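(* There exists an algorithm that, given a tropical curve $\Gamma$ and a divisor $D$ on $\Gamma$, computes (in finite time on every input) the rank $r_\Gamma(D)$ of $D$.
   Context: Computational model: since edge lengths and positions of points may be irrational, the algorithm is allowed to perform real arithmetic operations (and comparisons) with infinite precision. The input consists of the underlying finite multigraph, the edge lengths in $(0,\infty]$, and the divisor given as a finite list of points (each described by an edge and a position on it, possibly $\infty$) with integer coefficients. A tropical curve $\Gamma$ is a finite connected multigraph (loops and parallel edges allowed) in which each edge is assigned a positive length, where edges incident with vertices of degree one are allowed to have infinite length. Each edge of finite length is identified with a closed interval of that length, the end points of the interval being identified with the end vertices of the edge; each edge of infinite length is identified with the interval $[0,\infty]$, with $\infty$ identified with the vertex of degree one. The points corresponding to $\infty$ are called unbounded ends; they are points of $\Gamma$. $\mathrm{Div}(\Gamma)$ is the free abelian group on the set of all points of $\Gamma$; a divisor $D=\sum_v D(v)(v)$ is effective ($D\ge0$) if $D(v)\ge 0$ for all $v$, and $\deg(D)=\sum_v D(v)$. A rational function on $\Gamma$ is a continuous function $f:\Gamma\to\mathbb R\cup\{\pm\infty\}$ which is piecewise linear with finitely many pieces and integer slopes on every edge, and such that the only points $v$ with $f(v)=\pm\infty$ are unbounded ends. For a point $v$, $\mathrm{ord}_v(f)$ is the sum of the outgoing slopes of $f$ over all segments emanating from $v$ (so at an unbounded end, $\mathrm{ord}_v(f)$ is minus the slope of $f$ towards $\infty$ near that end), and $\mathrm{div}(f)=\sum_v\mathrm{ord}_v(f)(v)$. Divisors $D,D'$ are equivalent, $D\sim D'$,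 if $D=D'+\mathrm{div}(f)$ for some rational function $f$. Put $|D|=\{E\in\mathrm{Div}(\Gamma):E\ge0,\ E\sim D\}$. The rank of $D$ is $$r_\Gamma(D)=\min\{\deg(E):E\in\mathrm{Div}(\Gamma),\ E\ge0,\ |D-E|=\emptyset\}-1.$$ *)

theory Defs
  imports
    "HOL-Analysis.Analysis"
    "HOL-Library.Poly_Mapping"
    "Graph_Theory.Digraph_Component"
begin

section \<open>Tropical curves\<close>

text \<open>
  The underlying multigraph is a \<open>pre_digraph\<close>; the direction of an arc only fixes the
  parametrisation of the edge by \<open>[0, len e]\<close>, the tail being at position \<open>0\<close>.  On an unbounded
  edge the vertex at infinity is therefore the head.
\<close>

record ('v, 'e) metric_graph =
  graph :: "('v, 'e) pre_digraph"
  len :: "'e \<Rightarrow> ereal"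

abbreviation vertices :: "('v, 'e) metric_graph \<Rightarrow> 'v set" where
  "vertices \<Gamma> \<equiv> verts (graph \<Gamma>)"

abbreviation edges :: "('v, 'e) metric_graph \<Rightarrow> 'e set" where
  "edges \<Gamma> \<equiv> arcs (graph \<Gamma>)"

text \<open>A loop lies in both arc sets, hence contributes two to the degree of its vertex.\<close>

definition vertex_degree :: "('v, 'e) metric_graph \<Rightarrow> 'v \<Rightarrow> nat" where
  "vertex_degree \<Gamma> v = in_degree (graph \<Gamma>) v + out_degree (graph \<Gamma>) v"

definition tropical_curve :: "('v, 'e) metric_graph \<Rightarrow> bool" where
  "tropical_curve \<Gamma> \<longleftrightarrow>
     fin_digraph (graph \<Gamma>) \<and> Digraph_Component.connected (graph \<Gamma>) \<and>
     (\<forall>e \<in> edges \<Gamma>. 0 < len \<Gamma> e) \<and>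
     (\<forall>e \<in> edges \<Gamma>. len \<Gamma> e = \<infinity> \<longrightarrow> vertex_degree \<Gamma> (head (graph \<Gamma>) e) = 1)"

text \<open>
  The quotient of the disjoint union of the intervals \<open>[0, len e]\<close> by the identification of end
  points with vertices is represented by canonical representatives; \<open>chart\<close> is the quotient map.
\<close>

datatype ('v, 'e) point = Vertex 'v | Interior 'e real

definition chart :: "('v, 'e) metric_graph \<Rightarrow> 'e \<Rightarrow> ereal \<Rightarrow> ('v, 'e) point" where
  "chart \<Gamma> e x =
     (if x = 0 then Vertex (tail (graph \<Gamma>) e)
      else if x = len \<Gamma> e then Vertex (head (graph \<Gamma>) e)
      else Interior e (real_of_ereal x))"

definition points :: "('v, 'e) metric_graph \<Rightarrow> ('v, 'e) point set" where
  "points \<Gamma> = Vertex ` vertices \<Gamma> \<union> (\<Union>e \<in> edges \<Gamma>. chart \<Gamma> e ` {0..len \<Gamma> e})"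

definition unbounded_ends :: "('v, 'e) metric_graph \<Rightarrow> ('v, 'e) point set" where
  "unbounded_ends \<Gamma> = {chart \<Gamma> e \<infinity> | e. e \<in> edges \<Gamma> \<and> len \<Gamma> e = \<infinity>}"


section \<open>Rational functions\<close>

text \<open>
  The function \<open>g\<close> on \<open>[0, l]\<close> is affine with integer slope on each of the finitely many open
  intervals between consecutive entries of \<open>ts\<close>.
\<close>

definition piecewise_linear :: "ereal \<Rightarrow> (ereal \<Rightarrow> ereal) \<Rightarrow> bool" where
  "piecewise_linear l g \<longleftrightarrow>
     (\<exists>ts. ts \<noteq> [] \<and> sorted_wrt (<) ts \<and> hd ts = 0 \<and> last ts = l \<and>
        (\<forall>i. Suc i < length ts \<longrightarrow>
           (\<exists>(s::int) (a::real). \<forall>x::real. ts ! i < ereal x \<and> ereal x < ts ! Suc i \<longrightarrow>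
              g (ereal x) = ereal (a + of_int s * x))))"

text \<open>
  Continuity for the quotient topology of \<open>\<Gamma>\<close> means continuity in every chart.  Values outside
  \<open>points \<Gamma>\<close> are irrelevant.
\<close>

definition rational_function :: "('v, 'e) metric_graph \<Rightarrow> (('v, 'e) point \<Rightarrow> ereal) \<Rightarrow> bool" where
  "rational_function \<Gamma> f \<longleftrightarrow>
     (\<forall>e \<in> edges \<Gamma>. continuous_on {0..len \<Gamma> e} (\<lambda>x. f (chart \<Gamma> e x)) \<and>
                    piecewise_linear (len \<Gamma> e) (\<lambda>x. f (chart \<Gamma> e x))) \<and>
     (\<forall>v \<in> points \<Gamma>. \<bar>f v\<bar> = \<infinity> \<longrightarrow> v \<in> unbounded_ends \<Gamma>)"

text \<open>
  The slope of \<open>g\<close> along a filter on the extended reals: \<open>at_right x\<close> and \<open>at_left x\<close> give the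
  one-sided slopes at \<open>x\<close>, and \<open>at_left \<infinity>\<close> gives the slope near infinity.
\<close>

definition slope :: "(ereal \<Rightarrow> ereal) \<Rightarrow> ereal filter \<Rightarrow> int" where
  "slope g F =
     (THE s::int. \<exists>a::real. \<forall>\<^sub>F x in F. g x = ereal (a + of_int s * real_of_ereal x))"

text \<open>
  A segment emanating from \<open>v\<close> is given by an edge \<open>e\<close>, a position \<open>x\<close> on it representing \<open>v\<close>, and a
  direction; the outgoing slope in the backward direction is the negative of the left slope.
\<close>

definition ord :: "('v, 'e) metric_graph \<Rightarrow> (('v, 'e) point \<Rightarrow> ereal) \<Rightarrow> ('v, 'e) point \<Rightarrow> int" where
  "ord \<Gamma> f v =
     (\<Sum>(e, x) \<in> {(e, x). e \<in> edges \<Gamma> \<and> 0 \<le> x \<and> x < len \<Gamma> e \<and> chart \<Gamma> e x = v}.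
        slope (\<lambda>y. f (chart \<Gamma> e y)) (at_right x)) +
     (\<Sum>(e, x) \<in> {(e, x). e \<in> edges \<Gamma> \<and> 0 < x \<and> x \<le> len \<Gamma> e \<and> chart \<Gamma> e x = v}.
        - slope (\<lambda>y. f (chart \<Gamma> e y)) (at_left x))"


section \<open>Divisors and rank\<close>

type_synonym ('v, 'e) divisor = "('v, 'e) point \<Rightarrow>\<^sub>0 int"

definition Div :: "('v, 'e) metric_graph \<Rightarrow> ('v, 'e) divisor set" where
  "Div \<Gamma> = {D. Poly_Mapping.keys D \<subseteq> points \<Gamma>}"

text \<open>The order that the library puts on \<open>\<Rightarrow>\<^sub>0\<close> is not the pointwise one.\<close>

definition effective :: "('v, 'e) divisor \<Rightarrow> bool" where
  "effective D \<longleftrightarrow> (\<forall>v. 0 \<le> Poly_Mapping.lookup D v)"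

definition deg :: "('v, 'e) divisor \<Rightarrow> int" where
  "deg D = (\<Sum>v \<in> Poly_Mapping.keys D. Poly_Mapping.lookup D v)"

text \<open>The support of \<open>ord \<Gamma> f\<close> is finite if \<open>f\<close> is rational, see \<open>finite_ord_support\<close> below.\<close>

definition div_of :: "('v, 'e) metric_graph \<Rightarrow> (('v, 'e) point \<Rightarrow> ereal) \<Rightarrow> ('v, 'e) divisor" where
  "div_of \<Gamma> f = Abs_poly_mapping (ord \<Gamma> f)"

lemma strict_list_gap:
  fixes x :: "'a::linorder"
  assumes "sorted_wrt (<) ts" "ts \<noteq> []" "hd ts < x" "x < last ts" "x \<notin> set ts"
  shows "\<exists>i. Suc i < length ts \<and> ts ! i < x \<and> x < ts ! Suc i"
  using assms
proof (induction ts)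
  case (Cons t ts)
  then have "ts \<noteq> []" by (cases ts) auto
  show ?case
  proof (cases "x < hd ts")
    case True
    then show ?thesis using Cons.prems \<open>ts \<noteq> []\<close> by (intro exI[of _ 0]) (auto simp: hd_conv_nth)
  next
    case False
    then have "hd ts < x"
      using Cons.prems \<open>ts \<noteq> []\<close> by (metis hd_in_set list.set_intros(2) linorder_neqE)
    then obtain i where "Suc i < length ts \<and> ts ! i < x \<and> x < ts ! Suc i"
      using Cons \<open>ts \<noteq> []\<close> by auto
    then show ?thesis by (intro exI[of _ "Suc i"]) auto
  qed
qed simp

lemma slope_eqI:
  assumes g: "\<forall>\<^sub>F x in F. g x = ereal (a + of_int s * real_of_ereal x)"
    and F: "F \<noteq> bot" "F \<le> at y"
  shows "slope g F = s"
  unfolding slope_def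
proof (rule the_equality)
  show "\<exists>a::real. \<forall>\<^sub>F x in F. g x = ereal (a + of_int s * real_of_ereal x)" using g by blast
next
  fix s' :: int
  assume "\<exists>a::real. \<forall>\<^sub>F x in F. g x = ereal (a + of_int s' * real_of_ereal x)"
  then obtain a' :: real where g': "\<forall>\<^sub>F x in F. g x = ereal (a' + of_int s' * real_of_ereal x)"
    by blast
  show "s' = s"
  proof (rule ccontr)
    assume "s' \<noteq> s"
    define c where "c = (a - a') / (of_int s' - of_int s)"
    have neq: "\<forall>\<^sub>F x in F. x \<noteq> z" for z :: ereal
      using filter_leD[OF F(2) eventually_neq_at_within] .
    have "\<forall>\<^sub>F x in F. False"
      using g g' neq[of \<infinity>] neq[of "-\<infinity>"] neq[of "ereal c"]
    proof eventually_elim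
      case (elim x)
      then obtain r where r: "x = ereal r" by (cases x) auto
      with elim have "a + of_int s * r = a' + of_int s' * r" by simp
      then have "r * (of_int s' - of_int s) = a - a'" by (simp add: algebra_simps)
      then have "r = c" using \<open>s' \<noteq> s\<close> by (simp add: c_def field_simps)
      with elim r show False by simp
    qed
    with F(1) show False by (simp add: trivial_limit_def)
  qed
qed

lemma finite_ord_support:
  assumes \<Gamma>: "fin_digraph (graph \<Gamma>)" and f: "rational_function \<Gamma> f"
  shows "finite {v. ord \<Gamma> f v \<noteq> 0}"
proof -
  interpret fin_digraph "graph \<Gamma>" by (rule \<Gamma>)
  define bp where "bp e ts \<longleftrightarrow> ts \<noteq> [] \<and> sorted_wrt (<) ts \<and> hd ts = 0 \<and> last ts = len \<Gamma> e \<and>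
        (\<forall>i. Suc i < length ts \<longrightarrow>
           (\<exists>(s::int) (a::real). \<forall>x::real. ts ! i < ereal x \<and> ereal x < ts ! Suc i \<longrightarrow>
              f (chart \<Gamma> e (ereal x)) = ereal (a + of_int s * x)))" for e and ts :: "ereal list"
  have "\<forall>e \<in> edges \<Gamma>. \<exists>ts. bp e ts"
    using f unfolding rational_function_def piecewise_linear_def bp_def by blast
  then obtain ts where ts: "\<And>e. e \<in> edges \<Gamma> \<Longrightarrow> bp e (ts e)" by metis
  let ?B = "Vertex ` vertices \<Gamma> \<union> (\<Union>e \<in> edges \<Gamma>. (\<lambda>x. Interior e (real_of_ereal x)) ` set (ts e))"
  have "ord \<Gamma> f v = 0" if v: "v \<notin> ?B" for v
  proof (cases v)
    case (Vertex u)
    then have "u \<notin> vertices \<Gamma>" using v by auto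
    then have "chart \<Gamma> e x \<noteq> v" if "e \<in> edges \<Gamma>" for e x
      using that Vertex by (auto simp: chart_def)
    then have "{(e, x). e \<in> edges \<Gamma> \<and> 0 \<le> x \<and> x < len \<Gamma> e \<and> chart \<Gamma> e x = v} = {}"
      "{(e, x). e \<in> edges \<Gamma> \<and> 0 < x \<and> x \<le> len \<Gamma> e \<and> chart \<Gamma> e x = v} = {}" by auto
    then show ?thesis by (simp only: ord_def sum.empty)
  next
    case (Interior e r)
    have iff: "chart \<Gamma> e' x = v \<longleftrightarrow> e' = e \<and> x = ereal r \<and> x \<noteq> 0"
      if "0 \<le> x" "x < len \<Gamma> e'" for e' x
      using that Interior by (cases x) (auto simp: chart_def)
    have iff': "chart \<Gamma> e' x = v \<longleftrightarrow> e' = e \<and> x = ereal r \<and> x < len \<Gamma> e'"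
      if "0 < x" "x \<le> len \<Gamma> e'" for e' x
      using that Interior by (cases x) (auto simp: chart_def)
    show ?thesis
    proof (cases "e \<in> edges \<Gamma> \<and> 0 < r \<and> ereal r < len \<Gamma> e")
      case False
      then have "{(e, x). e \<in> edges \<Gamma> \<and> 0 \<le> x \<and> x < len \<Gamma> e \<and> chart \<Gamma> e x = v} = {}"
        "{(e, x). e \<in> edges \<Gamma> \<and> 0 < x \<and> x \<le> len \<Gamma> e \<and> chart \<Gamma> e x = v} = {}"
        using iff iff' by (auto simp: zero_ereal_def)
      then show ?thesis by (simp only: ord_def sum.empty)
    next
      case True
      have S: "{(e, x). e \<in> edges \<Gamma> \<and> 0 \<le> x \<and> x < len \<Gamma> e \<and> chart \<Gamma> e x = v} = {(e, ereal r)}"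
        "{(e, x). e \<in> edges \<Gamma> \<and> 0 < x \<and> x \<le> len \<Gamma> e \<and> chart \<Gamma> e x = v} = {(e, ereal r)}"
        using True iff iff' by (auto simp: zero_ereal_def)
      have "ereal r \<notin> set (ts e)" using v True Interior by force
      with True ts[of e] obtain i where i: "Suc i < length (ts e)" "ts e ! i < ereal r"
          "ereal r < ts e ! Suc i"
        using strict_list_gap[of "ts e" "ereal r"] by (auto simp: bp_def)
      with True ts[of e] obtain s :: int and a :: real where
        sa: "\<And>x::real. ts e ! i < ereal x \<Longrightarrow> ereal x < ts e ! Suc i \<Longrightarrow>
              f (chart \<Gamma> e (ereal x)) = ereal (a + of_int s * x)"
        unfolding bp_def by blast
      have sa': "f (chart \<Gamma> e x) = ereal (a + of_int s * real_of_ereal x)"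
        if "ts e ! i < x" "x < ts e ! Suc i" for x
        using that sa by (cases x) auto
      have "slope (\<lambda>y. f (chart \<Gamma> e y)) (at_right (ereal r)) = s"
      proof (rule slope_eqI[where y = "ereal r"])
        show "\<forall>\<^sub>F x in at_right (ereal r).
            f (chart \<Gamma> e x) = ereal (a + of_int s * real_of_ereal x)"
          using i sa' by (subst eventually_at_right[OF i(3)]) (meson less_trans)
        show "at_right (ereal r) \<noteq> bot"
          unfolding trivial_limit_def eventually_at_right[OF i(3)] using dense by blast
      qed (simp add: at_le)
      moreover have "slope (\<lambda>y. f (chart \<Gamma> e y)) (at_left (ereal r)) = s"
      proof (rule slope_eqI[where y = "ereal r"])
        show "\<forall>\<^sub>F x in at_left (ereal r).
            f (chart \<Gamma> e x) = ereal (a + of_int s * real_of_ereal x)"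
          using i sa' by (subst eventually_at_left[OF i(2)]) (meson less_trans)
        show "at_left (ereal r) \<noteq> bot"
          unfolding trivial_limit_def eventually_at_left[OF i(2)] using dense by blast
      qed (simp add: at_le)
      ultimately show ?thesis unfolding ord_def S by simp
    qed
  qed
  then have "{v. ord \<Gamma> f v \<noteq> 0} \<subseteq> ?B" by blast
  then show ?thesis by (rule finite_subset) auto
qed

lemma lookup_div_of:
  assumes "fin_digraph (graph \<Gamma>)" "rational_function \<Gamma> f"
  shows "Poly_Mapping.lookup (div_of \<Gamma> f) = ord \<Gamma> f"
  unfolding div_of_def using finite_ord_support[OF assms] by (rule Abs_poly_mapping_inverse[OF CollectI])

definition equivalent :: "('v, 'e) metric_graph \<Rightarrow> ('v, 'e) divisor \<Rightarrow> ('v, 'e) divisor \<Rightarrow> bool" where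
  "equivalent \<Gamma> D D' \<longleftrightarrow> (\<exists>f. rational_function \<Gamma> f \<and> D = D' + div_of \<Gamma> f)"

definition linear_system :: "('v, 'e) metric_graph \<Rightarrow> ('v, 'e) divisor \<Rightarrow> ('v, 'e) divisor set" where
  "linear_system \<Gamma> D = {E \<in> Div \<Gamma>. effective E \<and> equivalent \<Gamma> E D}"

definition divisor_rank :: "('v, 'e) metric_graph \<Rightarrow> ('v, 'e) divisor \<Rightarrow> int" where
  "divisor_rank \<Gamma> D =
     (LEAST d. \<exists>E \<in> Div \<Gamma>. effective E \<and> linear_system \<Gamma> (D - E) = {} \<and> deg E = d) - 1"


section \<open>Programs over the real numbers\<close>

text \<open>
  The computational model is a real RAM presented as a while language.  It has two unbounded
  memories with indirect addressing, one for integers and one for real numbers.  Real numbers are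
  subject to exact field operations and comparisons only: there is no rounding, and a program
  contains no real constants except those coming from integers.  Negative addresses are read
  as \<open>0\<close>, and division by zero yields \<open>0\<close>.
\<close>

record state =
  imem :: "nat \<Rightarrow> int"
  rmem :: "nat \<Rightarrow> real"

datatype iexp =
    IConst int
  | ILoad iexp
  | IAdd iexp iexp
  | ISub iexp iexp
  | IMul iexp iexp
  | IDiv iexp iexp
  | IMod iexp iexp

datatype rexp =
    ROfInt iexp
  | RLoad iexp
  | RAdd rexp rexp
  | RSub rexp rexp
  | RMul rexp rexp
  | RDiv rexp rexp

datatype bexp =
    ILess iexp iexp
  | RLess rexp rexp
  | BNot bexp
  | BAnd bexp bexp

datatype com =
    Skip
  | IStore iexp iexp
  | RStore iexp rexp
  | Seq com com
  | Cond bexp com com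
  | While bexp com

fun ival :: "iexp \<Rightarrow> state \<Rightarrow> int" where
  "ival (IConst k) \<sigma> = k"
| "ival (ILoad a) \<sigma> = imem \<sigma> (nat (ival a \<sigma>))"
| "ival (IAdd a b) \<sigma> = ival a \<sigma> + ival b \<sigma>"
| "ival (ISub a b) \<sigma> = ival a \<sigma> - ival b \<sigma>"
| "ival (IMul a b) \<sigma> = ival a \<sigma> * ival b \<sigma>"
| "ival (IDiv a b) \<sigma> = ival a \<sigma> div ival b \<sigma>"
| "ival (IMod a b) \<sigma> = ival a \<sigma> mod ival b \<sigma>"

fun rval :: "rexp \<Rightarrow> state \<Rightarrow> real" where
  "rval (ROfInt a) \<sigma> = of_int (ival a \<sigma>)"
| "rval (RLoad a) \<sigma> = rmem \<sigma> (nat (ival a \<sigma>))"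
| "rval (RAdd a b) \<sigma> = rval a \<sigma> + rval b \<sigma>"
| "rval (RSub a b) \<sigma> = rval a \<sigma> - rval b \<sigma>"
| "rval (RMul a b) \<sigma> = rval a \<sigma> * rval b \<sigma>"
| "rval (RDiv a b) \<sigma> = rval a \<sigma> / rval b \<sigma>"

fun bval :: "bexp \<Rightarrow> state \<Rightarrow> bool" where
  "bval (ILess a b) \<sigma> \<longleftrightarrow> ival a \<sigma> < ival b \<sigma>"
| "bval (RLess a b) \<sigma> \<longleftrightarrow> rval a \<sigma> < rval b \<sigma>"
| "bval (BNot b) \<sigma> \<longleftrightarrow> \<not> bval b \<sigma>"
| "bval (BAnd b c) \<sigma> \<longleftrightarrow> bval b \<sigma> \<and> bval c \<sigma>"

text \<open>\<open>exec P \<sigma> \<tau>\<close>: started in \<open>\<sigma>\<close>, the program \<open>P\<close> halts in \<open>\<tau>\<close> after finitely many steps.\<close>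

inductive exec :: "com \<Rightarrow> state \<Rightarrow> state \<Rightarrow> bool" where
  Skip: "exec Skip \<sigma> \<sigma>"
| IStore: "exec (IStore a b) \<sigma> (\<sigma>\<lparr>imem := (imem \<sigma>)(nat (ival a \<sigma>) := ival b \<sigma>)\<rparr>)"
| RStore: "exec (RStore a r) \<sigma> (\<sigma>\<lparr>rmem := (rmem \<sigma>)(nat (ival a \<sigma>) := rval r \<sigma>)\<rparr>)"
| Seq: "exec P \<sigma> \<tau> \<Longrightarrow> exec Q \<tau> \<upsilon> \<Longrightarrow> exec (Seq P Q) \<sigma> \<upsilon>"
| CondTrue: "bval b \<sigma> \<Longrightarrow> exec P \<sigma> \<tau> \<Longrightarrow> exec (Cond b P Q) \<sigma> \<tau>"
| CondFalse: "\<not> bval b \<sigma> \<Longrightarrow> exec Q \<sigma> \<tau> \<Longrightarrow> exec (Cond b P Q) \<sigma> \<tau>"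
| WhileFalse: "\<not> bval b \<sigma> \<Longrightarrow> exec (While b P) \<sigma> \<sigma>"
| WhileTrue: "bval b \<sigma> \<Longrightarrow> exec P \<sigma> \<tau> \<Longrightarrow> exec (While b P) \<tau> \<upsilon> \<Longrightarrow> exec (While b P) \<sigma> \<upsilon>"

inductive_cases exec_elims:
  "exec Skip \<sigma> \<tau>" "exec (IStore a b) \<sigma> \<tau>" "exec (RStore a r) \<sigma> \<tau>" "exec (Seq P Q) \<sigma> \<tau>"
  "exec (Cond b P Q) \<sigma> \<tau>" "exec (While b P) \<sigma> \<tau>"

lemma exec_deterministic: "exec P \<sigma> \<tau> \<Longrightarrow> exec P \<sigma> \<tau>' \<Longrightarrow> \<tau>' = \<tau>"
proof (induction arbitrary: \<tau>' rule: exec.induct)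
  case (Skip \<sigma>)
  then show ?case by (rule exec_elims(1))
next
  case (IStore a b \<sigma>)
  then show ?case by (rule exec_elims(2))
next
  case (RStore a r \<sigma>)
  then show ?case by (rule exec_elims(3))
next
  case (Seq P \<sigma> \<tau> Q \<upsilon>)
  from Seq.prems obtain \<rho> where "exec P \<sigma> \<rho>" "exec Q \<rho> \<tau>'" by (rule exec_elims(4))
  with Seq.IH show ?case by metis
next
  case (CondTrue b \<sigma> P \<tau> Q)
  then show ?case by (metis exec_elims(5))
next
  case (CondFalse b \<sigma> Q \<tau> P)
  then show ?case by (metis exec_elims(5))
next
  case (WhileFalse b \<sigma> P)
  then show ?case by (metis exec_elims(6))
next
  case (WhileTrue b \<sigma> P \<tau> \<upsilon>)
  from WhileTrue.prems WhileTrue.hyps(1) obtain \<rho> where "exec P \<sigma> \<rho>" "exec (While b P) \<rho> \<tau>'"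
    by (metis exec_elims(6))
  with WhileTrue.IH show ?case by metis
qed

definition load :: "int list \<Rightarrow> real list \<Rightarrow> state" where
  "load is rs =
     \<lparr>imem = (\<lambda>i. if i < length is then is ! i else 0),
      rmem = (\<lambda>i. if i < length rs then rs ! i else 0)\<rparr>"

text \<open>The input is placed at the beginning of the memories, the result is an integer in cell \<open>0\<close>.\<close>

definition computes :: "com \<Rightarrow> int list \<times> real list \<Rightarrow> int \<Rightarrow> bool" where
  "computes P input k \<longleftrightarrow> (\<exists>\<tau>. exec P (load (fst input) (snd input)) \<tau> \<and> imem \<tau> 0 = k)"


section \<open>Encoding of the input\<close>

text \<open>
  As part of the encoding, vertices and edges are numbered consecutively from \<open>0\<close>.
\<close>

definition numbered :: "(nat, nat) metric_graph \<Rightarrow> bool" where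
  "numbered \<Gamma> \<longleftrightarrow>
     vertices \<Gamma> = {..<card (vertices \<Gamma>)} \<and> edges \<Gamma> = {..<card (edges \<Gamma>)}"

text \<open>
  A point is given by an edge and a position on it; different descriptions may denote the same
  point.  A vertex may also be named directly, since the curve consisting of a single
  vertex has no edge.
\<close>

datatype description = At nat | On nat ereal

fun valid_description :: "(nat, nat) metric_graph \<Rightarrow> description \<Rightarrow> bool" where
  "valid_description \<Gamma> (At v) \<longleftrightarrow> v \<in> vertices \<Gamma>"
| "valid_description \<Gamma> (On e x) \<longleftrightarrow> e \<in> edges \<Gamma> \<and> 0 \<le> x \<and> x \<le> len \<Gamma> e"

fun described_point :: "(nat, nat) metric_graph \<Rightarrow> description \<Rightarrow> (nat, nat) point" where
  "described_point \<Gamma> (At v) = Vertex v"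
| "described_point \<Gamma> (On e x) = chart \<Gamma> e x"

definition describes ::
    "(nat, nat) metric_graph \<Rightarrow> (int \<times> description) list \<Rightarrow> (nat, nat) divisor \<Rightarrow> bool" where
  "describes \<Gamma> ds D \<longleftrightarrow>
     (\<forall>(k, p) \<in> set ds. valid_description \<Gamma> p) \<and>
     D = (\<Sum>(k, p) \<leftarrow> ds. frag_cmul k (frag_of (described_point \<Gamma> p)))"

lemma ex_describes:
  assumes "D \<in> Div \<Gamma>"
  shows "\<exists>ds. describes \<Gamma> ds D"
proof -
  have ex: "\<exists>p. valid_description \<Gamma> p \<and> described_point \<Gamma> p = v" if v: "v \<in> points \<Gamma>" for v
  proof -
    consider u where "u \<in> vertices \<Gamma>" "v = Vertex u"
      | e x where "e \<in> edges \<Gamma>" "0 \<le> x" "x \<le> len \<Gamma> e" "v = chart \<Gamma> e x"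
      using v by (auto simp: points_def)
    then show ?thesis
    proof cases
      case (1 u)
      then show ?thesis by (intro exI[of _ "At u"]) simp
    next
      case (2 e x)
      then show ?thesis by (intro exI[of _ "On e x"]) simp
    qed
  qed
  have "Poly_Mapping.keys D \<subseteq> points \<Gamma>" using assms by (simp add: Div_def)
  then show ?thesis
  proof (induction D rule: frag_induction)
    case zero
    show ?case by (intro exI[of _ "[]"]) (simp add: describes_def)
  next
    case (one v)
    then obtain p where "valid_description \<Gamma> p" "described_point \<Gamma> p = v" using ex by blast
    then show ?case by (intro exI[of _ "[(1, p)]"]) (simp add: describes_def)
  next
    case (diff a b)
    then obtain as bs where as: "describes \<Gamma> as a" and bs: "describes \<Gamma> bs b" by blast
    have neg: "(\<Sum>(k, p) \<leftarrow> map (\<lambda>(k, p). (- k, p)) bs. frag_cmul k (frag_of (described_point \<Gamma> p)))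
        = - (\<Sum>(k, p) \<leftarrow> bs. frag_cmul k (frag_of (described_point \<Gamma> p)))" for bs
      by (induction bs) auto
    show ?case
      using as bs neg[of bs]
      by (intro exI[of _ "as @ map (\<lambda>(k, p). (- k, p)) bs"]) (auto simp: describes_def)
  qed
qed

text \<open>
  An extended real \<open>x \<ge> 0\<close> is encoded by the integer \<open>inf_flag x\<close> together with the real number
  \<open>real_of_ereal x\<close>, which is \<open>0\<close> if \<open>x\<close> is infinite.
\<close>

definition inf_flag :: "ereal \<Rightarrow> int" where
  "inf_flag x = (if x = \<infinity> then 1 else 0)"

fun description_ints :: "description \<Rightarrow> int list" where
  "description_ints (At v) = [0, int v, 0]"
| "description_ints (On e x) = [1, int e, inf_flag x]"

fun description_real :: "description \<Rightarrow> real" where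
  "description_real (At v) = 0"
| "description_real (On e x) = real_of_ereal x"

definition encode ::
    "(nat, nat) metric_graph \<Rightarrow> (int \<times> description) list \<Rightarrow> int list \<times> real list" where
  "encode \<Gamma> ds =
     ([int (card (vertices \<Gamma>)), int (card (edges \<Gamma>)), int (length ds)]
        @ concat (map (\<lambda>e. [int (tail (graph \<Gamma>) e), int (head (graph \<Gamma>) e), inf_flag (len \<Gamma> e)])
                    [0..<card (edges \<Gamma>)])
        @ concat (map (\<lambda>(k, p). k # description_ints p) ds),
      map (\<lambda>e. real_of_ereal (len \<Gamma> e)) [0..<card (edges \<Gamma>)]
        @ map (\<lambda>(k, p). description_real p) ds)"

end

theory Submission
  imports Defs
begin

text \<open>
  A divisor is the divisor of a rational function iff there are integers \<open>s\<^sub>e\<close> (initial slopes) and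
  reals \<open>h\<^sub>v\<close> (values at the vertices) that satisfy a balancing condition at every vertex and, for
  every edge of finite length \<open>l\<close> with chips \<open>k\<^sub>j\<close> at \<open>x\<^sub>j\<close>, the equation
  \<open>h\<^sub>w - h\<^sub>u = s\<^sub>e l + \<Sum>\<^sub>j k\<^sub>j (l - x\<^sub>j)\<close>.  A level set argument bounds the slopes.  So \<open>r(D) + 1\<close> is the least
  \<open>d\<close> such that for some \<open>d\<close> points, for all \<open>deg D - d\<close> further points and all \<open>s\<close> and \<open>h\<close> these
  equations fail.  For fixed \<open>d\<close> this is a statement about reals whose atoms are signs of linear
  forms with bounded integer coefficients.  Following Ferrante and Rackoff, the real quantifiers may be
  restricted to rational combinations of the input numbers with bounded numerators and
  denominators.  They become bounded quantifiers over integer codes, and a formula with bounded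
  quantifiers only is evaluated by loops.
\<close>

section \<open>Closure properties of the computable functions\<close>

text \<open>Both the divisor subtracted from \<open>D\<close> and the candidates for the remaining
  points range over a continuum. The search becomes finite because the unknown reals, positions and
  vertex values, occur only linearly: every product has an integer factor, a slope or a given
  coefficient. The slope bound therefore does double duty. It makes the slopes a finite choice, and
  it bounds the coefficients of the linear forms, without which the sample points would not be
  bounded either. Whether an unknown point is a vertex or lies on a given edge is a finite choice
  too, and once it is known to lie on an edge of length \<open>l\<close> at \<open>x\<close>, the
  hinge \<open>max 0 (l - x)\<close> is simply \<open>l - x\<close>.

  The alternation of the quantifiers forces two radii. The sample for the first block depends on the
  input alone; the sample for the second block has to be fine enough over every vector that can be
  decoded for the first block, and such a vector already carries denominators. Each elimination
  cross-multiplies two forms, so the bounds are iterated squares, computable from the input; this is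
  why one program serves all inputs.\<close>

type_synonym input = "int list \<times> real list"

definition geti :: "input \<Rightarrow> nat \<Rightarrow> int" where
  "geti x i = (if i < length (fst x) then fst x ! i else 0)"

definition getr :: "input \<Rightarrow> nat \<Rightarrow> real" where
  "getr x i = (if i < length (snd x) then snd x ! i else 0)"

text \<open>The header has 3 cells, each edge takes 3 and each chip 4; every edge and every chip
  contributes one real. A program can thus compute where its free memory begins.\<close>

definition wf_input :: "input \<Rightarrow> bool" where
  "wf_input x \<longleftrightarrow> 3 \<le> length (fst x) \<and>
     int (length (fst x)) = 3 + 3 * geti x 1 + 4 * geti x 2 \<and>
     int (length (snd x)) = geti x 1 + geti x 2"

definition holds :: "input \<Rightarrow> state \<Rightarrow> bool" where
  "holds x \<sigma> \<longleftrightarrow> (\<forall>i < length (fst x). imem \<sigma> i = geti x i) \<and> (\<forall>i < length (snd x). rmem \<sigma> i = getr x i)"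

text \<open>
  The input is never overwritten; the registers are the cells behind it, so their addresses are
  computed from the three integers at the beginning of the input.
\<close>

definition ireg :: "input \<Rightarrow> state \<Rightarrow> nat \<Rightarrow> int" where
  "ireg x \<sigma> k = imem \<sigma> (length (fst x) + k)"

definition rreg :: "input \<Rightarrow> state \<Rightarrow> nat \<Rightarrow> real" where
  "rreg x \<sigma> k = rmem \<sigma> (length (snd x) + k)"

definition ilen_exp :: iexp where
  "ilen_exp = IAdd (IConst 3) (IAdd (IMul (IConst 3) (ILoad (IConst 1))) (IMul (IConst 4) (ILoad (IConst 2))))"

definition rlen_exp :: iexp where
  "rlen_exp = IAdd (ILoad (IConst 1)) (ILoad (IConst 2))"

definition IReg :: "nat \<Rightarrow> iexp" where
  "IReg k = ILoad (IAdd ilen_exp (IConst (int k)))"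

definition RReg :: "nat \<Rightarrow> rexp" where
  "RReg k = RLoad (IAdd rlen_exp (IConst (int k)))"

definition SetI :: "nat \<Rightarrow> iexp \<Rightarrow> com" where
  "SetI k e = IStore (IAdd ilen_exp (IConst (int k))) e"

definition SetR :: "nat \<Rightarrow> rexp \<Rightarrow> com" where
  "SetR k e = RStore (IAdd rlen_exp (IConst (int k))) e"

definition seti :: "input \<Rightarrow> nat \<Rightarrow> int \<Rightarrow> state \<Rightarrow> state" where
  "seti x k v \<sigma> = \<sigma>\<lparr>imem := (imem \<sigma>)(length (fst x) + k := v)\<rparr>"

definition setr :: "input \<Rightarrow> nat \<Rightarrow> real \<Rightarrow> state \<Rightarrow> state" where
  "setr x k v \<sigma> = \<sigma>\<lparr>rmem := (rmem \<sigma>)(length (snd x) + k := v)\<rparr>"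

lemma ireg_set [simp]:
  "ireg x (seti x k v \<sigma>) j = (if j = k then v else ireg x \<sigma> j)"
  "ireg x (setr x k w \<sigma>) j = ireg x \<sigma> j"
  by (auto simp: ireg_def seti_def setr_def)

lemma rreg_set [simp]:
  "rreg x (setr x k w \<sigma>) j = (if j = k then w else rreg x \<sigma> j)"
  "rreg x (seti x k v \<sigma>) j = rreg x \<sigma> j"
  by (auto simp: rreg_def seti_def setr_def)

lemma holds_set [simp]:
  "holds x (seti x k v \<sigma>) = holds x \<sigma>" "holds x (setr x k w \<sigma>) = holds x \<sigma>"
  by (auto simp: holds_def seti_def setr_def)

lemma len_exps:
  assumes "wf_input x" "holds x \<sigma>"
  shows "ival ilen_exp \<sigma> = int (length (fst x))" "ival rlen_exp \<sigma> = int (length (snd x))"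
  using assms by (auto simp: wf_input_def holds_def ilen_exp_def rlen_exp_def)

lemma val_Reg [simp]:
  assumes "wf_input x" "holds x \<sigma>"
  shows "ival (IReg k) \<sigma> = ireg x \<sigma> k" "rval (RReg k) \<sigma> = rreg x \<sigma> k"
  by (simp_all add: IReg_def RReg_def len_exps[OF assms] ireg_def rreg_def nat_add_distrib)

section \<open>Total correctness of programs\<close>

text \<open>Since \<open>exec\<close> is deterministic, the existence of one halting run with a good
  final state is total correctness.\<close>

definition wp :: "com \<Rightarrow> (state \<Rightarrow> bool) \<Rightarrow> state \<Rightarrow> bool" where
  "wp P Q \<sigma> \<longleftrightarrow> (\<exists>\<tau>. exec P \<sigma> \<tau> \<and> Q \<tau>)"

lemma wp_Seq: "wp P (wp P' Q) \<sigma> \<Longrightarrow> wp (Seq P P') Q \<sigma>"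
  by (auto simp: wp_def intro: exec.Seq)

lemma wp_Cond: "(bval b \<sigma> \<Longrightarrow> wp P Q \<sigma>) \<Longrightarrow> (\<not> bval b \<sigma> \<Longrightarrow> wp P' Q \<sigma>) \<Longrightarrow> wp (Cond b P P') Q \<sigma>"
  by (cases "bval b \<sigma>") (auto simp: wp_def intro: exec.CondTrue exec.CondFalse)

lemma wp_SetI:
  assumes "wf_input x" "holds x \<sigma>" "Q (seti x k (ival e \<sigma>) \<sigma>)"
  shows "wp (SetI k e) Q \<sigma>"
  unfolding wp_def SetI_def
  using exec.IStore[of "IAdd ilen_exp (IConst (int k))" e \<sigma>] assms(3) len_exps[OF assms(1,2)]
  by (auto simp: seti_def nat_add_distrib)

lemma wp_SetR:
  assumes "wf_input x" "holds x \<sigma>" "Q (setr x k (rval e \<sigma>) \<sigma>)"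
  shows "wp (SetR k e) Q \<sigma>"
  unfolding wp_def SetR_def
  using exec.RStore[of "IAdd rlen_exp (IConst (int k))" e \<sigma>] assms(3) len_exps[OF assms(1,2)]
  by (auto simp: setr_def nat_add_distrib)

text \<open>The number \<open>n\<close> of rounds is fixed before the loop starts and serves as the
  variant. This is enough even for the unbounded search, where the proof, not the program, knows
  \<open>n\<close>.\<close>

lemma wp_While:
  fixes n :: nat
  assumes step: "\<And>i \<sigma>. I i \<sigma> \<Longrightarrow> i < n \<Longrightarrow> bval b \<sigma> \<and> wp P (I (Suc i)) \<sigma>"
    and exit: "\<And>\<sigma>. I n \<sigma> \<Longrightarrow> \<not> bval b \<sigma> \<and> Q \<sigma>"
    and start: "I 0 \<sigma>"
  shows "wp (While b P) Q \<sigma>"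
proof -
  have "I i \<sigma> \<Longrightarrow> i \<le> n \<Longrightarrow> wp (While b P) Q \<sigma>" for i \<sigma>
  proof (induction "n - i" arbitrary: i \<sigma>)
    case 0
    then have "I n \<sigma>" by simp
    then show ?case using exit unfolding wp_def by (blast intro: exec.WhileFalse)
  next
    case (Suc j)
    then have "bval b \<sigma>" "wp P (I (Suc i)) \<sigma>" using step[of i \<sigma>] by auto
    then obtain \<tau> where \<tau>: "exec P \<sigma> \<tau>" "I (Suc i) \<tau>" by (auto simp: wp_def)
    moreover have "j = n - Suc i" "Suc i \<le> n" using Suc.hyps(2) by auto
    ultimately have "wp (While b P) Q \<tau>" using Suc.hyps(1)[of "Suc i" \<tau>] by blast
    with \<tau> \<open>bval b \<sigma>\<close> show ?case unfolding wp_def by (blast intro: exec.WhileTrue)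
  qed
  with start show ?thesis by blast
qed

text \<open>The frame condition of a subprogram: the input and the registers below \<open>k\<close>
  and \<open>m\<close> survive, everything above is scratch space.\<close>

definition agree :: "nat \<Rightarrow> nat \<Rightarrow> input \<Rightarrow> state \<Rightarrow> state \<Rightarrow> bool" where
  "agree k m x \<sigma> \<tau> \<longleftrightarrow>
     holds x \<tau> \<and> (\<forall>j<k. ireg x \<tau> j = ireg x \<sigma> j) \<and> (\<forall>j<m. rreg x \<tau> j = rreg x \<sigma> j)"

text \<open>
  A context \<open>R\<close> assigns to \<open>a\<close> an input and the integer values of the variables that \<open>a\<close> consists
  of; \<open>ls\<close> lists the registers in which the variables are found.
\<close>

definition fits :: "('a \<Rightarrow> input \<times> int list) \<Rightarrow> nat list \<Rightarrow> 'a \<Rightarrow> state \<Rightarrow> bool" where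
  "fits R ls a \<sigma> \<longleftrightarrow> wf_input (fst (R a)) \<and> holds (fst (R a)) \<sigma> \<and>
     map (ireg (fst (R a)) \<sigma>) ls = snd (R a)"

text \<open>
  \<open>k\<close> and \<open>m\<close> are the first free registers of the two memories.  Quantifying over them makes it
  possible to keep intermediate results of subexpressions.
\<close>

definition icalc :: "com \<Rightarrow> ('a \<Rightarrow> input \<times> int list) \<Rightarrow> nat list \<Rightarrow> nat \<Rightarrow> nat \<Rightarrow> ('a \<Rightarrow> int) \<Rightarrow> bool" where
  "icalc P R ls k m F \<longleftrightarrow> (\<forall>a \<sigma>. fits R ls a \<sigma> \<longrightarrow>
     wp P (\<lambda>\<tau>. agree k m (fst (R a)) \<sigma> \<tau> \<and> ireg (fst (R a)) \<tau> k = F a) \<sigma>)"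

definition icomp :: "('a \<Rightarrow> input \<times> int list) \<Rightarrow> ('a \<Rightarrow> int) \<Rightarrow> bool" where
  "icomp R F \<longleftrightarrow> (\<forall>k m ls. (\<forall>l \<in> set ls. l < k) \<longrightarrow> (\<exists>P. icalc P R ls k m F))"

definition rcalc :: "com \<Rightarrow> ('a \<Rightarrow> input \<times> int list) \<Rightarrow> nat list \<Rightarrow> nat \<Rightarrow> nat \<Rightarrow> ('a \<Rightarrow> real) \<Rightarrow> bool" where
  "rcalc P R ls k m F \<longleftrightarrow> (\<forall>a \<sigma>. fits R ls a \<sigma> \<longrightarrow>
     wp P (\<lambda>\<tau>. agree k m (fst (R a)) \<sigma> \<tau> \<and> rreg (fst (R a)) \<tau> m = F a) \<sigma>)"

definition rcomp :: "('a \<Rightarrow> input \<times> int list) \<Rightarrow> ('a \<Rightarrow> real) \<Rightarrow> bool" where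
  "rcomp R F \<longleftrightarrow> (\<forall>k m ls. (\<forall>l \<in> set ls. l < k) \<longrightarrow> (\<exists>P. rcalc P R ls k m F))"

abbreviation ncomp :: "('a \<Rightarrow> input \<times> int list) \<Rightarrow> ('a \<Rightarrow> nat) \<Rightarrow> bool" where
  "ncomp R F \<equiv> icomp R (\<lambda>a. int (F a))"

abbreviation bcomp :: "('a \<Rightarrow> input \<times> int list) \<Rightarrow> ('a \<Rightarrow> bool) \<Rightarrow> bool" where
  "bcomp R Q \<equiv> icomp R (\<lambda>a. of_bool (Q a))"

definition base :: "input \<Rightarrow> input \<times> int list" where
  "base x = (x, [])"

text \<open>Enters the scope of one more bound variable, as in de Bruijn notation: the newest
  variable comes first, and \<open>e\<close> turns its value into an integer.\<close>

definition ext :: "('a \<Rightarrow> input \<times> int list) \<Rightarrow> ('b \<Rightarrow> int) \<Rightarrow> 'a \<times> 'b \<Rightarrow> input \<times> int list" where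
  "ext R e p = (fst (R (fst p)), e (snd p) # snd (R (fst p)))"

text \<open>Names the input as a function of the context, so that the closure rules can match
  occurrences of the input under any number of binders.\<close>

definition reads :: "('a \<Rightarrow> input \<times> int list) \<Rightarrow> ('a \<Rightarrow> input) \<Rightarrow> bool" where
  "reads R I \<longleftrightarrow> (\<forall>a. fst (R a) = I a)"

lemma reads_base [intro]: "reads base (\<lambda>x. x)"
  by (simp add: reads_def base_def)

lemma reads_ext [intro]: "reads R I \<Longrightarrow> reads (ext R e) (\<lambda>p. I (fst p))"
  by (simp add: reads_def ext_def)

lemma wp_mono: "wp P Q \<sigma> \<Longrightarrow> (\<And>\<tau>. Q \<tau> \<Longrightarrow> Q' \<tau>) \<Longrightarrow> wp P Q' \<sigma>"
  by (auto simp: wp_def)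

lemma icalcD:
  assumes "icalc P R ls k m F" "fits R ls a \<sigma>"
    "\<And>\<tau>. agree k m (fst (R a)) \<sigma> \<tau> \<Longrightarrow> ireg (fst (R a)) \<tau> k = F a \<Longrightarrow> Q \<tau>"
  shows "wp P Q \<sigma>"
  using assms unfolding icalc_def by (blast intro: wp_mono)

lemma icompD: "icomp R F \<Longrightarrow> \<forall>l \<in> set ls. l < k \<Longrightarrow> \<exists>P. icalc P R ls k m F"
  by (auto simp: icomp_def)

lemma rcalcD:
  assumes "rcalc P R ls k m F" "fits R ls a \<sigma>"
    "\<And>\<tau>. agree k m (fst (R a)) \<sigma> \<tau> \<Longrightarrow> rreg (fst (R a)) \<tau> m = F a \<Longrightarrow> Q \<tau>"
  shows "wp P Q \<sigma>"
  using assms unfolding rcalc_def by (blast intro: wp_mono)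

lemma rcompD: "rcomp R F \<Longrightarrow> \<forall>l \<in> set ls. l < k \<Longrightarrow> \<exists>P. rcalc P R ls k m F"
  by (auto simp: rcomp_def)

lemma icompI:
  assumes "\<And>k m ls. \<forall>l \<in> set ls. l < k \<Longrightarrow> \<exists>P. \<forall>a \<sigma>. fits R ls a \<sigma> \<longrightarrow>
        wp P (\<lambda>\<tau>. agree k m (fst (R a)) \<sigma> \<tau> \<and> ireg (fst (R a)) \<tau> k = F a) \<sigma>"
  shows "icomp R F"
  using assms unfolding icomp_def icalc_def by blast

lemma rcompI:
  assumes "\<And>k m ls. \<forall>l \<in> set ls. l < k \<Longrightarrow> \<exists>P. \<forall>a \<sigma>. fits R ls a \<sigma> \<longrightarrow>
        wp P (\<lambda>\<tau>. agree k m (fst (R a)) \<sigma> \<tau> \<and> rreg (fst (R a)) \<tau> m = F a) \<sigma>"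
  shows "rcomp R F"
  using assms unfolding rcomp_def rcalc_def by blast

text \<open>The variables live below the first free register, so running a subprogram cannot destroy
  them.\<close>

lemma fits_agree:
  assumes "fits R ls a \<sigma>" "agree k m (fst (R a)) \<sigma> \<tau>" "\<forall>l \<in> set ls. l < k"
  shows "fits R ls a \<tau>"
  using assms by (auto simp: fits_def agree_def intro!: map_cong dest!: sym[of "map _ _"])

lemma fitsD: "fits R ls a \<sigma> \<Longrightarrow> wf_input (fst (R a))" "fits R ls a \<sigma> \<Longrightarrow> holds (fst (R a)) \<sigma>"
  by (auto simp: fits_def)

lemma agree_refl: "holds x \<sigma> \<Longrightarrow> agree k m x \<sigma> \<sigma>"
  by (simp add: agree_def)

lemma agree_trans:
  "agree k m x \<sigma> \<tau> \<Longrightarrow> agree k' m' x \<tau> \<upsilon> \<Longrightarrow> k \<le> k' \<Longrightarrow> m \<le> m' \<Longrightarrow> agree k m x \<sigma> \<upsilon>"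
  by (simp add: agree_def)

lemma agree_seti [simp]: "k \<le> j \<Longrightarrow> agree k m x \<sigma> (seti x j v \<tau>) = agree k m x \<sigma> \<tau>"
  by (auto simp: agree_def)

lemma agree_setr [simp]: "m \<le> j \<Longrightarrow> agree k m x \<sigma> (setr x j v \<tau>) = agree k m x \<sigma> \<tau>"
  by (auto simp: agree_def)

lemma agreeD: "agree k m x \<sigma> \<tau> \<Longrightarrow> holds x \<tau>" "agree k m x \<sigma> \<tau> \<Longrightarrow> j < k \<Longrightarrow> ireg x \<tau> j = ireg x \<sigma> j"
  "agree k m x \<sigma> \<tau> \<Longrightarrow> j < m \<Longrightarrow> rreg x \<tau> j = rreg x \<sigma> j"
  by (auto simp: agree_def)

section \<open>Arithmetic, comparisons and access to the input\<close>

lemma icomp_const: "icomp R (\<lambda>a. c)"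
proof (rule icompI)
  fix k m ls
  show "\<exists>P. \<forall>a \<sigma>. fits R ls a \<sigma> \<longrightarrow>
        wp P (\<lambda>\<tau>. agree k m (fst (R a)) \<sigma> \<tau> \<and> ireg (fst (R a)) \<tau> k = c) \<sigma>"
  proof (intro exI[of _ "SetI k (IConst c)"] allI impI)
    fix a \<sigma> assume "fits R ls a \<sigma>"
    note fitsD[OF this]
    then show "wp (SetI k (IConst c)) (\<lambda>\<tau>. agree k m (fst (R a)) \<sigma> \<tau> \<and> ireg (fst (R a)) \<tau> k = c) \<sigma>"
      by (intro wp_SetI) (auto simp: agree_refl)
  qed
qed

lemma icomp_head: "icomp (ext R e) (\<lambda>p. e (snd p))"
proof (rule icompI)
  fix k m and ls :: "nat list"
  assume "\<forall>l\<in>set ls. l < k"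
  show "\<exists>P. \<forall>a \<sigma>. fits (ext R e) ls a \<sigma> \<longrightarrow>
        wp P (\<lambda>\<tau>. agree k m (fst (ext R e a)) \<sigma> \<tau> \<and> ireg (fst (ext R e a)) \<tau> k = e (snd a)) \<sigma>"
  proof (intro exI[of _ "SetI k (IReg (hd ls))"] allI impI)
    fix a \<sigma> assume f: "fits (ext R e) ls a \<sigma>"
    then have "ireg (fst (ext R e a)) \<sigma> (hd ls) = e (snd a)"
      by (cases ls) (auto simp: fits_def ext_def)
    with fitsD[OF f] show "wp (SetI k (IReg (hd ls)))
        (\<lambda>\<tau>. agree k m (fst (ext R e a)) \<sigma> \<tau> \<and> ireg (fst (ext R e a)) \<tau> k = e (snd a)) \<sigma>"
      by (intro wp_SetI) (auto simp: agree_refl)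
  qed
qed

lemma fits_ext: "fits (ext R e) ls p \<sigma> \<longleftrightarrow>
    (\<exists>l ls'. ls = l # ls' \<and> fits R ls' (fst p) \<sigma> \<and> ireg (fst (R (fst p))) \<sigma> l = e (snd p))"
  by (cases ls) (auto simp: fits_def ext_def)

lemma fst_ext [simp]: "fst (ext R e p) = fst (R (fst p))"
  by (simp add: ext_def)

lemma icomp_weaken:
  assumes "icomp R F"
  shows "icomp (ext R e) (\<lambda>p. F (fst p))"
proof (rule icompI)
  fix k m and ls :: "nat list"
  assume ls: "\<forall>l\<in>set ls. l < k"
  then have "\<forall>l\<in>set (tl ls). l < k" by (cases ls) auto
  then obtain P where P: "icalc P R (tl ls) k m F"
    using icompD[OF assms] by blast
  show "\<exists>P. \<forall>a \<sigma>. fits (ext R e) ls a \<sigma> \<longrightarrow>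
        wp P (\<lambda>\<tau>. agree k m (fst (ext R e a)) \<sigma> \<tau> \<and> ireg (fst (ext R e a)) \<tau> k = F (fst a)) \<sigma>"
  proof (intro exI[of _ P] allI impI)
    fix p \<sigma> assume "fits (ext R e) ls p \<sigma>"
    then have "fits R (tl ls) (fst p) \<sigma>" by (auto simp: fits_ext)
    then show "wp P (\<lambda>\<tau>. agree k m (fst (ext R e p)) \<sigma> \<tau> \<and> ireg (fst (ext R e p)) \<tau> k = F (fst p)) \<sigma>"
      by (rule icalcD[OF P]) simp
  qed
qed

text \<open>The first value waits in register \<open>k\<close> while the second is computed with
  \<open>k + 1\<close> as first free register; this is where the quantification over
  \<open>k\<close> is used.\<close>

lemma icomp_binop:
  assumes c: "\<And>a b \<sigma>. ival (c a b) \<sigma> = f (ival a \<sigma>) (ival b \<sigma>)" and "icomp R F" "icomp R G"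
  shows "icomp R (\<lambda>a. f (F a) (G a))"
proof (rule icompI)
  fix k m and ls :: "nat list"
  assume ls: "\<forall>l\<in>set ls. l < k"
  then have ls': "\<forall>l\<in>set ls. l < Suc k" by auto
  obtain P where P: "icalc P R ls k m F"
    using icompD[OF assms(2) ls] by blast
  obtain P' where P': "icalc P' R ls (Suc k) m G"
    using icompD[OF assms(3) ls'] by blast
  let ?P = "Seq P (Seq P' (SetI k (c (IReg k) (IReg (Suc k)))))"
  show "\<exists>P. \<forall>a \<sigma>. fits R ls a \<sigma> \<longrightarrow>
        wp P (\<lambda>\<tau>. agree k m (fst (R a)) \<sigma> \<tau> \<and> ireg (fst (R a)) \<tau> k = f (F a) (G a)) \<sigma>"
  proof (intro exI[of _ ?P] allI impI)
    fix a \<sigma> assume f: "fits R ls a \<sigma>"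
    show "wp ?P (\<lambda>\<tau>. agree k m (fst (R a)) \<sigma> \<tau> \<and> ireg (fst (R a)) \<tau> k = f (F a) (G a)) \<sigma>"
    proof (rule wp_Seq, rule icalcD[OF P f])
      fix \<tau> assume \<tau>: "agree k m (fst (R a)) \<sigma> \<tau>" "ireg (fst (R a)) \<tau> k = F a"
      have f': "fits R ls a \<tau>" using fits_agree[OF f \<tau>(1) ls] .
      show "wp (Seq P' (SetI k (c (IReg k) (IReg (Suc k)))))
          (\<lambda>\<tau>. agree k m (fst (R a)) \<sigma> \<tau> \<and> ireg (fst (R a)) \<tau> k = f (F a) (G a)) \<tau>"
      proof (rule wp_Seq, rule icalcD[OF P' f'])
        fix \<upsilon> assume \<upsilon>: "agree (Suc k) m (fst (R a)) \<tau> \<upsilon>" "ireg (fst (R a)) \<upsilon> (Suc k) = G a"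
        note w = fitsD(1)[OF f] agreeD(1)[OF \<upsilon>(1)]
        show "wp (SetI k (c (IReg k) (IReg (Suc k))))
          (\<lambda>\<tau>. agree k m (fst (R a)) \<sigma> \<tau> \<and> ireg (fst (R a)) \<tau> k = f (F a) (G a)) \<upsilon>"
          using \<tau> \<upsilon> agree_trans[OF \<tau>(1) \<upsilon>(1)] agreeD(2)[OF \<upsilon>(1), of k]
          by (intro wp_SetI[OF w]) (simp add: val_Reg[OF w] c)
      qed
    qed
  qed
qed

lemma rcomp_binop:
  assumes c: "\<And>a b \<sigma>. rval (c a b) \<sigma> = f (rval a \<sigma>) (rval b \<sigma>)" and "rcomp R F" "rcomp R G"
  shows "rcomp R (\<lambda>a. f (F a) (G a))"
proof (rule rcompI)
  fix k m and ls :: "nat list"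
  assume ls: "\<forall>l\<in>set ls. l < k"
  obtain P where P: "rcalc P R ls k m F"
    using rcompD[OF assms(2) ls] by blast
  obtain P' where P': "rcalc P' R ls k (Suc m) G"
    using rcompD[OF assms(3) ls] by blast
  let ?P = "Seq P (Seq P' (SetR m (c (RReg m) (RReg (Suc m)))))"
  show "\<exists>P. \<forall>a \<sigma>. fits R ls a \<sigma> \<longrightarrow>
        wp P (\<lambda>\<tau>. agree k m (fst (R a)) \<sigma> \<tau> \<and> rreg (fst (R a)) \<tau> m = f (F a) (G a)) \<sigma>"
  proof (intro exI[of _ ?P] allI impI)
    fix a \<sigma> assume f: "fits R ls a \<sigma>"
    show "wp ?P (\<lambda>\<tau>. agree k m (fst (R a)) \<sigma> \<tau> \<and> rreg (fst (R a)) \<tau> m = f (F a) (G a)) \<sigma>"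
    proof (rule wp_Seq, rule rcalcD[OF P f])
      fix \<tau> assume \<tau>: "agree k m (fst (R a)) \<sigma> \<tau>" "rreg (fst (R a)) \<tau> m = F a"
      have f': "fits R ls a \<tau>" using fits_agree[OF f \<tau>(1) ls] .
      show "wp (Seq P' (SetR m (c (RReg m) (RReg (Suc m)))))
          (\<lambda>\<tau>. agree k m (fst (R a)) \<sigma> \<tau> \<and> rreg (fst (R a)) \<tau> m = f (F a) (G a)) \<tau>"
      proof (rule wp_Seq, rule rcalcD[OF P' f'])
        fix \<upsilon> assume \<upsilon>: "agree k (Suc m) (fst (R a)) \<tau> \<upsilon>" "rreg (fst (R a)) \<upsilon> (Suc m) = G a"
        note w = fitsD(1)[OF f] agreeD(1)[OF \<upsilon>(1)]
        show "wp (SetR m (c (RReg m) (RReg (Suc m))))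
          (\<lambda>\<tau>. agree k m (fst (R a)) \<sigma> \<tau> \<and> rreg (fst (R a)) \<tau> m = f (F a) (G a)) \<upsilon>"
          using \<tau> \<upsilon> agree_trans[OF \<tau>(1) \<upsilon>(1)] agreeD(3)[OF \<upsilon>(1), of m]
          by (intro wp_SetR[OF w]) (simp add: val_Reg[OF w] c)
      qed
    qed
  qed
qed

lemma icomp_add: "icomp R F \<Longrightarrow> icomp R G \<Longrightarrow> icomp R (\<lambda>a. F a + G a)"
  by (rule icomp_binop[where c = IAdd]) simp_all

lemma icomp_diff: "icomp R F \<Longrightarrow> icomp R G \<Longrightarrow> icomp R (\<lambda>a. F a - G a)"
  by (rule icomp_binop[where c = ISub]) simp_all

lemma icomp_mult: "icomp R F \<Longrightarrow> icomp R G \<Longrightarrow> icomp R (\<lambda>a. F a * G a)"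
  by (rule icomp_binop[where c = IMul]) simp_all

lemma icomp_div: "icomp R F \<Longrightarrow> icomp R G \<Longrightarrow> icomp R (\<lambda>a. F a div G a)"
  by (rule icomp_binop[where c = IDiv]) simp_all

lemma icomp_mod: "icomp R F \<Longrightarrow> icomp R G \<Longrightarrow> icomp R (\<lambda>a. F a mod G a)"
  by (rule icomp_binop[where c = IMod]) simp_all

lemma rcomp_add: "rcomp R F \<Longrightarrow> rcomp R G \<Longrightarrow> rcomp R (\<lambda>a. F a + G a)"
  by (rule rcomp_binop[where c = RAdd]) simp_all

lemma rcomp_diff: "rcomp R F \<Longrightarrow> rcomp R G \<Longrightarrow> rcomp R (\<lambda>a. F a - G a)"
  by (rule rcomp_binop[where c = RSub]) simp_all

lemma rcomp_mult: "rcomp R F \<Longrightarrow> rcomp R G \<Longrightarrow> rcomp R (\<lambda>a. F a * G a)"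
  by (rule rcomp_binop[where c = RMul]) simp_all

lemma rcomp_divide: "rcomp R F \<Longrightarrow> rcomp R G \<Longrightarrow> rcomp R (\<lambda>a. F a / G a)"
  by (rule rcomp_binop[where c = RDiv]) simp_all

lemma bcomp_less_int:
  assumes "icomp R F" "icomp R G"
  shows "bcomp R (\<lambda>a. F a < G a)"
proof (rule icompI)
  fix k m and ls :: "nat list"
  assume ls: "\<forall>l\<in>set ls. l < k"
  obtain P where P: "icalc P R ls k m (\<lambda>a. G a - F a)"
    using icompD[OF icomp_diff[OF assms(2,1)] ls] by blast
  let ?P = "Seq P (Cond (ILess (IConst 0) (IReg k)) (SetI k (IConst 1)) (SetI k (IConst 0)))"
  show "\<exists>P. \<forall>a \<sigma>. fits R ls a \<sigma> \<longrightarrow>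
        wp P (\<lambda>\<tau>. agree k m (fst (R a)) \<sigma> \<tau> \<and> ireg (fst (R a)) \<tau> k = of_bool (F a < G a)) \<sigma>"
  proof (intro exI[of _ ?P] allI impI)
    fix a \<sigma> assume f: "fits R ls a \<sigma>"
    show "wp ?P (\<lambda>\<tau>. agree k m (fst (R a)) \<sigma> \<tau> \<and> ireg (fst (R a)) \<tau> k = of_bool (F a < G a)) \<sigma>"
    proof (rule wp_Seq, rule icalcD[OF P f], rule wp_Cond)
      fix \<tau> assume \<tau>: "agree k m (fst (R a)) \<sigma> \<tau>" "ireg (fst (R a)) \<tau> k = G a - F a"
      note w = fitsD(1)[OF f] agreeD(1)[OF \<tau>(1)]
      show "wp (SetI k (IConst 1)) (\<lambda>\<tau>. agree k m (fst (R a)) \<sigma> \<tau> \<and> ireg (fst (R a)) \<tau> k = of_bool (F a < G a)) \<tau>"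
        if "bval (ILess (IConst 0) (IReg k)) \<tau>"
        using that \<tau> by (intro wp_SetI[OF w]) (simp add: val_Reg[OF w])
      show "wp (SetI k (IConst 0)) (\<lambda>\<tau>. agree k m (fst (R a)) \<sigma> \<tau> \<and> ireg (fst (R a)) \<tau> k = of_bool (F a < G a)) \<tau>"
        if "\<not> bval (ILess (IConst 0) (IReg k)) \<tau>"
        using that \<tau> by (intro wp_SetI[OF w]) (simp add: val_Reg[OF w])
    qed
  qed
qed

lemma bcomp_less_real:
  assumes "rcomp R F" "rcomp R G"
  shows "bcomp R (\<lambda>a. F a < G a)"
proof (rule icompI)
  fix k m and ls :: "nat list"
  assume ls: "\<forall>l\<in>set ls. l < k"
  obtain P where P: "rcalc P R ls k m (\<lambda>a. G a - F a)"
    using rcompD[OF rcomp_diff[OF assms(2,1)] ls] by blast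
  let ?P = "Seq P (Cond (RLess (ROfInt (IConst 0)) (RReg m)) (SetI k (IConst 1)) (SetI k (IConst 0)))"
  show "\<exists>P. \<forall>a \<sigma>. fits R ls a \<sigma> \<longrightarrow>
        wp P (\<lambda>\<tau>. agree k m (fst (R a)) \<sigma> \<tau> \<and> ireg (fst (R a)) \<tau> k = of_bool (F a < G a)) \<sigma>"
  proof (intro exI[of _ ?P] allI impI)
    fix a \<sigma> assume f: "fits R ls a \<sigma>"
    show "wp ?P (\<lambda>\<tau>. agree k m (fst (R a)) \<sigma> \<tau> \<and> ireg (fst (R a)) \<tau> k = of_bool (F a < G a)) \<sigma>"
    proof (rule wp_Seq, rule rcalcD[OF P f], rule wp_Cond)
      fix \<tau> assume \<tau>: "agree k m (fst (R a)) \<sigma> \<tau>" "rreg (fst (R a)) \<tau> m = G a - F a"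
      note w = fitsD(1)[OF f] agreeD(1)[OF \<tau>(1)]
      show "wp (SetI k (IConst 1)) (\<lambda>\<tau>. agree k m (fst (R a)) \<sigma> \<tau> \<and> ireg (fst (R a)) \<tau> k = of_bool (F a < G a)) \<tau>"
        if "bval (RLess (ROfInt (IConst 0)) (RReg m)) \<tau>"
        using that \<tau> by (intro wp_SetI[OF w]) (simp add: val_Reg[OF w])
      show "wp (SetI k (IConst 0)) (\<lambda>\<tau>. agree k m (fst (R a)) \<sigma> \<tau> \<and> ireg (fst (R a)) \<tau> k = of_bool (F a < G a)) \<tau>"
        if "\<not> bval (RLess (ROfInt (IConst 0)) (RReg m)) \<tau>"
        using that \<tau> by (intro wp_SetI[OF w]) (simp add: val_Reg[OF w])
    qed
  qed
qed

lemma rcomp_of_int: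
  assumes "icomp R F"
  shows "rcomp R (\<lambda>a. of_int (F a))"
proof (rule rcompI)
  fix k m and ls :: "nat list"
  assume ls: "\<forall>l\<in>set ls. l < k"
  obtain P where P: "icalc P R ls k m F"
    using icompD[OF assms ls] by blast
  let ?P = "Seq P (SetR m (ROfInt (IReg k)))"
  show "\<exists>P. \<forall>a \<sigma>. fits R ls a \<sigma> \<longrightarrow>
        wp P (\<lambda>\<tau>. agree k m (fst (R a)) \<sigma> \<tau> \<and> rreg (fst (R a)) \<tau> m = of_int (F a)) \<sigma>"
  proof (intro exI[of _ ?P] allI impI)
    fix a \<sigma> assume f: "fits R ls a \<sigma>"
    show "wp ?P (\<lambda>\<tau>. agree k m (fst (R a)) \<sigma> \<tau> \<and> rreg (fst (R a)) \<tau> m = of_int (F a)) \<sigma>"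
    proof (rule wp_Seq, rule icalcD[OF P f])
      fix \<tau> assume \<tau>: "agree k m (fst (R a)) \<sigma> \<tau>" "ireg (fst (R a)) \<tau> k = F a"
      note w = fitsD(1)[OF f] agreeD(1)[OF \<tau>(1)]
      show "wp (SetR m (ROfInt (IReg k)))
          (\<lambda>\<tau>. agree k m (fst (R a)) \<sigma> \<tau> \<and> rreg (fst (R a)) \<tau> m = of_int (F a)) \<tau>"
        using \<tau> by (intro wp_SetR[OF w]) (simp add: val_Reg[OF w])
    qed
  qed
qed

lemma bcomp_not:
  assumes "bcomp R Q"
  shows "bcomp R (\<lambda>a. \<not> Q a)"
  using icomp_diff[OF icomp_const[of R 1] assms] by (simp add: of_bool_not_iff)

lemma bcomp_conj: "bcomp R Q \<Longrightarrow> bcomp R Q' \<Longrightarrow> bcomp R (\<lambda>a. Q a \<and> Q' a)"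
  using icomp_mult[of R "\<lambda>a. of_bool (Q a)" "\<lambda>a. of_bool (Q' a)"] by (simp add: of_bool_conj)

lemma bcomp_disj: "bcomp R Q \<Longrightarrow> bcomp R Q' \<Longrightarrow> bcomp R (\<lambda>a. Q a \<or> Q' a)"
  using bcomp_not[OF bcomp_conj[OF bcomp_not bcomp_not], of R Q Q'] by simp

lemma bcomp_imp: "bcomp R Q \<Longrightarrow> bcomp R Q' \<Longrightarrow> bcomp R (\<lambda>a. Q a \<longrightarrow> Q' a)"
  using bcomp_disj[OF bcomp_not, of R Q Q'] by (simp only: imp_conv_disj)

lemma bcomp_le_int: "icomp R F \<Longrightarrow> icomp R G \<Longrightarrow> bcomp R (\<lambda>a. F a \<le> G a)"
  using bcomp_not[OF bcomp_less_int, of R G F] by (simp add: not_less)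

lemma bcomp_eq_int:
  assumes "icomp R F" "icomp R G"
  shows "bcomp R (\<lambda>a. F a = G a)"
proof -
  have "bcomp R (\<lambda>a. F a \<le> G a \<and> G a \<le> F a)"
    by (intro bcomp_conj bcomp_le_int assms)
  moreover have "F a \<le> G a \<and> G a \<le> F a \<longleftrightarrow> F a = G a" for a by arith
  ultimately show ?thesis by (simp only:)
qed

lemma bcomp_le_real: "rcomp R F \<Longrightarrow> rcomp R G \<Longrightarrow> bcomp R (\<lambda>a. F a \<le> G a)"
  using bcomp_not[OF bcomp_less_real, of R G F] by (simp add: not_less)

lemma bcomp_eq_real:
  assumes "rcomp R F" "rcomp R G"
  shows "bcomp R (\<lambda>a. F a = G a)"
proof -
  have "bcomp R (\<lambda>a. F a \<le> G a \<and> G a \<le> F a)"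
    by (intro bcomp_conj bcomp_le_real assms)
  moreover have "F a \<le> G a \<and> G a \<le> F a \<longleftrightarrow> F a = G a" for a by arith
  ultimately show ?thesis by (simp only:)
qed

text \<open>Selection by arithmetic instead of a jump. Both branches are evaluated, which is
  harmless because all operations are total.\<close>

lemma icomp_if:
  assumes "bcomp R Q" "icomp R F" "icomp R G"
  shows "icomp R (\<lambda>a. if Q a then F a else G a)"
proof -
  have "icomp R (\<lambda>a. of_bool (Q a) * F a + (1 - of_bool (Q a)) * G a)"
    by (intro icomp_add icomp_mult icomp_diff icomp_const assms)
  moreover have "(\<lambda>a. of_bool (Q a) * F a + (1 - of_bool (Q a)) * G a) = (\<lambda>a. if Q a then F a else G a)"
    by auto
  ultimately show ?thesis by simp
qed

lemma rcomp_if: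
  assumes "bcomp R Q" "rcomp R F" "rcomp R G"
  shows "rcomp R (\<lambda>a. if Q a then F a else G a)"
proof -
  have "rcomp R (\<lambda>a. of_int (of_bool (Q a)) * F a + (of_int 1 - of_int (of_bool (Q a))) * G a)"
    by (intro rcomp_add rcomp_mult rcomp_diff rcomp_of_int icomp_const assms)
  moreover have "(\<lambda>a. of_int (of_bool (Q a)) * F a + (of_int 1 - of_int (of_bool (Q a))) * G a)
      = (\<lambda>a. if Q a then F a else G a)"
    by auto
  ultimately show ?thesis by simp
qed

text \<open>The range test matters: behind the input lie the registers, so an unguarded load would
  return scratch data instead of the default \<open>0\<close>.\<close>

lemma icomp_geti:
  assumes "reads R I" "ncomp R F"
  shows "icomp R (\<lambda>a. geti (I a) (F a))"
proof -
  have I: "fst (R a) = I a" for a using assms(1) by (simp add: reads_def)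
  have "icomp R (\<lambda>a. if int (F a) < int (length (fst (I a))) then geti (I a) (F a) else 0)"
  proof (rule icompI)
    fix k m and ls :: "nat list"
    assume ls: "\<forall>l\<in>set ls. l < k"
    obtain P where P: "icalc P R ls k m (\<lambda>a. int (F a))"
      using icompD[OF assms(2) ls] by blast
    let ?P = "Seq P (Cond (ILess (IReg k) ilen_exp) (SetI k (ILoad (IReg k))) (SetI k (IConst 0)))"
    let ?F = "\<lambda>a. if int (F a) < int (length (fst (I a))) then geti (I a) (F a) else 0"
    show "\<exists>P. \<forall>a \<sigma>. fits R ls a \<sigma> \<longrightarrow>
        wp P (\<lambda>\<tau>. agree k m (fst (R a)) \<sigma> \<tau> \<and> ireg (fst (R a)) \<tau> k = ?F a) \<sigma>"
    proof (intro exI[of _ ?P] allI impI)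
      fix a \<sigma> assume f: "fits R ls a \<sigma>"
      show "wp ?P (\<lambda>\<tau>. agree k m (fst (R a)) \<sigma> \<tau> \<and> ireg (fst (R a)) \<tau> k = ?F a) \<sigma>"
      proof (rule wp_Seq, rule icalcD[OF P f], rule wp_Cond)
        fix \<tau> assume \<tau>: "agree k m (fst (R a)) \<sigma> \<tau>" "ireg (fst (R a)) \<tau> k = int (F a)"
        note w = fitsD(1)[OF f] agreeD(1)[OF \<tau>(1)]
        have h: "holds (I a) \<tau>" using w I by simp
        show "wp (SetI k (ILoad (IReg k))) (\<lambda>\<tau>. agree k m (fst (R a)) \<sigma> \<tau> \<and> ireg (fst (R a)) \<tau> k = ?F a) \<tau>"
          if "bval (ILess (IReg k) ilen_exp) \<tau>"
          using that \<tau> h by (intro wp_SetI[OF w]) (simp add: val_Reg[OF w] len_exps[OF w] I holds_def)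
        show "wp (SetI k (IConst 0)) (\<lambda>\<tau>. agree k m (fst (R a)) \<sigma> \<tau> \<and> ireg (fst (R a)) \<tau> k = ?F a) \<tau>"
          if "\<not> bval (ILess (IReg k) ilen_exp) \<tau>"
          using that \<tau> by (intro wp_SetI[OF w]) (simp add: val_Reg[OF w] len_exps[OF w] I)
      qed
    qed
  qed
  moreover have "(if int (F a) < int (length (fst (I a))) then geti (I a) (F a) else 0) = geti (I a) (F a)" for a
    by (simp add: geti_def)
  ultimately show ?thesis by (simp only:)
qed

lemma rcomp_getr:
  assumes "reads R I" "ncomp R F"
  shows "rcomp R (\<lambda>a. getr (I a) (F a))"
proof -
  have I: "fst (R a) = I a" for a using assms(1) by (simp add: reads_def)
  have "rcomp R (\<lambda>a. if int (F a) < int (length (snd (I a))) then getr (I a) (F a) else 0)"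
  proof (rule rcompI)
    fix k m and ls :: "nat list"
    assume ls: "\<forall>l\<in>set ls. l < k"
    obtain P where P: "icalc P R ls k m (\<lambda>a. int (F a))"
      using icompD[OF assms(2) ls] by blast
    let ?P = "Seq P (Cond (ILess (IReg k) rlen_exp) (SetR m (RLoad (IReg k))) (SetR m (ROfInt (IConst 0))))"
    let ?F = "\<lambda>a. if int (F a) < int (length (snd (I a))) then getr (I a) (F a) else 0"
    show "\<exists>P. \<forall>a \<sigma>. fits R ls a \<sigma> \<longrightarrow>
        wp P (\<lambda>\<tau>. agree k m (fst (R a)) \<sigma> \<tau> \<and> rreg (fst (R a)) \<tau> m = ?F a) \<sigma>"
    proof (intro exI[of _ ?P] allI impI)
      fix a \<sigma> assume f: "fits R ls a \<sigma>"
      show "wp ?P (\<lambda>\<tau>. agree k m (fst (R a)) \<sigma> \<tau> \<and> rreg (fst (R a)) \<tau> m = ?F a) \<sigma>"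
      proof (rule wp_Seq, rule icalcD[OF P f], rule wp_Cond)
        fix \<tau> assume \<tau>: "agree k m (fst (R a)) \<sigma> \<tau>" "ireg (fst (R a)) \<tau> k = int (F a)"
        note w = fitsD(1)[OF f] agreeD(1)[OF \<tau>(1)]
        have h: "holds (I a) \<tau>" using w I by simp
        show "wp (SetR m (RLoad (IReg k))) (\<lambda>\<tau>. agree k m (fst (R a)) \<sigma> \<tau> \<and> rreg (fst (R a)) \<tau> m = ?F a) \<tau>"
          if "bval (ILess (IReg k) rlen_exp) \<tau>"
          using that \<tau> h by (intro wp_SetR[OF w]) (simp add: val_Reg[OF w] len_exps[OF w] I holds_def)
        show "wp (SetR m (ROfInt (IConst 0))) (\<lambda>\<tau>. agree k m (fst (R a)) \<sigma> \<tau> \<and> rreg (fst (R a)) \<tau> m = ?F a) \<tau>"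
          if "\<not> bval (ILess (IReg k) rlen_exp) \<tau>"
          using that \<tau> by (intro wp_SetR[OF w]) (simp add: val_Reg[OF w] len_exps[OF w] I)
      qed
    qed
  qed
  moreover have "(if int (F a) < int (length (snd (I a))) then getr (I a) (F a) else 0) = getr (I a) (F a)" for a
    by (simp add: getr_def)
  ultimately show ?thesis by (simp only:)
qed

section \<open>Bounded iteration\<close>

text \<open>A for loop whose body sees the counter and the accumulator as two new variables. The
  conversion \<open>e\<close> lets one rule serve natural and integer accumulators; sums, powers and
  bounded quantifiers are instances.\<close>

lemma icomp_iter:
  fixes e :: "'b \<Rightarrow> int"
  assumes "ncomp R N" "icomp R (\<lambda>a. e (A a))"
    and body: "icomp (ext (ext R int) e) (\<lambda>p. e (b (fst (fst p)) (snd (fst p)) (snd p)))"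
  shows "icomp R (\<lambda>a. e (rec_nat (A a) (b a) (N a)))"
proof (rule icompI)
  fix k m and ls :: "nat list"
  assume ls: "\<forall>l\<in>set ls. l < k"
  obtain PN where PN: "icalc PN R ls k m (\<lambda>a. int (N a))"
    using icompD[OF assms(1) ls] by blast
  have "\<forall>l\<in>set ls. l < k+1" using ls by auto
  then obtain PA where PA: "icalc PA R ls (k+1) m (\<lambda>a. e (A a))"
    using icompD[OF assms(2)] by blast
  \<comment> \<open>Registers: \<open>k\<close> the number of rounds, \<open>k + 1\<close> the
    accumulator, \<open>k + 2\<close> the counter, and \<open>k + 3\<close> onwards the scratch
    space of the body.\<close>
  have ls3: "\<forall>l\<in>set ((k+1) # (k+2) # ls). l < k+3" using ls by auto
  obtain PB where PB: "icalc PB (ext (ext R int) e) ((k+1) # (k+2) # ls) (k+3) m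
      (\<lambda>p. e (b (fst (fst p)) (snd (fst p)) (snd p)))"
    using icompD[OF body ls3] by blast
  let ?body = "Seq PB (Seq (SetI (k+1) (IReg (k+3))) (SetI (k+2) (IAdd (IReg (k+2)) (IConst 1))))"
  let ?cond = "ILess (IReg (k+2)) (IReg k)"
  let ?loop = "While ?cond ?body"
  let ?P = "Seq PN (Seq PA (Seq (SetI (k+2) (IConst 0)) (Seq ?loop (SetI k (IReg (k+1))))))"
  let ?r = "\<lambda>a n. rec_nat (A a) (b a) n"
  show "\<exists>P. \<forall>a \<sigma>. fits R ls a \<sigma> \<longrightarrow>
        wp P (\<lambda>\<tau>. agree k m (fst (R a)) \<sigma> \<tau> \<and> ireg (fst (R a)) \<tau> k = e (?r a (N a))) \<sigma>"
  proof (intro exI[of _ ?P] allI impI)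
    fix a \<sigma> assume f: "fits R ls a \<sigma>"
    define x where "x = fst (R a)"
    note wf = fitsD(1)[OF f, folded x_def]
    let ?post = "\<lambda>\<tau>. agree k m x \<sigma> \<tau> \<and> ireg x \<tau> k = e (?r a (N a))"
    define J where "J i \<tau> \<longleftrightarrow> agree k m x \<sigma> \<tau> \<and> ireg x \<tau> k = int (N a) \<and> ireg x \<tau> (k+2) = int i \<and>
        ireg x \<tau> (k+1) = e (?r a i)" for i \<tau>
    have loop: "wp ?loop (wp (SetI k (IReg (k+1))) ?post) \<tau>" if "J 0 \<tau>" for \<tau>
    proof (rule wp_While[where I = J and n = "N a"])
      show "J 0 \<tau>" by fact
    next
      fix \<tau> assume J: "J (N a) \<tau>"
      have h: "holds x \<tau>" using J agreeD(1)[of k m x \<sigma> \<tau>] by (simp add: J_def)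
      show "\<not> bval ?cond \<tau> \<and> wp (SetI k (IReg (k+1))) ?post \<tau>"
        using J by (auto simp: J_def val_Reg[OF wf h] intro!: wp_SetI[OF wf h])
    next
      fix i \<tau> assume J: "J i \<tau>" and i: "i < N a"
      have h: "holds x \<tau>" using J agreeD(1)[of k m x \<sigma> \<tau>] by (simp add: J_def)
      have "fits R ls a \<tau>" using fits_agree[OF f _ ls] J by (auto simp: J_def x_def)
      then have f': "fits (ext (ext R int) e) ((k+1) # (k+2) # ls) ((a, i), ?r a i) \<tau>"
        using J by (simp add: fits_ext J_def x_def)
      have "wp ?body (J (Suc i)) \<tau>"
      proof (rule wp_Seq, rule icalcD[OF PB f'], simp only: fst_ext fst_conv snd_conv flip: x_def)
        fix \<upsilon> assume \<upsilon>: "agree (k+3) m x \<tau> \<upsilon>" "ireg x \<upsilon> (k+3) = e (b a i (?r a i))"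
        note h = agreeD(1)[OF \<upsilon>(1)]
        have "agree k m x \<sigma> \<upsilon>" using agree_trans[OF _ \<upsilon>(1), of k m \<sigma>] J by (auto simp: J_def)
        then show "wp (Seq (SetI (k+1) (IReg (k+3))) (SetI (k+2) (IAdd (IReg (k+2)) (IConst 1)))) (J (Suc i)) \<upsilon>"
          using \<upsilon> J agreeD(2)[OF \<upsilon>(1)] h
          by (intro wp_Seq wp_SetI[OF wf h] wp_SetI[OF wf]) (auto simp: J_def val_Reg[OF wf])
      qed
      then show "bval ?cond \<tau> \<and> wp ?body (J (Suc i)) \<tau>"
        using J i by (simp add: J_def val_Reg[OF wf h])
    qed
    show "wp ?P (\<lambda>\<tau>. agree k m (fst (R a)) \<sigma> \<tau> \<and> ireg (fst (R a)) \<tau> k = e (?r a (N a))) \<sigma>"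
    proof (fold x_def, rule wp_Seq, rule icalcD[OF PN f], fold x_def)
      fix \<tau> assume \<tau>: "agree k m x \<sigma> \<tau>" "ireg x \<tau> k = int (N a)"
      have f': "fits R ls a \<tau>" using fits_agree[OF f _ ls] \<tau> by (simp add: x_def)
      show "wp (Seq PA (Seq (SetI (k+2) (IConst 0)) (Seq ?loop (SetI k (IReg (k+1)))))) ?post \<tau>"
      proof (rule wp_Seq, rule icalcD[OF PA f'], fold x_def)
        fix \<upsilon> assume \<upsilon>: "agree (k+1) m x \<tau> \<upsilon>" "ireg x \<upsilon> (k+1) = e (A a)"
        note h = agreeD(1)[OF \<upsilon>(1)]
        have "J 0 (seti x (k+2) 0 \<upsilon>)"
          using \<upsilon> \<tau> agreeD(2)[OF \<upsilon>(1), of k] agree_trans[OF \<tau>(1) \<upsilon>(1)] by (simp add: J_def)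
        then show "wp (Seq (SetI (k+2) (IConst 0)) (Seq ?loop (SetI k (IReg (k+1))))) ?post \<upsilon>"
          by (intro wp_Seq wp_SetI[OF wf h]) (use loop in auto)
      qed
    qed
  qed
qed

lemma icomp_nat_const: "ncomp R (\<lambda>a. c)"
  by (rule icomp_const)

lemma icomp_nat_add: "ncomp R F \<Longrightarrow> ncomp R G \<Longrightarrow> ncomp R (\<lambda>a. F a + G a)"
  using icomp_add[of R "\<lambda>a. int (F a)" "\<lambda>a. int (G a)"] by simp

lemma icomp_nat_mult: "ncomp R F \<Longrightarrow> ncomp R G \<Longrightarrow> ncomp R (\<lambda>a. F a * G a)"
  using icomp_mult[of R "\<lambda>a. int (F a)" "\<lambda>a. int (G a)"] by simp

lemma icomp_nat_div: "ncomp R F \<Longrightarrow> ncomp R G \<Longrightarrow> ncomp R (\<lambda>a. F a div G a)"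
  using icomp_div[of R "\<lambda>a. int (F a)" "\<lambda>a. int (G a)"] by (simp add: zdiv_int)

lemma icomp_nat_mod: "ncomp R F \<Longrightarrow> ncomp R G \<Longrightarrow> ncomp R (\<lambda>a. F a mod G a)"
  using icomp_mod[of R "\<lambda>a. int (F a)" "\<lambda>a. int (G a)"] by (simp add: zmod_int)

lemma icomp_nat:
  assumes "icomp R F"
  shows "ncomp R (\<lambda>a. nat (F a))"
proof -
  have "icomp R (\<lambda>a. if 0 < F a then F a else 0)"
    by (intro icomp_if bcomp_less_int icomp_const assms)
  moreover have "(if 0 < F a then F a else 0) = int (nat (F a))" for a by simp
  ultimately show ?thesis by (simp only:)
qed

lemma icomp_abs:
  assumes "icomp R F"
  shows "icomp R (\<lambda>a. \<bar>F a\<bar>)"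
proof -
  have "icomp R (\<lambda>a. if F a < 0 then 0 - F a else F a)"
    by (intro icomp_if bcomp_less_int icomp_const icomp_diff assms)
  moreover have "(if F a < 0 then 0 - F a else F a) = \<bar>F a\<bar>" for a by simp
  ultimately show ?thesis by (simp only:)
qed

lemma rcomp_zero: "rcomp R (\<lambda>a. 0)" and rcomp_one: "rcomp R (\<lambda>a. 1)"
  using rcomp_of_int[OF icomp_const[of R 0]] rcomp_of_int[OF icomp_const[of R 1]] by simp_all

lemma rcomp_of_nat: "ncomp R F \<Longrightarrow> rcomp R (\<lambda>a. of_nat (F a))"
  using rcomp_of_int[of R "\<lambda>a. int (F a)"] by simp

lemma bcomp_less_nat: "ncomp R F \<Longrightarrow> ncomp R G \<Longrightarrow> bcomp R (\<lambda>a. F a < G a)"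
  using bcomp_less_int[of R "\<lambda>a. int (F a)" "\<lambda>a. int (G a)"] by simp

lemma bcomp_le_nat: "ncomp R F \<Longrightarrow> ncomp R G \<Longrightarrow> bcomp R (\<lambda>a. F a \<le> G a)"
  using bcomp_le_int[of R "\<lambda>a. int (F a)" "\<lambda>a. int (G a)"] by simp

lemma bcomp_eq_nat: "ncomp R F \<Longrightarrow> ncomp R G \<Longrightarrow> bcomp R (\<lambda>a. F a = G a)"
  using bcomp_eq_int[of R "\<lambda>a. int (F a)" "\<lambda>a. int (G a)"] by simp

lemma icomp_nat_iter:
  assumes "ncomp R N" "ncomp R A"
    "ncomp (ext (ext R int) int) (\<lambda>p. b (fst (fst p)) (snd (fst p)) (snd p))"
  shows "ncomp R (\<lambda>a. rec_nat (A a) (b a) (N a))"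
  using assms by (rule icomp_iter)

lemma icomp_power:
  assumes "ncomp R F" "ncomp R G"
  shows "ncomp R (\<lambda>a. F a ^ G a)"
proof -
  have "ncomp R (\<lambda>a. rec_nat 1 (\<lambda>_ r. F a * r) (G a))"
    by (intro icomp_nat_iter icomp_nat_const icomp_nat_mult[OF icomp_weaken[OF icomp_weaken] icomp_head] assms)
  moreover have "rec_nat 1 (\<lambda>_ r. F a * r) n = F a ^ n" for a n
    by (induction n) auto
  ultimately show ?thesis by (simp only:)
qed

lemma icomp_sum:
  assumes "ncomp R N" "icomp (ext R int) (\<lambda>p. b (fst p) (snd p))"
  shows "icomp R (\<lambda>a. \<Sum>i<N a. b a i)"
proof -
  have "icomp R (\<lambda>a. id (rec_nat 0 (\<lambda>i r. b a i + r) (N a)))"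
    using icomp_add[OF icomp_weaken[OF assms(2)] icomp_head[where e = id]]
    by (intro icomp_iter[where e = id and A = "\<lambda>a. 0" and b = "\<lambda>a i r. b a i + r", OF assms(1) icomp_const])
      (simp only: id_apply)
  moreover have "id (rec_nat 0 (\<lambda>i r. b a i + r) n) = (\<Sum>i<n. b a i)" for a n
    by (induction n) auto
  ultimately show ?thesis by (simp only:)
qed

lemma bcomp_ball:
  assumes "ncomp R N" "bcomp (ext R int) (\<lambda>p. Q (fst p) (snd p))"
  shows "bcomp R (\<lambda>a. \<forall>i<N a. Q a i)"
proof -
  have "icomp R (\<lambda>a. id (rec_nat 1 (\<lambda>i r. of_bool (Q a i) * r) (N a)))"
    using icomp_mult[OF icomp_weaken[OF assms(2)] icomp_head[where e = id]]
    by (intro icomp_iter[where e = id and A = "\<lambda>a. 1" and b = "\<lambda>a i r. of_bool (Q a i) * r", OF assms(1) icomp_const])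
      (simp only: id_apply)
  moreover have "id (rec_nat 1 (\<lambda>i r. of_bool (Q a i) * r) n) = (of_bool (\<forall>i<n. Q a i) :: int)" for a n
    by (induction n) (auto simp: less_Suc_eq)
  ultimately show ?thesis by (simp only:)
qed

lemma bcomp_bex:
  assumes "ncomp R N" "bcomp (ext R int) (\<lambda>p. Q (fst p) (snd p))"
  shows "bcomp R (\<lambda>a. \<exists>i<N a. Q a i)"
  using bcomp_not[OF bcomp_ball[OF assms(1) bcomp_not[OF assms(2)]]] by simp

text \<open>Contexts carry integer variables only, so a real accumulator cannot be passed to the
  body as in \<open>icomp_iter\<close>. It is kept in real register \<open>m\<close>, outside the
  reach of the summand.\<close>

lemma rcomp_sum:
  assumes "ncomp R N" and body: "rcomp (ext R int) (\<lambda>p. b (fst p) (snd p))"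
  shows "rcomp R (\<lambda>a. \<Sum>i<N a. b a i)"
proof (rule rcompI)
  fix k m and ls :: "nat list"
  assume ls: "\<forall>l\<in>set ls. l < k"
  obtain PN where PN: "icalc PN R ls k m (\<lambda>a. int (N a))"
    using icompD[OF assms(1) ls] by blast
  have ls2: "\<forall>l\<in>set ((k+1) # ls). l < k+2" using ls by auto
  obtain PB where PB: "rcalc PB (ext R int) ((k+1) # ls) (k+2) (m+1) (\<lambda>p. b (fst p) (snd p))"
    using rcompD[OF body ls2] by blast
  let ?body = "Seq PB (Seq (SetR m (RAdd (RReg m) (RReg (m+1)))) (SetI (k+1) (IAdd (IReg (k+1)) (IConst 1))))"
  let ?cond = "ILess (IReg (k+1)) (IReg k)"
  let ?loop = "While ?cond ?body"
  let ?P = "Seq PN (Seq (SetI (k+1) (IConst 0)) (Seq (SetR m (ROfInt (IConst 0))) ?loop))"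
  show "\<exists>P. \<forall>a \<sigma>. fits R ls a \<sigma> \<longrightarrow>
        wp P (\<lambda>\<tau>. agree k m (fst (R a)) \<sigma> \<tau> \<and> rreg (fst (R a)) \<tau> m = (\<Sum>i<N a. b a i)) \<sigma>"
  proof (intro exI[of _ ?P] allI impI)
    fix a \<sigma> assume f: "fits R ls a \<sigma>"
    define x where "x = fst (R a)"
    note wf = fitsD(1)[OF f, folded x_def]
    let ?post = "\<lambda>\<tau>. agree k m x \<sigma> \<tau> \<and> rreg x \<tau> m = (\<Sum>i<N a. b a i)"
    define J where "J n \<tau> \<longleftrightarrow> agree k m x \<sigma> \<tau> \<and> ireg x \<tau> k = int (N a) \<and> ireg x \<tau> (k+1) = int n \<and>
        rreg x \<tau> m = (\<Sum>i<n. b a i)" for n \<tau>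
    have loop: "wp ?loop ?post \<tau>" if "J 0 \<tau>" for \<tau>
    proof (rule wp_While[where I = J and n = "N a"])
      show "J 0 \<tau>" by fact
    next
      fix \<tau> assume J: "J (N a) \<tau>"
      have h: "holds x \<tau>" using J agreeD(1)[of k m x \<sigma> \<tau>] by (simp add: J_def)
      show "\<not> bval ?cond \<tau> \<and> ?post \<tau>"
        using J by (auto simp: J_def val_Reg[OF wf h])
    next
      fix i \<tau> assume J: "J i \<tau>" and i: "i < N a"
      have h: "holds x \<tau>" using J agreeD(1)[of k m x \<sigma> \<tau>] by (simp add: J_def)
      have "fits R ls a \<tau>" using fits_agree[OF f _ ls] J by (auto simp: J_def x_def)
      then have f': "fits (ext R int) ((k+1) # ls) (a, i) \<tau>"
        using J by (simp add: fits_ext J_def x_def)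
      have "wp ?body (J (Suc i)) \<tau>"
      proof (rule wp_Seq, rule rcalcD[OF PB f'], simp only: fst_ext fst_conv snd_conv flip: x_def)
        fix \<upsilon> assume \<upsilon>: "agree (k+2) (m+1) x \<tau> \<upsilon>" "rreg x \<upsilon> (m+1) = b a i"
        note h = agreeD(1)[OF \<upsilon>(1)]
        have "agree k m x \<sigma> \<upsilon>" using agree_trans[OF _ \<upsilon>(1), of k m \<sigma>] J by (auto simp: J_def)
        then show "wp (Seq (SetR m (RAdd (RReg m) (RReg (m+1)))) (SetI (k+1) (IAdd (IReg (k+1)) (IConst 1)))) (J (Suc i)) \<upsilon>"
          using \<upsilon> J agreeD(2,3)[OF \<upsilon>(1)] h
          by (intro wp_Seq wp_SetR[OF wf h] wp_SetI[OF wf]) (auto simp: J_def val_Reg[OF wf])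
      qed
      then show "bval ?cond \<tau> \<and> wp ?body (J (Suc i)) \<tau>"
        using J i by (simp add: J_def val_Reg[OF wf h])
    qed
    show "wp ?P (\<lambda>\<tau>. agree k m (fst (R a)) \<sigma> \<tau> \<and> rreg (fst (R a)) \<tau> m = (\<Sum>i<N a. b a i)) \<sigma>"
    proof (fold x_def, rule wp_Seq, rule icalcD[OF PN f], fold x_def)
      fix \<tau> assume \<tau>: "agree k m x \<sigma> \<tau>" "ireg x \<tau> k = int (N a)"
      note h = agreeD(1)[OF \<tau>(1)]
      have "J 0 (setr x m 0 (seti x (k+1) 0 \<tau>))"
        using \<tau> by (simp add: J_def)
      then show "wp (Seq (SetI (k+1) (IConst 0)) (Seq (SetR m (ROfInt (IConst 0))) ?loop)) ?post \<tau>"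
        using h by (intro wp_Seq wp_SetI[OF wf h] wp_SetR[OF wf]) (use loop in auto)
    qed
  qed
qed

section \<open>Unbounded search\<close>

lemma holds_load: "holds x (load (fst x) (snd x))"
  by (simp add: holds_def load_def geti_def getr_def)

text \<open>The only loop without a bound computed beforehand. Register \<open>0\<close> holds the
  candidate and register \<open>1\<close> the truth value of \<open>Q\<close>; the loop stops
  because some \<open>d\<close> satisfies \<open>Q\<close>. Only the last instruction overwrites the
  input, in cell \<open>0\<close>. The subtraction of 1 is the one in the definition of the
  rank.\<close>

lemma computes_search:
  assumes Q: "bcomp (ext base int) (\<lambda>p. Q (fst p) (snd p))"
  shows "\<exists>P. \<forall>x d. wf_input x \<longrightarrow> Q x d \<longrightarrow> computes P x (int (LEAST d. Q x d) - 1)"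
proof -
  have ls: "\<forall>l\<in>set [0::nat]. l < 1" by simp
  obtain P where P: "icalc P (ext base int) [0] 1 0 (\<lambda>p. of_bool (Q (fst p) (snd p)))"
    using icompD[OF Q ls] by blast
  let ?cond = "ILess (IReg 1) (IConst 1)"
  let ?body = "Seq (SetI 0 (IAdd (IReg 0) (IConst 1))) P"
  let ?P = "Seq (SetI 0 (IConst 0)) (Seq P (Seq (While ?cond ?body) (IStore (IConst 0) (ISub (IReg 0) (IConst 1)))))"
  show ?thesis
  proof (intro exI[of _ ?P] allI impI)
    fix x d assume wf: "wf_input x" and "Q x d"
    define n where "n = (LEAST d. Q x d)"
    have n: "Q x n" "\<And>i. i < n \<Longrightarrow> \<not> Q x i"
      unfolding n_def by (rule LeastI, rule \<open>Q x d\<close>) (rule not_less_Least)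
    let ?post = "\<lambda>\<tau>. imem \<tau> 0 = int n - 1"
    define J where "J i \<tau> \<longleftrightarrow> holds x \<tau> \<and> ireg x \<tau> 0 = int i \<and> ireg x \<tau> 1 = of_bool (Q x i)" for i \<tau>
    have step: "wp P (J i) \<sigma>" if "holds x \<sigma>" "ireg x \<sigma> 0 = int i" for i \<sigma>
    proof -
      have f: "fits (ext base int) [0] (x, i) \<sigma>"
        using that wf by (auto simp: fits_def ext_def base_def)
      show ?thesis
        by (rule icalcD[OF P f]) (simp_all add: J_def agree_def base_def that)
    qed
    let ?fin = "IStore (IConst 0) (ISub (IReg 0) (IConst 1))"
    have fin: "wp ?fin ?post \<tau>" if "J n \<tau>" for \<tau>
    proof -
      have h: "holds x \<tau>" "ireg x \<tau> 0 = int n" using that by (auto simp: J_def)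
      show ?thesis unfolding wp_def
        by (rule exI, rule conjI, rule exec.IStore) (simp add: val_Reg[OF wf h(1)] h(2))
    qed
    have loop: "wp (While ?cond ?body) (wp ?fin ?post) \<tau>" if "J 0 \<tau>" for \<tau>
    proof (rule wp_While[where I = J and n = n])
      show "J 0 \<tau>" by fact
    next
      fix \<tau> assume J: "J n \<tau>"
      then have h: "holds x \<tau>" by (simp add: J_def)
      show "\<not> bval ?cond \<tau> \<and> wp ?fin ?post \<tau>"
        using fin[OF J] J n(1) by (simp add: J_def val_Reg[OF wf h])
    next
      fix i \<tau> assume J: "J i \<tau>" and i: "i < n"
      then have h: "holds x \<tau>" by (simp add: J_def)
      have "wp ?body (J (Suc i)) \<tau>"
        by (rule wp_Seq, rule wp_SetI[OF wf h], rule step) (use J h in \<open>auto simp: J_def val_Reg[OF wf h]\<close>)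
      then show "bval ?cond \<tau> \<and> wp ?body (J (Suc i)) \<tau>"
        using J n(2)[OF i] by (simp add: J_def val_Reg[OF wf h])
    qed
    have "wp ?P ?post (load (fst x) (snd x))"
      by (rule wp_Seq, rule wp_SetI[OF wf holds_load], rule wp_Seq, rule wp_mono, rule step[of _ 0], simp add: holds_load,
          simp, rule wp_Seq, erule loop)
    then show "computes ?P x (int (LEAST d. Q x d) - 1)"
      by (auto simp: computes_def wp_def n_def)
  qed
qed

section \<open>Bounding real quantifiers\<close>

definition lin :: "nat \<Rightarrow> (nat \<Rightarrow> int) \<Rightarrow> (nat \<Rightarrow> real) \<Rightarrow> real" where
  "lin k c p = (\<Sum>i<k. of_int (c i) * p i)"

text \<open>Vectors related in this way satisfy the same quantifier-free formulas whose atoms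
  compare forms with coefficients up to \<open>B\<close> with \<open>0\<close>. Quantifiers are
  handled by a back-and-forth argument in which the bound shrinks.\<close>

definition sign_eq :: "nat \<Rightarrow> nat \<Rightarrow> (nat \<Rightarrow> real) \<Rightarrow> (nat \<Rightarrow> real) \<Rightarrow> bool" where
  "sign_eq B k p q \<longleftrightarrow>
     (\<forall>c. (\<forall>i<k. \<bar>c i\<bar> \<le> int B) \<longrightarrow> sgn (lin k c p) = sgn (lin k c q))"

lemma lin_cong: "(\<And>i. i < k \<Longrightarrow> c i = c' i) \<Longrightarrow> (\<And>i. i < k \<Longrightarrow> p i = p' i) \<Longrightarrow> lin k c p = lin k c' p'"
  by (simp add: lin_def)

lemma lin_Suc: "lin (Suc k) c p = lin k c p + of_int (c k) * p k"
  by (simp add: lin_def)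

lemma lin_add: "lin k (\<lambda>i. c i + c' i) p = lin k c p + lin k c' p"
  by (simp add: lin_def sum.distrib algebra_simps)

lemma lin_scale: "lin k (\<lambda>i. m * c i) p = of_int m * lin k c p"
  by (simp add: lin_def sum_distrib_left algebra_simps)

lemma lin_minus: "lin k (\<lambda>i. - c i) p = - lin k c p"
  using lin_scale[of k "-1"] by simp

lemma lin_unit: "j < k \<Longrightarrow> lin k (\<lambda>i. if i = j then 1 else 0) p = p j"
  by (simp add: lin_def if_distrib[of real_of_int] if_distrib[of "\<lambda>x. x * _"] sum.delta cong: if_cong)

lemma sign_eqD: "sign_eq B k p q \<Longrightarrow> (\<And>i. i < k \<Longrightarrow> \<bar>c i\<bar> \<le> int B) \<Longrightarrow> sgn (lin k c p) = sgn (lin k c q)"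
  by (simp add: sign_eq_def)

lemma sign_eq_cong:
  assumes "\<And>i. i < k \<Longrightarrow> p i = p' i" "\<And>i. i < k \<Longrightarrow> q i = q' i"
  shows "sign_eq B k p q \<longleftrightarrow> sign_eq B k p' q'"
proof -
  have "lin k c p = lin k c p'" "lin k c q = lin k c q'" for c
    using assms by (auto intro: lin_cong)
  then show ?thesis by (simp add: sign_eq_def)
qed

lemma sign_eq_refl: "sign_eq B k p p"
  by (simp add: sign_eq_def)

lemma sign_eq_sym: "sign_eq B k p q \<Longrightarrow> sign_eq B k q p"
  by (simp add: sign_eq_def)

text \<open>
  Ferrante and Rackoff: the truth of a formula in \<open>x\<close> only depends on the position of \<open>x\<close>
  relative to the zeros of the linear forms in it, and the order of the zeros is given by signs
  of linear forms without \<open>x\<close>.  Hence \<open>x\<close> can be replaced by a zero, by a mean of two zeros, or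
  by a zero plus or minus one.
\<close>

lemma sign_eq_extend:
  assumes pq: "sign_eq (2 * B\<^sup>2) k p q" and B: "1 \<le> B" and k: "0 < k" and q0: "q 0 = 1"
  shows "\<exists>c b. (\<forall>i<k. \<bar>c i\<bar> \<le> int (2 * B\<^sup>2)) \<and> 1 \<le> b \<and> b \<le> int (2 * B\<^sup>2) \<and>
    sign_eq B (Suc k) (p(k := x)) (q(k := lin k c q / of_int b))"
proof -
  let ?A = "int (2 * B\<^sup>2)"
  have BA: "int B \<le> ?A" "2 * int B \<le> ?A"
    using B mult_mono[of 1 "int B" "int B" "int B"] by (simp_all add: power2_eq_square)
  have prod_le: "\<bar>c * d\<bar> \<le> (int B)\<^sup>2" if "\<bar>c\<bar> \<le> int B" "\<bar>d\<bar> \<le> int B" for c d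
    using that mult_mono[of "\<bar>c\<bar>" "int B" "\<bar>d\<bar>" "int B"] by (simp add: abs_mult power2_eq_square)
  \<comment> \<open>A pair \<open>(g, e)\<close> in \<open>S\<close> is the form with coefficients
    \<open>g\<close> on the old variables and \<open>e\<close> on the new one, normalised to
    \<open>e > 0\<close>; \<open>root\<close> is its zero in the new variable.\<close>
  define S where "S = ({..<k} \<rightarrow>\<^sub>E {- int B..int B}) \<times> {1..int B}"
  define root where "root p z = - lin k (fst z) p / of_int (snd z)" for p and z :: "(nat \<Rightarrow> int) \<times> int"
  have finS: "finite S" by (auto simp: S_def intro!: finite_PiE)
  have S: "\<bar>fst z i\<bar> \<le> int B" "1 \<le> snd z" "\<bar>snd z\<bar> \<le> int B" "snd z \<le> int B" if "z \<in> S" "i < k" for z i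
  proof -
    have z: "fst z \<in> {..<k} \<rightarrow>\<^sub>E {- int B..int B}" "snd z \<in> {1..int B}"
      using that(1) unfolding S_def by (simp_all only: mem_Times_iff)
    moreover have "fst z i \<in> {- int B..int B}" using PiE_mem[OF z(1)] that(2) by simp
    ultimately have "fst z i \<in> {- int B..int B}" "snd z \<in> {1..int B}" by simp_all
    then show "\<bar>fst z i\<bar> \<le> int B" "1 \<le> snd z" "\<bar>snd z\<bar> \<le> int B" "snd z \<le> int B" by auto
  qed
  have S_ne: "S \<noteq> {}" using B by (auto simp: S_def PiE_eq_empty_iff)
  \<comment> \<open>Comparing two roots and clearing denominators gives a form whose coefficients
    are sums of two products, hence at most \<open>2 * B\<^sup>2\<close>. This is the origin of the
    bound in the hypothesis.\<close>
  have less: "root p z < root p z' \<longleftrightarrow> root q z < root q z'" if z: "z \<in> S" "z' \<in> S" for z z'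
  proof -
    let ?c = "\<lambda>i. snd z' * fst z i + - snd z * fst z' i"
    have "sgn (lin k ?c p) = sgn (lin k ?c q)"
    proof (rule sign_eqD[OF pq])
      fix i assume i: "i < k"
      have "\<bar>?c i\<bar> \<le> \<bar>snd z' * fst z i\<bar> + \<bar>snd z * fst z' i\<bar>" by simp
      also have "\<dots> \<le> ?A"
        using prod_le[of "snd z'" "fst z i"] prod_le[of "snd z" "fst z' i"] S[OF z(1) i] S[OF z(2) i] by simp
      finally show "\<bar>?c i\<bar> \<le> ?A" .
    qed
    then have "0 < lin k ?c p \<longleftrightarrow> 0 < lin k ?c q"
      using sgn_greater[of "lin k ?c p"] sgn_greater[of "lin k ?c q"] by simp
    moreover have "root p z < root p z' \<longleftrightarrow> 0 < lin k ?c p" for p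
    proof -
      have frac: "- a / d < - b / d' \<longleftrightarrow> 0 < d' * a + - d * b" if "0 < d" "0 < d'" for a b d d' :: real
        using that by (simp add: divide_less_eq less_divide_eq mult.commute)
      show ?thesis
        using frac[of "of_int (snd z)" "of_int (snd z')" "lin k (fst z) p" "lin k (fst z') p"]
          S(2)[OF z(1) k] S(2)[OF z(2) k]
        unfolding root_def lin_add lin_scale by simp
    qed
    ultimately show ?thesis by simp
  qed
  \<comment> \<open>It suffices to choose the new coordinate on the same side of every root as
    \<open>x\<close>.\<close>
  have main: ?thesis if c: "\<And>i. i < k \<Longrightarrow> \<bar>c i\<bar> \<le> ?A" and b: "1 \<le> b" "b \<le> ?A"
    and pos: "\<And>z. z \<in> S \<Longrightarrow> sgn (x - root p z) = sgn (lin k c q / of_int b - root q z)" for c b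
  proof -
    let ?y = "lin k c q / of_int b"
    have "sgn (lin (Suc k) f (p(k := x))) = sgn (lin (Suc k) f (q(k := ?y)))"
      if f: "\<And>i. i < Suc k \<Longrightarrow> \<bar>f i\<bar> \<le> int B" for f
    proof -
      have exp: "lin (Suc k) f (p(k := x)) = lin k f p + of_int (f k) * x" for p x
        unfolding lin_Suc by (simp add: lin_def)
      have main: "sgn (lin k g p + of_int e * x) = sgn (lin k g q + of_int e * ?y)"
        if g: "\<And>i. i < k \<Longrightarrow> \<bar>g i\<bar> \<le> int B" and e: "1 \<le> e" "e \<le> int B" for g e
      proof -
        let ?z = "(restrict g {..<k}, e)"
        have "?z \<in> S" using g e by (auto simp: S_def abs_le_iff minus_le_iff)
        from pos[OF this] have "sgn (of_int e * (x - root p ?z)) = sgn (of_int e * (?y - root q ?z))"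
          by (simp only: sgn_mult)
        moreover have eq: "lin k g p + of_int e * x = of_int e * (x - root p ?z)" for p x
          using e by (simp add: root_def field_simps lin_cong[of k "restrict g {..<k}" g p p])
        ultimately show ?thesis by (simp only: eq)
      qed
      consider "f k = 0" | "f k > 0" | "f k < 0" by linarith
      then show ?thesis
      proof cases
        case 1
        have "sgn (lin k f p) = sgn (lin k f q)"
          by (rule sign_eqD[OF pq]) (use f BA(1) order_trans in \<open>blast intro: less_SucI order_trans\<close>)
        with 1 show ?thesis by (simp add: exp)
      next
        case 2
        then show ?thesis using main[of f "f k"] f[of k] f by (simp add: exp)
      next
        case 3
        then have "sgn (lin k (\<lambda>i. - f i) p + of_int (- f k) * x) = sgn (lin k (\<lambda>i. - f i) q + of_int (- f k) * ?y)"
          using main[of "\<lambda>i. - f i" "- f k"] f[of k] f by simp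
        then have "sgn (- (lin k f p + of_int (f k) * x)) = sgn (- (lin k f q + of_int (f k) * ?y))"
          by (simp add: lin_minus)
        then show ?thesis unfolding exp by (simp only: sgn_minus neg_equal_iff_equal)
      qed
    qed
    then have "sign_eq B (Suc k) (p(k := x)) (q(k := ?y))" by (simp add: sign_eq_def)
    with c b show ?thesis by blast
  qed
  show ?thesis
  proof (cases "\<exists>z\<in>S. root p z = x")
    case True
    then obtain z where z: "z \<in> S" "root p z = x" by blast
    have y: "lin k (\<lambda>i. - fst z i) q / of_int (snd z) = root q z"
      by (simp add: root_def lin_minus)
    show ?thesis
    proof (rule main[of "\<lambda>i. - fst z i" "snd z"])
      show "\<bar>- fst z i\<bar> \<le> ?A" if "i < k" for i using S(1)[OF z(1) that] BA by simp
      show "1 \<le> snd z" "snd z \<le> ?A" using S[OF z(1) k] BA by simp_all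
      show "sgn (x - root p z') = sgn (lin k (\<lambda>i. - fst z i) q / of_int (snd z) - root q z')" if "z' \<in> S" for z'
        unfolding y using less[OF z(1) that] less[OF that z(1)] z(2) by (auto simp: sgn_if)
    qed
  next
    case False
    \<comment> \<open>No root equals \<open>x\<close>. The roots split into lower and upper ones,
      and by \<open>less\<close> the split is also ordered over \<open>q\<close>, so any value
      between the extreme roots over \<open>q\<close> will do.\<close>
    define Lo where "Lo = {z \<in> S. root p z < x}"
    define Hi where "Hi = {z \<in> S. x < root p z}"
    have fin: "finite Lo" "finite Hi" using finS by (auto simp: Lo_def Hi_def)
    have SLH: "S = Lo \<union> Hi" using False by (auto simp: Lo_def Hi_def)
    have LH: "root q z < root q z'" if "z \<in> Lo" "z' \<in> Hi" for z z'
      using that less[of z z'] by (auto simp: Lo_def Hi_def)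
    have pos: "sgn (x - root p z) = sgn (y - root q z)"
      if "\<And>z. z \<in> Lo \<Longrightarrow> root q z < y" "\<And>z. z \<in> Hi \<Longrightarrow> y < root q z" "z \<in> S" for y z
    proof (cases "z \<in> Lo")
      case True
      with that(1)[OF True] show ?thesis by (simp add: Lo_def)
    next
      case False
      with that(3) SLH have "z \<in> Hi" by blast
      with that(2)[OF this] show ?thesis by (simp add: Hi_def)
    qed
    have maxLo: "\<exists>z\<in>Lo. \<forall>z'\<in>Lo. root q z' \<le> root q z" if "Lo \<noteq> {}"
      using obtains_MAX[OF fin(1) that, of "root q"] fin(1) by (metis Max_ge finite_imageI imageI)
    have minHi: "\<exists>z\<in>Hi. \<forall>z'\<in>Hi. root q z \<le> root q z'" if "Hi \<noteq> {}"
      using obtains_MIN[OF fin(2) that, of "root q"] fin(2) by (metis Min_le finite_imageI imageI)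
    consider "Lo \<noteq> {}" "Hi \<noteq> {}" | "Hi = {}" "Lo \<noteq> {}" | "Lo = {}" "Hi \<noteq> {}" using S_ne SLH by blast
    then show ?thesis
    proof cases
      case 1
      from maxLo[OF 1(1)] obtain z1 where z1: "z1 \<in> Lo" "\<And>z. z \<in> Lo \<Longrightarrow> root q z \<le> root q z1" by blast
      from minHi[OF 1(2)] obtain z2 where z2: "z2 \<in> Hi" "\<And>z. z \<in> Hi \<Longrightarrow> root q z2 \<le> root q z" by blast
      have zS: "z1 \<in> S" "z2 \<in> S" using z1 z2 by (auto simp: Lo_def Hi_def)
      \<comment> \<open>The midpoint of the two neighbouring roots, over the common denominator
        \<open>2 * (snd z1 * snd z2)\<close>.\<close>
      let ?c = "\<lambda>i. - snd z2 * fst z1 i + - snd z1 * fst z2 i" and ?b = "2 * (snd z1 * snd z2)"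
      have y: "lin k ?c q / of_int ?b = (root q z1 + root q z2) / 2"
        using S(2)[OF zS(1) k] S(2)[OF zS(2) k] by (simp only: lin_add lin_scale) (simp add: root_def field_simps)
      note lt = LH[OF z1(1) z2(1)]
      show ?thesis
      proof (rule main[of ?c ?b])
        fix i assume i: "i < k"
        have "\<bar>?c i\<bar> \<le> \<bar>snd z2 * fst z1 i\<bar> + \<bar>snd z1 * fst z2 i\<bar>" by simp
        also have "\<dots> \<le> ?A"
          using prod_le[of "snd z2" "fst z1 i"] prod_le[of "snd z1" "fst z2 i"] S[OF zS(1) i] S[OF zS(2) i] by simp
        finally show "\<bar>?c i\<bar> \<le> ?A" .
      next
        show "1 \<le> ?b" using S(2)[OF zS(1) k] S(2)[OF zS(2) k] mult_mono[of 1 "snd z1" 1 "snd z2"] by simp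
        show "?b \<le> ?A" using prod_le[of "snd z1" "snd z2"] S[OF zS(1) k] S[OF zS(2) k] by simp
      next
        fix z assume z: "z \<in> S"
        show "sgn (x - root p z) = sgn (lin k ?c q / of_int ?b - root q z)"
        proof (rule pos[OF _ _ z])
          show "root q z < lin k ?c q / of_int ?b" if "z \<in> Lo" for z
            unfolding y using z1(2)[OF that] lt by simp
          show "lin k ?c q / of_int ?b < root q z" if "z \<in> Hi" for z
            unfolding y using z2(2)[OF that] lt by simp
        qed
      qed
    next
      case 2
      from maxLo[OF 2(2)] obtain z1 where z1: "z1 \<in> Lo" "\<And>z. z \<in> Lo \<Longrightarrow> root q z \<le> root q z1" by blast
      have zS: "z1 \<in> S" using z1 by (auto simp: Lo_def)
      \<comment> \<open>Above all roots: the greatest root plus one. As \<open>q 0 = 1\<close>,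
        adding one is itself a linear form.\<close>
      let ?c = "\<lambda>i. - fst z1 i + snd z1 * (if i = 0 then 1 else 0)"
      have y: "lin k ?c q / of_int (snd z1) = root q z1 + 1"
        using S(2)[OF zS k] q0 by (simp only: lin_add lin_scale lin_minus lin_unit[OF k]) (simp add: root_def field_simps)
      show ?thesis
      proof (rule main[of ?c "snd z1"])
        show "\<bar>?c i\<bar> \<le> ?A" if "i < k" for i
        proof -
          have "\<bar>?c i\<bar> \<le> \<bar>fst z1 i\<bar> + \<bar>snd z1\<bar>" by (cases "i = 0"; simp; linarith?)
          then show ?thesis using S(1,3)[OF zS that] BA(2) by linarith
        qed
        show "1 \<le> snd z1" "snd z1 \<le> ?A" using S[OF zS k] BA by simp_all
        show "sgn (x - root p z) = sgn (lin k ?c q / of_int (snd z1) - root q z)" if "z \<in> S" for z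
          unfolding y
          by (rule pos[OF _ _ that], drule z1(2), simp, use 2 in simp)
      qed
    next
      case 3
      from minHi[OF 3(2)] obtain z1 where z1: "z1 \<in> Hi" "\<And>z. z \<in> Hi \<Longrightarrow> root q z1 \<le> root q z" by blast
      have zS: "z1 \<in> S" using z1 by (auto simp: Hi_def)
      let ?c = "\<lambda>i. - fst z1 i + - snd z1 * (if i = 0 then 1 else 0)"
      have y: "lin k ?c q / of_int (snd z1) = root q z1 - 1"
        using S(2)[OF zS k] q0 by (simp only: lin_add lin_scale lin_minus lin_unit[OF k]) (simp add: root_def field_simps)
      show ?thesis
      proof (rule main[of ?c "snd z1"])
        show "\<bar>?c i\<bar> \<le> ?A" if "i < k" for i
        proof -
          have "\<bar>?c i\<bar> \<le> \<bar>fst z1 i\<bar> + \<bar>snd z1\<bar>" by (cases "i = 0"; simp; linarith?)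
          then show ?thesis using S(1,3)[OF zS that] BA(2) by linarith
        qed
        show "1 \<le> snd z1" "snd z1 \<le> ?A" using S[OF zS k] BA by simp_all
        show "sgn (x - root p z) = sgn (lin k ?c q / of_int (snd z1) - root q z)" if "z \<in> S" for z
          unfolding y
          by (rule pos[OF _ _ that], use 3 in simp, drule z1(2), simp)
      qed
    qed
  qed
qed

section \<open>Vectors of bounded rational combinations\<close>

text \<open>One common denominator for all entries: combinations of such vectors then need only one
  further factor, and a code needs only one digit for it.\<close>

definition bounded_span :: "nat \<Rightarrow> nat \<Rightarrow> (nat \<Rightarrow> real) \<Rightarrow> nat \<Rightarrow> (nat \<Rightarrow> real) \<Rightarrow> bool" where
  "bounded_span A k w m u \<longleftrightarrow> (\<exists>b a. 1 \<le> b \<and> b \<le> int A \<and>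
     (\<forall>i<m. (\<forall>l<k. \<bar>a i l\<bar> \<le> int A) \<and> u i = lin k (a i) w / of_int b))"

lemma bounded_spanI:
  assumes "1 \<le> b" "b \<le> int A" "\<And>i l. i < m \<Longrightarrow> l < k \<Longrightarrow> \<bar>a i l\<bar> \<le> int A"
    "\<And>i. i < m \<Longrightarrow> u i = lin k (a i) w / of_int b"
  shows "bounded_span A k w m u"
  using assms unfolding bounded_span_def by blast

lemma bounded_spanE:
  assumes "bounded_span A k w m u"
  obtains b a where "1 \<le> b" "b \<le> int A" "\<And>i l. i < m \<Longrightarrow> l < k \<Longrightarrow> \<bar>a i l\<bar> \<le> int A"
    "\<And>i. i < m \<Longrightarrow> u i = lin k (a i) w / of_int b"
  using assms unfolding bounded_span_def by blast

lemma bounded_span_mono: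
  assumes "bounded_span A k w m u" "A \<le> A'"
  shows "bounded_span A' k w m u"
  using assms(1)
proof (rule bounded_spanE)
  fix b a
  assume "1 \<le> b" "b \<le> int A" and a: "\<And>i l. i < m \<Longrightarrow> l < k \<Longrightarrow> \<bar>a i l\<bar> \<le> int A"
    "\<And>i. i < m \<Longrightarrow> u i = lin k (a i) w / of_int b"
  then show ?thesis using assms(2) by (intro bounded_spanI[of b A' m k a]) (auto dest!: a(1))
qed

lemma bounded_span_self: "bounded_span 1 k w k w"
  by (rule bounded_spanI[where b = 1 and a = "\<lambda>i l. if l = i then 1 else 0"]) (simp_all add: lin_unit)

lemma lin_lin: "lin m c (\<lambda>i. lin k (a i) w) = lin k (\<lambda>l. \<Sum>i<m. c i * a i l) w"
  by (simp add: lin_def sum_distrib_left sum_distrib_right sum.swap[of _ "{..<m}" "{..<k}"] mult.assoc)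

text \<open>Over the denominator \<open>b * d\<close> the old numerators are multiplied by
  \<open>d\<close> and the new one is a sum of \<open>m\<close> products. The factor is
  \<open>Suc m\<close> rather than \<open>m\<close> because the old numerators and the denominator
  also have to fit, even for \<open>m = 0\<close>.\<close>

lemma bounded_span_snoc:
  assumes u: "bounded_span A k w m u" and c: "\<And>i. i < m \<Longrightarrow> \<bar>c i\<bar> \<le> int C" and d: "1 \<le> d" "d \<le> int C"
  shows "bounded_span (A * (Suc m * C)) k w (Suc m) (u(m := lin m c u / of_int d))"
proof -
  obtain b a where b: "1 \<le> b" "b \<le> int A" and a: "\<And>i l. i < m \<Longrightarrow> l < k \<Longrightarrow> \<bar>a i l\<bar> \<le> int A"
    and ua: "\<And>i. i < m \<Longrightarrow> u i = lin k (a i) w / of_int b"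
    using u unfolding bounded_span_def by blast
  let ?a = "\<lambda>i l. if i = m then \<Sum>j<m. c j * a j l else d * a i l"
  have C: "0 \<le> int C" using d by simp
  have prod: "x * y \<le> int (A * C)" if "0 \<le> x" "x \<le> int A" "0 \<le> y" "y \<le> int C" for x y
    using mult_mono[OF that(2,4)] that by simp
  have AC: "int (A * C) \<le> int (A * (Suc m * C))" by (simp add: algebra_simps)
  show ?thesis
  proof (rule bounded_spanI[where b = "b * d" and a = ?a])
    show "1 \<le> b * d" using mult_mono[of 1 b 1 d] b d by simp
    show "b * d \<le> int (A * (Suc m * C))" using prod[of b d] b d AC by linarith
  next
    fix i l assume i: "i < Suc m" and l: "l < k"
    show "\<bar>?a i l\<bar> \<le> int (A * (Suc m * C))"
    proof (cases "i = m")
      case True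
      have "\<bar>\<Sum>j<m. c j * a j l\<bar> \<le> (\<Sum>j<m. \<bar>a j l\<bar> * \<bar>c j\<bar>)"
        by (rule order_trans[OF sum_abs]) (simp add: abs_mult mult.commute)
      also have "\<dots> \<le> (\<Sum>j<m. int (A * C))"
        by (intro sum_mono prod) (use a c l in auto)
      also have "\<dots> \<le> int (A * (Suc m * C))" by (simp add: algebra_simps)
      finally show ?thesis using True by simp
    next
      case False
      then have "\<bar>a i l\<bar> * d \<le> int (A * C)" using i l a d by (intro prod) auto
      then show ?thesis using False AC d by (simp add: abs_mult mult.commute)
    qed
  next
    fix i assume i: "i < Suc m"
    show "(u(m := lin m c u / of_int d)) i = lin k (?a i) w / of_int (b * d)"
    proof (cases "i = m")
      case True
      have "lin m c u = lin m c (\<lambda>i. (1 / of_int b) * lin k (a i) w)"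
        by (rule lin_cong) (simp_all add: ua)
      also have "\<dots> = (1 / of_int b) * lin m c (\<lambda>i. lin k (a i) w)"
        by (simp add: lin_def sum_distrib_left algebra_simps)
      finally show ?thesis using True by (simp add: lin_lin)
    next
      case False
      then show ?thesis using i ua[of i] d by (simp add: lin_scale)
    qed
  qed
qed

text \<open>The precision on the parameters that leaves precision \<open>B\<close> after
  \<open>n\<close> extensions, each costing \<open>b\<close> to
  \<open>2 * b\<^sup>2\<close>.\<close>

definition elim_bound :: "nat \<Rightarrow> nat \<Rightarrow> nat" where
  "elim_bound B n = rec_nat B (\<lambda>_ b. 2 * b\<^sup>2) n"

lemma elim_bound_simps [simp]:
  "elim_bound B 0 = B" "elim_bound B (Suc n) = 2 * (elim_bound B n)\<^sup>2"
  by (simp_all add: elim_bound_def)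

lemma elim_bound_add: "elim_bound B (m + n) = elim_bound (elim_bound B n) m"
  by (induction m) auto

lemma le_two_square: "b \<le> 2 * b\<^sup>2" for b :: nat
  by (cases b) (auto simp: power2_eq_square)

lemma elim_bound_ge: "B \<le> elim_bound B n"
  by (induction n) (auto intro: order_trans[OF _ le_two_square])

text \<open>The entries of \<open>p\<close> from position \<open>k\<close> on are imitated over
  \<open>q\<close> one at a time. Precision is spent on the way, from \<open>elim_bound B n\<close>
  down to \<open>B\<close>, while each step enlarges the span bound by a factor of at most
  \<open>(k + n) * elim_bound B n\<close>.\<close>

lemma sign_eq_extend_block:
  assumes "sign_eq (elim_bound B n) k p q" "1 \<le> B" "0 < k" "q 0 = 1" "bounded_span A l w k q"
  shows "\<exists>q'. (\<forall>i<k. q' i = q i) \<and> sign_eq B (k + n) p q' \<and>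
    bounded_span (A * ((k + n) * elim_bound B n) ^ n) l w (k + n) q'"
  using assms
proof (induction n arbitrary: k q A)
  case 0
  then show ?case by auto
next
  case (Suc n)
  let ?b = "elim_bound B n" and ?b' = "elim_bound B (Suc n)"
  have b1: "1 \<le> ?b" using elim_bound_ge[of B n] Suc.prems by simp
  have pq: "sign_eq (2 * ?b\<^sup>2) k p q" using Suc.prems by simp
  obtain c d where c: "\<And>i. i < k \<Longrightarrow> \<bar>c i\<bar> \<le> int (2 * ?b\<^sup>2)" and d: "1 \<le> d" "d \<le> int (2 * ?b\<^sup>2)"
    and se: "sign_eq ?b (Suc k) (p(k := p k)) (q(k := lin k c q / of_int d))"
    using sign_eq_extend[OF pq b1 Suc.prems(3,4), of "p k"] by blast
  let ?q = "q(k := lin k c q / of_int d)"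
  have sp: "bounded_span (A * (Suc k * ?b')) l w (Suc k) ?q"
    using bounded_span_snoc[OF Suc.prems(5), of c "2 * ?b\<^sup>2" d] c d by simp
  have q0: "?q 0 = 1" using Suc.prems by simp
  have se': "sign_eq ?b (Suc k) p ?q" using se by simp
  obtain q' where q': "\<And>i. i < Suc k \<Longrightarrow> q' i = ?q i" "sign_eq B (Suc k + n) p q'"
    "bounded_span (A * (Suc k * ?b') * ((Suc k + n) * ?b) ^ n) l w (Suc k + n) q'"
    using Suc.IH[OF se' Suc.prems(2) zero_less_Suc q0 sp] by blast
  have "A * (Suc k * ?b') * ((Suc k + n) * ?b) ^ n \<le> A * ((k + Suc n) * ?b') * ((k + Suc n) * ?b') ^ n"
    using le_two_square[of ?b] by (intro mult_mono power_mono) auto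
  also have "\<dots> = A * ((k + Suc n) * ?b') ^ Suc n" by (simp only: power_Suc mult.assoc)
  finally have "bounded_span (A * ((k + Suc n) * ?b') ^ Suc n) l w (k + Suc n) q'"
    using bounded_span_mono[OF q'(3)] by simp
  moreover have "\<forall>i<k. q' i = q i" using q'(1) by auto
  moreover have "sign_eq B (k + Suc n) p q'" using q'(2) by simp
  ultimately show ?case by blast
qed

section \<open>Coding vectors by natural numbers\<close>

definition dig :: "nat \<Rightarrow> nat \<Rightarrow> nat \<Rightarrow> nat" where
  "dig M c i = c div M ^ i mod M"

lemma ex_digits: "(\<And>i. i < n \<Longrightarrow> f i < M) \<Longrightarrow> \<exists>c < M ^ n. \<forall>i<n. dig M c i = f i"
proof (induction n)
  case 0
  then show ?case by auto
next
  case (Suc n)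
  then obtain c where c: "c < M ^ n" "\<And>i. i < n \<Longrightarrow> dig M c i = f i" by (meson less_SucI)
  have fn: "f n < M" using Suc.prems by simp
  let ?c = "c + f n * M ^ n"
  have "?c < Suc (f n) * M ^ n" using c(1) by simp
  also have "\<dots> \<le> M * M ^ n" using fn by (intro mult_right_mono) auto
  finally have "?c < M ^ Suc n" by simp
  moreover have "dig M ?c i = f i" if i: "i < Suc n" for i
  proof (cases "i = n")
    case True
    have "M ^ n \<noteq> 0" using c(1) by linarith
    then have "?c div M ^ n = f n" using div_mult_self1[of "M ^ n" c "f n"] c(1) by simp
    then show ?thesis using True fn by (simp add: dig_def)
  next
    case False
    then have "i < n" using i by simp
    then have "n = Suc (n - Suc i) + i" by simp
    then have "M ^ n = M ^ (Suc (n - Suc i) + i)" by (rule arg_cong)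
    then have "M ^ n = M ^ Suc (n - Suc i) * M ^ i" by (simp only: power_add)
    then have "?c = c + (f n * M ^ (n - Suc i) * M) * M ^ i" by simp
    moreover have "M ^ i \<noteq> 0" using fn by simp
    ultimately have "?c div M ^ i = c div M ^ i + f n * M ^ (n - Suc i) * M"
      by (metis add.commute div_mult_self1 mult.commute)
    then show ?thesis using c(2)[OF \<open>i < n\<close>] by (simp add: dig_def)
  qed
  ultimately show ?case by blast
qed

text \<open>
  A code \<open>c\<close> for \<open>K\<close> real numbers consists of \<open>K * k\<close> digits for the coefficients, shifted by \<open>A\<close>,
  followed by one digit for the common denominator, shifted by \<open>-1\<close>.
\<close>

definition comb :: "nat \<Rightarrow> nat \<Rightarrow> (nat \<Rightarrow> real) \<Rightarrow> nat \<Rightarrow> nat \<Rightarrow> nat \<Rightarrow> real" where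
  "comb A k w K c i =
     (\<Sum>l<k. of_int (int (dig (2 * A + 1) c (i * k + l)) - int A) * w l) / of_nat (1 + dig (2 * A + 1) c (K * k))"

lemma dig_less: "0 < M \<Longrightarrow> dig M c i < M"
  by (simp add: dig_def)

text \<open>Every code, sensible or not, decodes to numerators between \<open>-A\<close> and
  \<open>A\<close> and a denominator between \<open>1\<close> and \<open>2 * A + 1\<close>. The
  parameters are brought to the same denominator, so it also bounds their numerators.\<close>

lemma comb_span:
  "bounded_span (2 * A + 1) k w (k + d) (\<lambda>i. if i < k then w i else comb A k w K c i)"
proof -
  let ?b = "int (1 + dig (2 * A + 1) c (K * k))"
  let ?a = "\<lambda>i l. if i < k then if l = i then ?b else 0 else int (dig (2 * A + 1) c (i * k + l)) - int A"
  have dig: "dig (2 * A + 1) c j \<le> 2 * A" for j using dig_less[of "2 * A + 1" c j] by simp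
  show ?thesis
  proof (rule bounded_spanI[where b = ?b and a = ?a])
    show "?b \<le> int (2 * A + 1)" using dig[of "K * k"] by linarith
    show "\<bar>?a i l\<bar> \<le> int (2 * A + 1)" for i l
      using dig[of "i * k + l"] dig[of "K * k"] by (cases "i < k"; cases "l = i"; simp; linarith?)
    show "(if i < k then w i else comb A k w K c i) = lin k (?a i) w / of_int ?b" for i
    proof (cases "i < k")
      case True
      then have "lin k (?a i) w = lin k (\<lambda>l. ?b * (if l = i then 1 else 0)) w"
        by (intro lin_cong) auto
      also have "\<dots> = of_int ?b * w i" by (simp only: lin_scale lin_unit[OF True])
      finally show ?thesis using True by simp
    qed (simp add: comb_def lin_def)
  qed simp
qed

text \<open>\<open>K\<close> may exceed \<open>m\<close>: both quantifier blocks share the layout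
  for all \<open>K\<close> coordinates, and the digits of coordinates not yet chosen are filled with
  \<open>0\<close>.\<close>

lemma comb_code:
  assumes u: "bounded_span A k w m u" and m: "m \<le> K" and k: "0 < k"
  shows "\<exists>c < (2 * A + 1) ^ (K * k + 1). \<forall>i<m. u i = comb A k w K c i"
proof -
  obtain b a where b: "1 \<le> b" "b \<le> int A" and a: "\<And>i l. i < m \<Longrightarrow> l < k \<Longrightarrow> \<bar>a i l\<bar> \<le> int A"
    and ua: "\<And>i. i < m \<Longrightarrow> u i = lin k (a i) w / of_int b"
    using u unfolding bounded_span_def by blast
  define f where "f j = (if j = K * k then nat (b - 1) else if j div k < m then nat (a (j div k) (j mod k) + int A) else 0)" for j
  have "f j < 2 * A + 1" for j
  proof -
    have "j mod k < k" using k by simp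
    then show ?thesis using b a[of "j div k" "j mod k"] by (auto simp: f_def)
  qed
  then obtain c where c: "c < (2 * A + 1) ^ (K * k + 1)" "\<And>j. j < K * k + 1 \<Longrightarrow> dig (2 * A + 1) c j = f j"
    using ex_digits[of "K * k + 1" f "2 * A + 1"] by blast
  have "u i = comb A k w K c i" if i: "i < m" for i
  proof -
    have "int (dig (2 * A + 1) c (i * k + l)) - int A = a i l" if l: "l < k" for l
    proof -
      have "i * k + l < Suc i * k" using l by simp
      also have "\<dots> \<le> K * k" using i m by (intro mult_right_mono) auto
      finally have lt: "i * k + l < K * k" .
      have dm: "(i * k + l) div k = i" "(i * k + l) mod k = l" using l by simp_all
      show ?thesis using lt c(2)[of "i * k + l"] i a[OF i l] unfolding f_def dm by simp
    qed
    moreover have "real (1 + dig (2 * A + 1) c (K * k)) = of_int b"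
      using c(2)[of "K * k"] b by (simp add: f_def)
    ultimately show ?thesis using ua[OF i] by (simp add: comb_def lin_def)
  qed
  with c(1) show ?thesis by blast
qed

section \<open>Elimination of two quantifier blocks\<close>

text \<open>The growth factor of \<open>sign_eq_extend_block\<close> for \<open>n\<close> variables
  over \<open>k\<close> parameters.\<close>

definition code_bound :: "nat \<Rightarrow> nat \<Rightarrow> nat \<Rightarrow> nat" where
  "code_bound B k n = ((k + n) * elim_bound B n) ^ n"

text \<open>A real witness for the first block is replaced by a coded one with the same signs up to
  precision \<open>elim_bound B n\<close>; this is exactly what the second block consumes.
  Counterexamples in the second block are built over the coded first block, whence the product in
  \<open>V\<close>.\<close>

theorem bounded_quantifiers:
  fixes \<Phi> :: "(nat \<Rightarrow> real) \<Rightarrow> bool"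
  assumes p0: "p 0 = 1" and k: "0 < k" and B: "1 \<le> B"
    and det: "\<And>u v. sign_eq B (k + d + n) u v \<Longrightarrow> \<Phi> u = \<Phi> v"
    and K: "K = k + d + n" and W: "W = code_bound B k (d + n)" and V: "V = (2 * W + 1) * W"
  shows "(\<exists>u. (\<forall>i<k. u i = p i) \<and> (\<forall>v. (\<forall>i<k+d. v i = u i) \<longrightarrow> \<Phi> v)) \<longleftrightarrow>
    (\<exists>cE < (2 * W + 1) ^ (K * k + 1). \<forall>cF < (2 * V + 1) ^ (K * k + 1).
       \<Phi> (\<lambda>i. if i < k then p i else if i < k + d then comb W k p K cE i else comb V k p K cF i))"
proof -
  have eb: "elim_bound B n \<le> elim_bound B (d + n)"
    unfolding elim_bound_add by (rule elim_bound_ge)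
  have B1: "1 \<le> elim_bound B n" using elim_bound_ge[of B n] B by simp
  let ?X = "(k + (d + n)) * elim_bound B (d + n)"
  have X: "1 \<le> ?X" using k eb B1 mult_mono[of 1 "k + (d + n)" 1 "elim_bound B (d + n)"] by simp
  have Wd: "((k + d) * elim_bound (elim_bound B n) d) ^ d \<le> W"
  proof -
    have "((k + d) * elim_bound (elim_bound B n) d) ^ d \<le> ?X ^ d"
      by (intro power_mono mult_mono) (simp_all add: elim_bound_add)
    also have "\<dots> \<le> ?X ^ (d + n)" using X by (intro power_increasing) auto
    finally show ?thesis by (simp add: W code_bound_def)
  qed
  have Wn: "((k + d + n) * elim_bound B n) ^ n \<le> W"
  proof -
    have "((k + d + n) * elim_bound B n) ^ n \<le> ?X ^ n"
      by (intro power_mono mult_mono) (use eb in simp_all)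
    also have "\<dots> \<le> ?X ^ (d + n)" using X by (intro power_increasing) auto
    finally show ?thesis by (simp add: W code_bound_def)
  qed
  \<comment> \<open>The back-and-forth step: a completion over one vector is imitated over any
    sign-equivalent vector, without changing the truth of \<open>\<Phi>\<close> and inside a
    controlled span.\<close>
  have inner: "\<exists>v'. (\<forall>i<k+d. v' i = u' i) \<and> bounded_span (A * W) l w K v' \<and> \<Phi> v' = \<Phi> v"
    if uu: "sign_eq (elim_bound B n) (k + d) v u'" and u0: "u' 0 = 1" and sp: "bounded_span A l w (k + d) u'" for u' v A l w
  proof -
    obtain v' where v': "\<forall>i<k+d. v' i = u' i" "sign_eq B (k + d + n) v v'"
      "bounded_span (A * ((k + d + n) * elim_bound B n) ^ n) l w (k + d + n) v'"
      using sign_eq_extend_block[OF uu B _ u0 sp] k by auto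
    have "bounded_span (A * W) l w K v'"
      using bounded_span_mono[OF v'(3), of "A * W"] Wn by (simp add: K)
    then show ?thesis using v' det by blast
  qed
  show ?thesis
  proof
    assume "\<exists>u. (\<forall>i<k. u i = p i) \<and> (\<forall>v. (\<forall>i<k+d. v i = u i) \<longrightarrow> \<Phi> v)"
    then obtain u where u: "\<And>i. i < k \<Longrightarrow> u i = p i" "\<And>v. (\<And>i. i < k+d \<Longrightarrow> v i = u i) \<Longrightarrow> \<Phi> v" by blast
    \<comment> \<open>Both vectors agree on the parameters, so the extension may start with any
      precision.\<close>
    have "sign_eq (elim_bound (elim_bound B n) d) k u p"
      using sign_eq_refl sign_eq_cong[of k u p p p] u(1) by blast
    from sign_eq_extend_block[OF this B1 k p0 bounded_span_self]
    obtain u' where u': "\<And>i. i < k \<Longrightarrow> u' i = p i" "sign_eq (elim_bound B n) (k + d) u u'"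
      "bounded_span (1 * ((k + d) * elim_bound (elim_bound B n) d) ^ d) k p (k + d) u'" by blast
    have "bounded_span W k p (k + d) u'" using bounded_span_mono[OF u'(3)] Wd by simp
    from comb_code[OF this, of K] k obtain cE where cE: "cE < (2 * W + 1) ^ (K * k + 1)"
      "\<And>i. i < k + d \<Longrightarrow> u' i = comb W k p K cE i" by (auto simp: K)
    \<comment> \<open>The coded vector inherits the property of \<open>u\<close>: a completion over
      \<open>u'\<close> is carried back to one over \<open>u\<close>, where \<open>\<Phi>\<close>
      holds.\<close>
    have \<Phi>: "\<Phi> v" if v: "\<And>i. i < k + d \<Longrightarrow> v i = u' i" for v
    proof -
      have "sign_eq (elim_bound B n) (k + d) v u"
        using sign_eq_sym[OF u'(2)] sign_eq_cong[of "k + d" v u' u u] v by blast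
      moreover have "u 0 = 1" using u(1)[of 0] p0 k by simp
      ultimately obtain v' where "\<forall>i<k+d. v' i = u i" "\<Phi> v' = \<Phi> v"
        using inner[of v u 1 "k + d" u] bounded_span_self by blast
      then show ?thesis using u(2) by blast
    qed
    show "\<exists>cE < (2 * W + 1) ^ (K * k + 1). \<forall>cF < (2 * V + 1) ^ (K * k + 1).
       \<Phi> (\<lambda>i. if i < k then p i else if i < k + d then comb W k p K cE i else comb V k p K cF i)"
      using cE u'(1) by (intro exI[of _ cE] conjI allI impI \<Phi>) auto
  next
    assume "\<exists>cE < (2 * W + 1) ^ (K * k + 1). \<forall>cF < (2 * V + 1) ^ (K * k + 1).
       \<Phi> (\<lambda>i. if i < k then p i else if i < k + d then comb W k p K cE i else comb V k p K cF i)"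
    then obtain cE where cE: "\<And>cF. cF < (2 * V + 1) ^ (K * k + 1) \<Longrightarrow>
       \<Phi> (\<lambda>i. if i < k then p i else if i < k + d then comb W k p K cE i else comb V k p K cF i)" by blast
    define u where "u = (\<lambda>i. if i < k then p i else comb W k p K cE i)"
    \<comment> \<open>The decoded first block has numerators and denominators up to
      \<open>2 * W + 1\<close>; the second block multiplies this by \<open>W\<close>, which gives
      \<open>V\<close>.\<close>
    have sp: "bounded_span (2 * W + 1) k p (k + d) u" unfolding u_def by (rule comb_span)
    have "\<Phi> v" if v: "\<And>i. i < k + d \<Longrightarrow> v i = u i" for v
    proof -
      have "sign_eq (elim_bound B n) (k + d) v u"
        using sign_eq_refl[of _ _ u] sign_eq_cong[of "k + d" v u u u] v by blast
      moreover have "u 0 = 1" using p0 k by (simp add: u_def)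
      ultimately obtain v' where v': "\<And>i. i < k + d \<Longrightarrow> v' i = u i" "bounded_span V k p K v'" "\<Phi> v' = \<Phi> v"
        using inner[OF _ _ sp, of v] V by blast
      from comb_code[OF v'(2), of K] k obtain cF where cF: "cF < (2 * V + 1) ^ (K * k + 1)"
        "\<And>i. i < K \<Longrightarrow> v' i = comb V k p K cF i" by blast
      let ?v = "\<lambda>i. if i < k then p i else if i < k + d then comb W k p K cE i else comb V k p K cF i"
      have "sign_eq B (k + d + n) ?v v'"
      proof -
        have "?v i = v' i" if "i < k + d + n" for i
          using cF(2)[of i] v'(1)[of i] that by (auto simp: u_def K)
        then show ?thesis using sign_eq_refl[of _ _ v'] sign_eq_cong[of "k + d + n" ?v v' v' v'] by blast
      qed
      from det[OF this] cE[OF cF(1)] v'(3) show ?thesis by simp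
    qed
    moreover have "\<forall>i<k. u i = p i" by (simp add: u_def)
    ultimately show "\<exists>u. (\<forall>i<k. u i = p i) \<and> (\<forall>v. (\<forall>i<k+d. v i = u i) \<longrightarrow> \<Phi> v)" by blast
  qed
qed

section \<open>Divisors of rational functions\<close>

type_synonym chips = "(int \<times> description) list"

section \<open>Chips and the functions they bend\<close>

definition chip_sum :: "chips \<Rightarrow> (description \<Rightarrow> bool) \<Rightarrow> int" where
  "chip_sum ds P = (\<Sum>(k, p) \<leftarrow> ds. if P p then k else 0)"

lemma chip_sum_simps [simp]:
  "chip_sum [] P = 0"
  "chip_sum ((k, p) # ds) P = (if P p then k else 0) + chip_sum ds P"
  "chip_sum (ds @ ds') P = chip_sum ds P + chip_sum ds' P"
  by (simp_all add: chip_sum_def)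

lemma chip_sum_cong: "(\<And>k p. (k, p) \<in> set ds \<Longrightarrow> P p = Q p) \<Longrightarrow> chip_sum ds P = chip_sum ds Q"
  unfolding chip_sum_def by (intro arg_cong[where f = sum_list] map_cong) auto

lemma chip_sum_disj:
  assumes "\<And>p. \<not> (P p \<and> Q p)"
  shows "chip_sum ds (\<lambda>p. P p \<or> Q p) = chip_sum ds P + chip_sum ds Q"
proof (induction ds)
  case (Cons d ds)
  then show ?case using assms[of "snd d"] by (cases d) auto
qed simp

abbreviation edge_weight :: "chips \<Rightarrow> nat \<Rightarrow> int" where
  "edge_weight ds e \<equiv> chip_sum ds (\<lambda>p. \<exists>z. p = On e z)"

abbreviation vertex_weight :: "chips \<Rightarrow> nat \<Rightarrow> int" where
  "vertex_weight ds v \<equiv> chip_sum ds (\<lambda>p. p = At v)"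

text \<open>The function that is \<open>0\<close> up to the chip and has slope 1 after it. A chip at
  infinity is never passed; the guard is essential because
  \<open>real_of_ereal \<infinity> = 0\<close> would move it to the beginning of the edge.\<close>

fun hinge :: "nat \<Rightarrow> description \<Rightarrow> real \<Rightarrow> real" where
  "hinge e (At v) y = 0"
| "hinge e (On e' z) y = (if e' = e \<and> z \<noteq> \<infinity> then max 0 (y - real_of_ereal z) else 0)"

text \<open>The solution on the edge of "second derivative equals the chips" that vanishes before
  the first chip. A function with the right divisor inside the edge differs from it by an affine
  function.\<close>

definition kink :: "chips \<Rightarrow> nat \<Rightarrow> real \<Rightarrow> real" where
  "kink ds e y = (\<Sum>(k, p) \<leftarrow> ds. of_int k * hinge e p y)"

lemma kink_simps [simp]:
  "kink [] e y = 0"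
  "kink ((k, p) # ds) e y = of_int k * hinge e p y + kink ds e y"
  "kink (ds @ ds') e y = kink ds e y + kink ds' e y"
  by (simp_all add: kink_def)

lemma kink_zero: "\<forall>(k, p) \<in> set ds. \<forall>z. p = On e z \<longrightarrow> 0 \<le> z \<Longrightarrow> kink ds e 0 = 0"
proof (induction ds)
  case (Cons d ds)
  obtain k p where d: "d = (k, p)" by (cases d)
  have "hinge e p 0 = 0"
  proof (cases p)
    case (On e' z)
    with Cons.prems d show ?thesis by (cases z) auto
  qed simp
  with Cons d show ?case by simp
qed simp

lemma continuous_hinge: "continuous_on UNIV (hinge e p)"
proof (cases p)
  case (At v)
  then have "hinge e p = (\<lambda>y. 0)" by auto
  then show ?thesis by simp
next
  case (On e' z)
  then have "hinge e p = (\<lambda>y. if e' = e \<and> z \<noteq> \<infinity> then max 0 (y - real_of_ereal z) else 0)" by auto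
  then show ?thesis
    by (cases "e' = e \<and> z \<noteq> \<infinity>") (auto intro!: continuous_intros)
qed

lemma continuous_kink: "continuous_on UNIV (kink ds e)"
proof (induction ds)
  case Nil
  have "kink [] e = (\<lambda>y. 0)" by auto
  then show ?case by simp
next
  case (Cons d ds)
  obtain k p where d: "d = (k, p)" by (cases d)
  have "kink (d # ds) e = (\<lambda>y. of_int k * hinge e p y + kink ds e y)" by (auto simp: d)
  then show ?case using Cons continuous_hinge by (auto intro!: continuous_intros)
qed

text \<open>Between consecutive chips every hinge is affine: it is \<open>y - z\<close> for a chip
  already passed and \<open>0\<close> otherwise.\<close>

lemma kink_gap:
  assumes "\<forall>(k, p) \<in> set ds. \<forall>z. p = On e z \<longrightarrow> z \<noteq> -\<infinity> \<and> (z \<le> \<alpha> \<or> \<beta> \<le> z)" "\<alpha> < \<beta>"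
  shows "\<exists>a::real. \<forall>y::real. \<alpha> < ereal y \<and> ereal y < \<beta> \<longrightarrow>
    kink ds e y = a + of_int (chip_sum ds (\<lambda>p. \<exists>z\<le>\<alpha>. p = On e z)) * y"
  using assms(1)
proof (induction ds)
  case Nil
  then show ?case by simp
next
  case (Cons d ds)
  obtain k p where d: "d = (k, p)" by (cases d)
  let ?c = "chip_sum ds (\<lambda>p. \<exists>z\<le>\<alpha>. p = On e z)"
  from Cons obtain a where a: "\<And>y. \<alpha> < ereal y \<Longrightarrow> ereal y < \<beta> \<Longrightarrow> kink ds e y = a + of_int ?c * y" by auto
  show ?case
  proof (cases "\<exists>z\<le>\<alpha>. p = On e z")
    case True
    then obtain z where z: "z \<le> \<alpha>" "p = On e z" by blast
    with Cons.prems d have "z \<noteq> -\<infinity>" by auto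
    moreover have "z \<noteq> \<infinity>" using z assms(2) by auto
    ultimately obtain r where r: "z = ereal r" by (cases z) auto
    have "kink (d # ds) e y = (a - of_int k * r) + of_int (k + ?c) * y"
      if y: "\<alpha> < ereal y" "ereal y < \<beta>" for y
    proof -
      have "ereal r < ereal y" using y z r by (metis order.strict_trans1)
      then show ?thesis using a[OF y] z r d by (simp add: algebra_simps)
    qed
    then show ?thesis using True d by auto
  next
    case False
    have "hinge e p y = 0" if y: "\<alpha> < ereal y" "ereal y < \<beta>" for y
    proof (cases p)
      case (On e' z)
      show ?thesis
      proof (cases "e' = e \<and> z \<noteq> \<infinity>")
        case True
        then have "\<beta> \<le> z" "z \<noteq> -\<infinity>" using False On Cons.prems d by auto
        then have "ereal y < z" using y by simp
        with On \<open>z \<noteq> -\<infinity>\<close> show ?thesis by (cases z) auto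
      qed (use On in auto)
    qed simp
    then show ?thesis using a False d by (intro exI[of _ a]) auto
  qed
qed

definition stops :: "chips \<Rightarrow> nat \<Rightarrow> ereal set" where
  "stops ds e = {z. \<exists>k. (k, On e z) \<in> set ds}"

lemma finite_stops: "finite (stops ds e)"
proof -
  have "stops ds e \<subseteq> (\<lambda>d. case snd d of On e' z \<Rightarrow> z | At v \<Rightarrow> 0) ` set ds"
    by (force simp: stops_def)
  then show ?thesis by (rule finite_subset) simp
qed

lemma ex_gap_right:
  fixes x l :: "'a::linorder"
  assumes "finite A" "x < l"
  shows "\<exists>y. x < y \<and> y \<le> l \<and> (\<forall>z\<in>A. z \<le> x \<or> y \<le> z)"
proof -
  let ?B = "{z \<in> A. x < z}"
  have fin: "finite ?B" using assms by auto
  show ?thesis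
  proof (cases "?B = {}")
    case False
    have "Min ?B \<in> ?B" "\<And>z. z \<in> ?B \<Longrightarrow> Min ?B \<le> z" using Min_in[OF fin False] Min_le[OF fin] by auto
    then show ?thesis using assms by (intro exI[of _ "min l (Min ?B)"]) (auto simp: not_le min_le_iff_disj)
  qed (use assms in \<open>auto intro!: exI[of _ l] simp: not_less\<close>)
qed

lemma ex_gap_left:
  fixes x l :: "'a::linorder"
  assumes "finite A" "l < x"
  shows "\<exists>y. y < x \<and> l \<le> y \<and> (\<forall>z\<in>A. z \<le> y \<or> x \<le> z)"
proof -
  let ?B = "{z \<in> A. z < x}"
  have fin: "finite ?B" using assms by auto
  show ?thesis
  proof (cases "?B = {}")
    case False
    have "Max ?B \<in> ?B" "\<And>z. z \<in> ?B \<Longrightarrow> z \<le> Max ?B" using Max_in[OF fin False] Max_ge[OF fin] by auto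
    then show ?thesis using assms by (intro exI[of _ "max l (Max ?B)"]) (auto simp: not_le le_max_iff_disj)
  qed (use assms in \<open>auto intro!: exI[of _ l] simp: not_less\<close>)
qed

section \<open>One-sided slopes and orders\<close>

lemma at_right_ne_bot_ereal: "x < l \<Longrightarrow> at_right (x::ereal) \<noteq> bot"
  unfolding trivial_limit_def by (subst eventually_at_right, assumption) (use dense in blast)

lemma at_left_ne_bot_ereal: "l < x \<Longrightarrow> at_left (x::ereal) \<noteq> bot"
  unfolding trivial_limit_def by (subst eventually_at_left, assumption) (use dense in blast)

lemma affine_at_right:
  fixes g :: "ereal \<Rightarrow> ereal"
  assumes "x < y" "\<And>r. x < ereal r \<Longrightarrow> ereal r < y \<Longrightarrow> g (ereal r) = ereal (a + of_int s * r)"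
    and "x \<noteq> -\<infinity>"
  shows "\<forall>\<^sub>F z in at_right x. g z = ereal (a + of_int s * real_of_ereal z)"
proof -
  have "g z = ereal (a + of_int s * real_of_ereal z)" if "x < z" "z < y" for z
    using that assms(2) by (cases z) auto
  then show ?thesis using assms(1) by (subst eventually_at_right[OF assms(1)]) blast
qed

lemma affine_at_left:
  fixes g :: "ereal \<Rightarrow> ereal"
  assumes "y < x" "\<And>r. y < ereal r \<Longrightarrow> ereal r < x \<Longrightarrow> g (ereal r) = ereal (a + of_int s * r)"
  shows "\<forall>\<^sub>F z in at_left x. g z = ereal (a + of_int s * real_of_ereal z)"
proof -
  have "g z = ereal (a + of_int s * real_of_ereal z)" if "y < z" "z < x" for z
    using that assms(2) by (cases z) auto
  then show ?thesis using assms(1) by (subst eventually_at_left[OF assms(1)]) blast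
qed

lemma slope_right:
  assumes "x < l" "\<forall>\<^sub>F z in at_right x. g z = ereal (a + of_int s * real_of_ereal z)"
  shows "slope g (at_right x) = s"
  using assms(2) at_right_ne_bot_ereal[OF assms(1)] by (rule slope_eqI[where y = x]) (simp add: at_le)

lemma slope_left:
  assumes "l < x" "\<forall>\<^sub>F z in at_left x. g z = ereal (a + of_int s * real_of_ereal z)"
  shows "slope g (at_left x) = s"
  using assms(2) at_left_ne_bot_ereal[OF assms(1)] by (rule slope_eqI[where y = x]) (simp add: at_le)

lemma kink_right:
  assumes x: "0 \<le> x" "x < l" and ds: "\<forall>(k, p) \<in> set ds. \<forall>z. p = On e z \<longrightarrow> 0 \<le> z"
  shows "\<exists>a. \<forall>\<^sub>F z in at_right x. ereal (kink ds e (real_of_ereal z)) =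
    ereal (a + of_int (chip_sum ds (\<lambda>p. \<exists>z\<le>x. p = On e z)) * real_of_ereal z)"
proof -
  obtain y where y: "x < y" "\<forall>z\<in>stops ds e. z \<le> x \<or> y \<le> z"
    using ex_gap_right[OF finite_stops x(2)] by blast
  have "\<forall>(k, p) \<in> set ds. \<forall>z. p = On e z \<longrightarrow> z \<noteq> -\<infinity> \<and> (z \<le> x \<or> y \<le> z)"
    using y(2) ds by (fastforce simp: stops_def)
  from kink_gap[OF this y(1)] obtain a where a: "\<And>r. x < ereal r \<Longrightarrow> ereal r < y \<Longrightarrow>
      kink ds e r = a + of_int (chip_sum ds (\<lambda>p. \<exists>z\<le>x. p = On e z)) * r" by blast
  show ?thesis
    by (rule exI[of _ a], rule affine_at_right[OF y(1)]) (use a x in auto)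
qed

text \<open>Left slopes count the chips strictly before \<open>x\<close>, right slopes those up to
  \<open>x\<close>; the jump is the weight at \<open>x\<close>. The case
  \<open>x = \<infinity>\<close> gives the slope towards an unbounded end.\<close>

lemma kink_left:
  assumes x: "0 < x" and ds: "\<forall>(k, p) \<in> set ds. \<forall>z. p = On e z \<longrightarrow> 0 \<le> z"
  shows "\<exists>a. \<forall>\<^sub>F z in at_left x. ereal (kink ds e (real_of_ereal z)) =
    ereal (a + of_int (chip_sum ds (\<lambda>p. \<exists>z<x. p = On e z)) * real_of_ereal z)"
proof -
  obtain y where y: "y < x" "0 \<le> y" "\<forall>z\<in>stops ds e. z \<le> y \<or> x \<le> z"
    using ex_gap_left[OF finite_stops x] by blast
  have gap: "z \<le> y \<or> x \<le> z" if "(k, On e z) \<in> set ds" for k z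
    using y(3) that by (auto simp: stops_def)
  have "\<forall>(k, p) \<in> set ds. \<forall>z. p = On e z \<longrightarrow> z \<noteq> -\<infinity> \<and> (z \<le> y \<or> x \<le> z)"
    using gap ds by fastforce
  from kink_gap[OF this y(1)] obtain a where a: "\<And>r. y < ereal r \<Longrightarrow> ereal r < x \<Longrightarrow>
      kink ds e r = a + of_int (chip_sum ds (\<lambda>p. \<exists>z\<le>y. p = On e z)) * r" by blast
  have eq: "chip_sum ds (\<lambda>p. \<exists>z\<le>y. p = On e z) = chip_sum ds (\<lambda>p. \<exists>z<x. p = On e z)"
  proof (rule chip_sum_cong)
    fix k p assume kp: "(k, p) \<in> set ds"
    show "(\<exists>z\<le>y. p = On e z) = (\<exists>z<x. p = On e z)"
      using gap kp y(1) by (metis leD order.strict_trans1)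
  qed
  show ?thesis
    by (rule exI[of _ a], rule affine_at_left[OF y(1)]) (use a eq in auto)
qed

text \<open>As lengths are positive, an edge represents \<open>u\<close> at \<open>0\<close> iff
  \<open>u\<close> is its tail and at its length iff \<open>u\<close> is its head. A loop enters
  both sums.\<close>

lemma ord_Vertex:
  assumes \<Gamma>: "fin_digraph (graph \<Gamma>)" and pos: "\<forall>e\<in>edges \<Gamma>. 0 < len \<Gamma> e"
  shows "ord \<Gamma> f (Vertex u) =
    (\<Sum>e | e \<in> edges \<Gamma> \<and> tail (graph \<Gamma>) e = u. slope (\<lambda>y. f (chart \<Gamma> e y)) (at_right 0)) -
    (\<Sum>e | e \<in> edges \<Gamma> \<and> head (graph \<Gamma>) e = u. slope (\<lambda>y. f (chart \<Gamma> e y)) (at_left (len \<Gamma> e)))"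
proof -
  interpret fin_digraph "graph \<Gamma>" by (rule \<Gamma>)
  let ?T = "{e. e \<in> edges \<Gamma> \<and> tail (graph \<Gamma>) e = u}" and ?H = "{e. e \<in> edges \<Gamma> \<and> head (graph \<Gamma>) e = u}"
  have "{(e, x). e \<in> edges \<Gamma> \<and> 0 \<le> x \<and> x < len \<Gamma> e \<and> chart \<Gamma> e x = Vertex u} = (\<lambda>e. (e, 0)) ` ?T"
    using pos by (auto simp: chart_def split: if_splits)
  moreover have "{(e, x). e \<in> edges \<Gamma> \<and> 0 < x \<and> x \<le> len \<Gamma> e \<and> chart \<Gamma> e x = Vertex u} =
      (\<lambda>e. (e, len \<Gamma> e)) ` ?H"
    using pos by (auto simp: chart_def split: if_splits)
  moreover have "inj_on (\<lambda>e. (e, 0::ereal)) ?T" "inj_on (\<lambda>e. (e, len \<Gamma> e)) ?H" by (auto intro: inj_onI)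
  ultimately show ?thesis
    by (simp add: ord_def sum.reindex sum_negf)
qed

lemma ord_Interior:
  assumes "e \<in> edges \<Gamma>" "0 < r" "ereal r < len \<Gamma> e"
  shows "ord \<Gamma> f (Interior e r) =
    slope (\<lambda>y. f (chart \<Gamma> e y)) (at_right (ereal r)) - slope (\<lambda>y. f (chart \<Gamma> e y)) (at_left (ereal r))"
proof -
  have 1: "chart \<Gamma> e' x = Interior e r \<longleftrightarrow> e' = e \<and> x = ereal r"
    if "0 \<le> x" "x < len \<Gamma> e'" for e' x
    using that assms by (cases x) (auto simp: chart_def)
  have 2: "chart \<Gamma> e' x = Interior e r \<longleftrightarrow> e' = e \<and> x = ereal r"
    if "0 < x" "x \<le> len \<Gamma> e'" for e' x
    using that assms by (cases x) (auto simp: chart_def)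
  have "{(e', x). e' \<in> edges \<Gamma> \<and> 0 \<le> x \<and> x < len \<Gamma> e' \<and> chart \<Gamma> e' x = Interior e r} = {(e, ereal r)}"
    "{(e', x). e' \<in> edges \<Gamma> \<and> 0 < x \<and> x \<le> len \<Gamma> e' \<and> chart \<Gamma> e' x = Interior e r} = {(e, ereal r)}"
    using assms 1 2 by auto
  then show ?thesis by (simp add: ord_def)
qed

lemma ord_no_point:
  assumes "q \<notin> points \<Gamma>"
  shows "ord \<Gamma> f q = 0"
proof -
  have "{(e, x). e \<in> edges \<Gamma> \<and> 0 \<le> x \<and> x < len \<Gamma> e \<and> chart \<Gamma> e x = q} = {}"
    "{(e, x). e \<in> edges \<Gamma> \<and> 0 < x \<and> x \<le> len \<Gamma> e \<and> chart \<Gamma> e x = q} = {}"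
    using assms unfolding points_def by force+
  then show ?thesis by (simp only: ord_def sum.empty)
qed

definition chip_div :: "(nat, nat) metric_graph \<Rightarrow> chips \<Rightarrow> (nat, nat) divisor" where
  "chip_div \<Gamma> ds = (\<Sum>(k, p) \<leftarrow> ds. frag_cmul k (frag_of (described_point \<Gamma> p)))"

lemma chip_div_simps [simp]:
  "chip_div \<Gamma> [] = 0"
  "chip_div \<Gamma> ((k, p) # ds) = frag_cmul k (frag_of (described_point \<Gamma> p)) + chip_div \<Gamma> ds"
  "chip_div \<Gamma> (ds @ ds') = chip_div \<Gamma> ds + chip_div \<Gamma> ds'"
  by (simp_all add: chip_div_def)

definition valid_chips :: "(nat, nat) metric_graph \<Rightarrow> chips \<Rightarrow> bool" where
  "valid_chips \<Gamma> ds \<longleftrightarrow> (\<forall>(k, p) \<in> set ds. valid_description \<Gamma> p)"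

lemma valid_chips_simps [simp]:
  "valid_chips \<Gamma> []"
  "valid_chips \<Gamma> ((k, p) # ds) \<longleftrightarrow> valid_description \<Gamma> p \<and> valid_chips \<Gamma> ds"
  "valid_chips \<Gamma> (ds @ ds') \<longleftrightarrow> valid_chips \<Gamma> ds \<and> valid_chips \<Gamma> ds'"
  by (auto simp: valid_chips_def)

lemma lookup_chip_div:
  "Poly_Mapping.lookup (chip_div \<Gamma> ds) q = chip_sum ds (\<lambda>p. described_point \<Gamma> p = q)"
proof (induction ds)
  case (Cons d ds)
  then show ?case by (cases d) (auto simp: lookup_add lookup_single when_def)
qed simp

lemma valid_chips_on:
  assumes "valid_chips \<Gamma> ds" "(k, On e z) \<in> set ds"
  shows "e \<in> edges \<Gamma>" "0 \<le> z" "z \<le> len \<Gamma> e"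
  using assms by (auto simp: valid_chips_def)

lemma described_point_in_points: "valid_description \<Gamma> p \<Longrightarrow> described_point \<Gamma> p \<in> points \<Gamma>"
  by (cases p) (force simp: points_def)+

lemma lookup_chip_div_no_point:
  assumes "valid_chips \<Gamma> ds" "q \<notin> points \<Gamma>"
  shows "chip_sum ds (\<lambda>p. described_point \<Gamma> p = q) = 0"
proof -
  have "chip_sum ds (\<lambda>p. described_point \<Gamma> p = q) = chip_sum ds (\<lambda>p. False)"
    using assms described_point_in_points by (intro chip_sum_cong) (auto simp: valid_chips_def)
  also have "\<dots> = 0" by (induction ds) auto
  finally show ?thesis .
qed

lemma chip_sum_Interior:
  assumes v: "valid_chips \<Gamma> ds" and e: "0 < r" "ereal r < len \<Gamma> e"
  shows "chip_sum ds (\<lambda>p. described_point \<Gamma> p = Interior e r) = chip_sum ds (\<lambda>p. p = On e (ereal r))"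
proof (rule chip_sum_cong)
  fix k p assume kp: "(k, p) \<in> set ds"
  show "(described_point \<Gamma> p = Interior e r) = (p = On e (ereal r))"
  proof (cases p)
    case (On e' z)
    with kp v have "0 \<le> z" "z \<le> len \<Gamma> e'" using valid_chips_on by blast+
    with On e show ?thesis by (cases z) (auto simp: chart_def)
  qed simp
qed

text \<open>A vertex has several descriptions, by name and as either end of its edges; positive
  lengths keep the two ends of a loop from being the same description.\<close>

lemma chip_sum_Vertex:
  assumes fin: "finite (edges \<Gamma>)" and pos: "\<forall>e\<in>edges \<Gamma>. 0 < len \<Gamma> e" and v: "valid_chips \<Gamma> ds"
  shows "chip_sum ds (\<lambda>p. described_point \<Gamma> p = Vertex u) = vertex_weight ds u +
    (\<Sum>e | e \<in> edges \<Gamma> \<and> tail (graph \<Gamma>) e = u. chip_sum ds (\<lambda>p. p = On e 0)) +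
    (\<Sum>e | e \<in> edges \<Gamma> \<and> head (graph \<Gamma>) e = u. chip_sum ds (\<lambda>p. p = On e (len \<Gamma> e)))"
  using v
proof (induction ds)
  case (Cons d ds)
  obtain k p where d: "d = (k, p)" by (cases d)
  let ?T = "{e. e \<in> edges \<Gamma> \<and> tail (graph \<Gamma>) e = u}" and ?H = "{e. e \<in> edges \<Gamma> \<and> head (graph \<Gamma>) e = u}"
  have fin': "finite ?T" "finite ?H" using fin by auto
  have "(if described_point \<Gamma> p = Vertex u then k else 0) = (if p = At u then k else 0) +
     (\<Sum>e\<in>?T. if p = On e 0 then k else 0) + (\<Sum>e\<in>?H. if p = On e (len \<Gamma> e) then k else 0)"
  proof (cases p)
    case (On e' z)
    have e': "e' \<in> edges \<Gamma>" "0 \<le> z" "z \<le> len \<Gamma> e'" using Cons.prems d On by auto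
    have "(\<Sum>e\<in>?T. if p = On e 0 then k else 0) = (\<Sum>e\<in>?T. if e = e' then (if z = 0 then k else 0) else 0)"
      by (rule sum.cong) (auto simp: On)
    also have "\<dots> = (if tail (graph \<Gamma>) e' = u \<and> z = 0 then k else 0)"
      using e' fin' by (simp add: sum.delta')
    finally have 1: "(\<Sum>e\<in>?T. if p = On e 0 then k else 0) = (if tail (graph \<Gamma>) e' = u \<and> z = 0 then k else 0)" .
    have "(\<Sum>e\<in>?H. if p = On e (len \<Gamma> e) then k else 0) =
        (\<Sum>e\<in>?H. if e = e' then (if z = len \<Gamma> e' then k else 0) else 0)"
      by (rule sum.cong) (auto simp: On)
    also have "\<dots> = (if head (graph \<Gamma>) e' = u \<and> z = len \<Gamma> e' then k else 0)"
      using e' fin' by (simp add: sum.delta')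
    finally have 2: "(\<Sum>e\<in>?H. if p = On e (len \<Gamma> e) then k else 0) =
        (if head (graph \<Gamma>) e' = u \<and> z = len \<Gamma> e' then k else 0)" .
    show ?thesis using e' pos unfolding 1 2 by (auto simp: On chart_def)
  qed simp
  with Cons d show ?case by (simp add: sum.distrib)
qed simp

lemma slopes_of_form:
  fixes g :: "ereal \<Rightarrow> ereal" and s :: int
  assumes form: "\<And>y. 0 \<le> y \<Longrightarrow> ereal y < l \<Longrightarrow> g (ereal y) = ereal (a + of_int s * y + kink ds e y)"
    and ds: "\<forall>(k, p) \<in> set ds. \<forall>z. p = On e z \<longrightarrow> 0 \<le> z"
  shows "0 \<le> x \<Longrightarrow> x < l \<Longrightarrow> slope g (at_right x) = s + chip_sum ds (\<lambda>p. \<exists>z\<le>x. p = On e z)"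
    and "0 < x \<Longrightarrow> x \<le> l \<Longrightarrow> slope g (at_left x) = s + chip_sum ds (\<lambda>p. \<exists>z<x. p = On e z)"
proof -
  have form': "g z = ereal (a + of_int s * real_of_ereal z + kink ds e (real_of_ereal z))"
    if "0 \<le> z" "z < l" for z
    using that form by (cases z) auto
  {
    assume x: "0 \<le> x" "x < l"
    let ?c = "chip_sum ds (\<lambda>p. \<exists>z\<le>x. p = On e z)"
    obtain b where b: "\<forall>\<^sub>F z in at_right x. ereal (kink ds e (real_of_ereal z)) =
        ereal (b + of_int ?c * real_of_ereal z)"
      using kink_right[OF x ds] by blast
    have "\<forall>\<^sub>F z in at_right x. x < z \<and> z < l"
      using x by (subst eventually_at_right[OF x(2)]) auto
    with b have "\<forall>\<^sub>F z in at_right x. g z = ereal ((a + b) + of_int (s + ?c) * real_of_ereal z)"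
    proof eventually_elim
      case (elim z)
      then have "0 \<le> z" "z < l" using x by auto
      from form'[OF this] elim show ?case by (simp add: algebra_simps)
    qed
    then show "slope g (at_right x) = s + ?c" by (rule slope_right[OF x(2)])
  }
  {
    assume x: "0 < x" "x \<le> l"
    let ?c = "chip_sum ds (\<lambda>p. \<exists>z<x. p = On e z)"
    obtain b where b: "\<forall>\<^sub>F z in at_left x. ereal (kink ds e (real_of_ereal z)) =
        ereal (b + of_int ?c * real_of_ereal z)"
      using kink_left[OF x(1) ds] by blast
    have "\<forall>\<^sub>F z in at_left x. 0 < z \<and> z < x"
      using x by (subst eventually_at_left[OF x(1)]) auto
    with b have "\<forall>\<^sub>F z in at_left x. g z = ereal ((a + b) + of_int (s + ?c) * real_of_ereal z)"
    proof eventually_elim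
      case (elim z)
      then have "0 \<le> z" "z < l" using x by auto
      from form'[OF this] elim show ?case by (simp add: algebra_simps)
    qed
    then show "slope g (at_left x) = s + ?c" by (rule slope_left[OF x(1)])
  }
qed

text \<open>
  \<open>s e\<close> is the slope at the beginning of \<open>e\<close> before the chips at position \<open>0\<close> are passed, and the
  final slope counts the chips at position \<open>len e\<close> as passed, even if it is infinite.  Hence chips at
  the ends of an edge need no separate treatment.
\<close>

definition balanced :: "(nat, nat) metric_graph \<Rightarrow> chips \<Rightarrow> (nat \<Rightarrow> int) \<Rightarrow> bool" where
  "balanced \<Gamma> ds s \<longleftrightarrow> (\<forall>u \<in> vertices \<Gamma>.
     (\<Sum>e | e \<in> edges \<Gamma> \<and> tail (graph \<Gamma>) e = u. s e) -
     (\<Sum>e | e \<in> edges \<Gamma> \<and> head (graph \<Gamma>) e = u. s e + edge_weight ds e) = vertex_weight ds u)"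

definition potential :: "(nat, nat) metric_graph \<Rightarrow> chips \<Rightarrow> (nat \<Rightarrow> int) \<Rightarrow> (nat \<Rightarrow> real) \<Rightarrow> bool" where
  "potential \<Gamma> ds s h \<longleftrightarrow> (\<forall>e \<in> edges \<Gamma>. len \<Gamma> e \<noteq> \<infinity> \<longrightarrow>
     h (head (graph \<Gamma>) e) - h (tail (graph \<Gamma>) e) =
       of_int (s e) * real_of_ereal (len \<Gamma> e) + kink ds e (real_of_ereal (len \<Gamma> e)))"

lemma valid_chips_nonneg: "valid_chips \<Gamma> ds \<Longrightarrow> \<forall>(k, p) \<in> set ds. \<forall>z. p = On e z \<longrightarrow> 0 \<le> z"
  by (auto simp: valid_chips_def)

text \<open>In the interior of an edge the jumps of \<open>kink\<close> already produce the chips,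
  so equality of the divisors is decided at the vertices.\<close>

lemma div_of_eq_iff:
  assumes \<Gamma>: "tropical_curve \<Gamma>" and f: "rational_function \<Gamma> f" and v: "valid_chips \<Gamma> ds"
    and form: "\<And>e y. e \<in> edges \<Gamma> \<Longrightarrow> 0 \<le> y \<Longrightarrow> ereal y < len \<Gamma> e \<Longrightarrow>
      f (chart \<Gamma> e (ereal y)) = ereal (a e + of_int (s e) * y + kink ds e y)"
  shows "div_of \<Gamma> f = chip_div \<Gamma> ds \<longleftrightarrow> balanced \<Gamma> ds s"
proof -
  have fin: "fin_digraph (graph \<Gamma>)" and pos: "\<forall>e\<in>edges \<Gamma>. 0 < len \<Gamma> e"
    using \<Gamma> by (auto simp: tropical_curve_def)
  interpret fin_digraph "graph \<Gamma>" by (rule fin)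
  note nonneg = valid_chips_nonneg[OF v]
  have lookup: "Poly_Mapping.lookup (div_of \<Gamma> f) = ord \<Gamma> f" by (rule lookup_div_of[OF fin f])
  have right: "slope (\<lambda>y. f (chart \<Gamma> e y)) (at_right x) = s e + chip_sum ds (\<lambda>p. \<exists>z\<le>x. p = On e z)"
    if "e \<in> edges \<Gamma>" "0 \<le> x" "x < len \<Gamma> e" for e x
    using that form nonneg by (intro slopes_of_form(1)[where a = "a e" and l = "len \<Gamma> e"]) auto
  have left: "slope (\<lambda>y. f (chart \<Gamma> e y)) (at_left x) = s e + chip_sum ds (\<lambda>p. \<exists>z<x. p = On e z)"
    if "e \<in> edges \<Gamma>" "0 < x" "x \<le> len \<Gamma> e" for e x
    using that form nonneg by (intro slopes_of_form(2)[where a = "a e" and l = "len \<Gamma> e"]) auto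
  \<comment> \<open>Chips at the ends of edges cancel: those at \<open>0\<close> enter the order
    through the right slope and the divisor through the tail; those at the far end are in
    \<open>edge_weight\<close> but not in the left slope.\<close>
  have vert: "ord \<Gamma> f (Vertex u) - chip_sum ds (\<lambda>p. described_point \<Gamma> p = Vertex u) =
     (\<Sum>e | e \<in> edges \<Gamma> \<and> tail (graph \<Gamma>) e = u. s e) -
     (\<Sum>e | e \<in> edges \<Gamma> \<and> head (graph \<Gamma>) e = u. s e + edge_weight ds e) - vertex_weight ds u" for u
  proof -
    have 1: "chip_sum ds (\<lambda>p. \<exists>z\<le>0. p = On e z) = chip_sum ds (\<lambda>p. p = On e 0)" for e
      using nonneg[of e] by (intro chip_sum_cong) fastforce
    have 2: "chip_sum ds (\<lambda>p. \<exists>z<len \<Gamma> e. p = On e z) + chip_sum ds (\<lambda>p. p = On e (len \<Gamma> e)) = edge_weight ds e" for e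
    proof -
      have "chip_sum ds (\<lambda>p. \<exists>z<len \<Gamma> e. p = On e z) + chip_sum ds (\<lambda>p. p = On e (len \<Gamma> e)) =
          chip_sum ds (\<lambda>p. (\<exists>z<len \<Gamma> e. p = On e z) \<or> p = On e (len \<Gamma> e))"
        by (rule chip_sum_disj[symmetric]) auto
      also have "\<dots> = edge_weight ds e"
      proof (rule chip_sum_cong)
        fix k p assume "(k, p) \<in> set ds"
        then show "((\<exists>z<len \<Gamma> e. p = On e z) \<or> p = On e (len \<Gamma> e)) = (\<exists>z. p = On e z)"
          using valid_chips_on(3)[OF v, of k e] le_less by blast
      qed
      finally show ?thesis .
    qed
    have "ord \<Gamma> f (Vertex u) = (\<Sum>e | e \<in> edges \<Gamma> \<and> tail (graph \<Gamma>) e = u. s e + chip_sum ds (\<lambda>p. p = On e 0)) -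
        (\<Sum>e | e \<in> edges \<Gamma> \<and> head (graph \<Gamma>) e = u. s e + edge_weight ds e - chip_sum ds (\<lambda>p. p = On e (len \<Gamma> e)))"
      unfolding ord_Vertex[OF fin pos] using pos
      by (intro arg_cong2[where f = "(-)"] sum.cong) (auto simp: right left 1 simp flip: 2)
    then show ?thesis
      unfolding chip_sum_Vertex[OF finite_arcs pos v] by (simp add: sum.distrib sum_subtractf)
  qed
  have int: "ord \<Gamma> f (Interior e r) = chip_sum ds (\<lambda>p. described_point \<Gamma> p = Interior e r)"
    if e: "e \<in> edges \<Gamma>" "0 < r" "ereal r < len \<Gamma> e" for e r
  proof -
    have "chip_sum ds (\<lambda>p. \<exists>z\<le>ereal r. p = On e z) =
        chip_sum ds (\<lambda>p. (\<exists>z<ereal r. p = On e z) \<or> p = On e (ereal r))"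
      by (rule chip_sum_cong) (auto simp: le_less)
    also have "\<dots> = chip_sum ds (\<lambda>p. \<exists>z<ereal r. p = On e z) + chip_sum ds (\<lambda>p. p = On e (ereal r))"
      by (rule chip_sum_disj) auto
    finally show ?thesis
      using e by (simp add: ord_Interior chip_sum_Interior[OF v] right left)
  qed
  have pts: "q \<in> points \<Gamma> \<Longrightarrow> (\<exists>u\<in>vertices \<Gamma>. q = Vertex u) \<or>
      (\<exists>e r. e \<in> edges \<Gamma> \<and> 0 < r \<and> ereal r < len \<Gamma> e \<and> q = Interior e r)" for q
    unfolding points_def
  proof (elim UnE UN_E imageE)
    fix e x assume "e \<in> edges \<Gamma>" "x \<in> {0..len \<Gamma> e}" "q = chart \<Gamma> e x"
    then show ?thesis by (cases x) (auto simp: chart_def less_le split: if_splits)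
  qed auto
  show ?thesis
  proof
    assume eq: "div_of \<Gamma> f = chip_div \<Gamma> ds"
    have "ord \<Gamma> f (Vertex u) = chip_sum ds (\<lambda>p. described_point \<Gamma> p = Vertex u)" for u
      using eq lookup lookup_chip_div by metis
    then show "balanced \<Gamma> ds s" using vert by (simp add: balanced_def)
  next
    assume b: "balanced \<Gamma> ds s"
    show "div_of \<Gamma> f = chip_div \<Gamma> ds"
    proof (rule poly_mapping_eqI)
      fix q
      show "Poly_Mapping.lookup (div_of \<Gamma> f) q = Poly_Mapping.lookup (chip_div \<Gamma> ds) q"
      proof (cases "q \<in> points \<Gamma>")
        case False
        then show ?thesis
          by (simp add: lookup lookup_chip_div ord_no_point lookup_chip_div_no_point[OF v])
      next
        case True
        then consider u where "u \<in> vertices \<Gamma>" "q = Vertex u"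
          | e r where "e \<in> edges \<Gamma>" "0 < r" "ereal r < len \<Gamma> e" "q = Interior e r"
          using pts by blast
        then show ?thesis
        proof cases
          case (1 u)
          then show ?thesis using vert[of u] b by (simp add: lookup lookup_chip_div balanced_def)
        next
          case (2 e r)
          then show ?thesis using int by (simp add: lookup lookup_chip_div)
        qed
      qed
    qed
  qed
qed

section \<open>Normal form of a rational function on an edge\<close>

lemma strict_list_gap_right:
  fixes x :: "'a::linorder"
  assumes "sorted_wrt (<) ts" "ts \<noteq> []" "hd ts \<le> x" "x < last ts"
  shows "\<exists>i. Suc i < length ts \<and> ts ! i \<le> x \<and> x < ts ! Suc i"
proof (cases "x \<in> set ts")
  case True
  then obtain i where i: "i < length ts" "ts ! i = x" by (auto simp: in_set_conv_nth)
  with assms have "Suc i < length ts" by (metis Suc_lessI diff_Suc_1 last_conv_nth less_irrefl)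
  with i assms(1) show ?thesis by (intro exI[of _ i]) (auto simp: sorted_wrt_iff_nth_less)
next
  case False
  then have "hd ts < x" using assms by (metis hd_in_set order_le_less)
  with strict_list_gap[OF assms(1,2) _ assms(4) False] show ?thesis by (meson less_imp_le)
qed

lemma strict_list_gap_left:
  fixes x :: "'a::linorder"
  assumes "sorted_wrt (<) ts" "ts \<noteq> []" "hd ts < x" "x \<le> last ts"
  shows "\<exists>i. Suc i < length ts \<and> ts ! i < x \<and> x \<le> ts ! Suc i"
proof (cases "x \<in> set ts")
  case True
  then obtain i where i: "i < length ts" "ts ! i = x" by (auto simp: in_set_conv_nth)
  with assms have "i \<noteq> 0" by (metis hd_conv_nth less_irrefl)
  then obtain j where "i = Suc j" by (cases i) auto
  with i assms(1) show ?thesis by (intro exI[of _ j]) (auto simp: sorted_wrt_iff_nth_less)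
next
  case False
  then have "x < last ts" using assms by (metis last_in_set order_le_less)
  with strict_list_gap[OF assms(1-3) _ False] show ?thesis by (meson less_imp_le)
qed

lemma piecewise_linear_right:
  assumes g: "piecewise_linear l g" and x: "0 \<le> x" "x < l"
  shows "\<exists>(s::int) (a::real). \<forall>\<^sub>F z in at_right x. g z = ereal (a + of_int s * real_of_ereal z)"
proof -
  obtain ts where ts: "ts \<noteq> []" "sorted_wrt (<) ts" "hd ts = 0" "last ts = l"
    and pl: "\<And>i. Suc i < length ts \<Longrightarrow> \<exists>(s::int) (a::real). \<forall>x::real. ts ! i < ereal x \<and> ereal x < ts ! Suc i \<longrightarrow>
              g (ereal x) = ereal (a + of_int s * x)"
    using g unfolding piecewise_linear_def by blast
  obtain i where i: "Suc i < length ts" "ts ! i \<le> x" "x < ts ! Suc i"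
    using strict_list_gap_right[OF ts(2,1)] ts x by metis
  obtain s :: int and a :: real where sa: "\<And>r. ts ! i < ereal r \<Longrightarrow> ereal r < ts ! Suc i \<Longrightarrow> g (ereal r) = ereal (a + of_int s * r)"
    using pl[OF i(1)] by blast
  have "\<forall>\<^sub>F z in at_right x. g z = ereal (a + of_int s * real_of_ereal z)"
    by (rule affine_at_right[OF i(3)]) (use sa i(2) x in \<open>auto intro: order.strict_trans1\<close>)
  then show ?thesis by blast
qed

lemma piecewise_linear_left:
  assumes g: "piecewise_linear l g" and x: "0 < x" "x \<le> l"
  shows "\<exists>(s::int) (a::real). \<forall>\<^sub>F z in at_left x. g z = ereal (a + of_int s * real_of_ereal z)"
proof -
  obtain ts where ts: "ts \<noteq> []" "sorted_wrt (<) ts" "hd ts = 0" "last ts = l"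
    and pl: "\<And>i. Suc i < length ts \<Longrightarrow> \<exists>(s::int) (a::real). \<forall>x::real. ts ! i < ereal x \<and> ereal x < ts ! Suc i \<longrightarrow>
              g (ereal x) = ereal (a + of_int s * x)"
    using g unfolding piecewise_linear_def by blast
  obtain i where i: "Suc i < length ts" "ts ! i < x" "x \<le> ts ! Suc i"
    using strict_list_gap_left[OF ts(2,1)] ts x by metis
  obtain s :: int and a :: real where sa: "\<And>r. ts ! i < ereal r \<Longrightarrow> ereal r < ts ! Suc i \<Longrightarrow> g (ereal r) = ereal (a + of_int s * r)"
    using pl[OF i(1)] by blast
  have "\<forall>\<^sub>F z in at_left x. g z = ereal (a + of_int s * real_of_ereal z)"
    by (rule affine_at_left[OF i(2)]) (use sa i(3) in \<open>auto intro: order.strict_trans2\<close>)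
  then show ?thesis by blast
qed

text \<open>The germ of \<open>\<phi>\<close> is locally constant, hence constant.\<close>

lemma locally_affine_imp_affine:
  fixes \<phi> :: "real \<Rightarrow> real"
  assumes U: "Topological_Spaces.connected U" "open U" and x0: "x0 \<in> U"
    and aff: "\<And>x. x \<in> U \<Longrightarrow> \<exists>a (s::int). \<forall>\<^sub>F y in nhds x. \<phi> y = a + of_int s * y"
  shows "\<exists>a (s::int). \<forall>x\<in>U. \<phi> x = a + of_int s * x"
proof -
  obtain a :: "real \<Rightarrow> real" and s :: "real \<Rightarrow> int"
    where as: "\<And>x. x \<in> U \<Longrightarrow> \<forall>\<^sub>F y in nhds x. \<phi> y = a x + of_int (s x) * y"
    using aff by metis
  have uniq: "a x = b \<and> s x = t" if x: "x \<in> U" and ev: "\<forall>\<^sub>F y in nhds x. \<phi> y = b + of_int t * y" for x b t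
  proof -
    have "\<forall>\<^sub>F y in nhds x. a x + of_int (s x) * y = b + of_int t * y"
      using as[OF x] ev by eventually_elim simp
    then obtain d where d: "0 < d" "\<And>y. dist y x < d \<Longrightarrow> a x + of_int (s x) * y = b + of_int t * y"
      unfolding eventually_nhds_metric by blast
    have "a x + of_int (s x) * x = b + of_int t * x" using d by simp
    moreover have "a x + of_int (s x) * (x + d / 2) = b + of_int t * (x + d / 2)"
      using d by (simp add: dist_real_def)
    ultimately have "real_of_int (s x) * (d / 2) = of_int t * (d / 2)" unfolding distrib_left by linarith
    then have "s x = t" using d by simp
    with \<open>a x + of_int (s x) * x = b + of_int t * x\<close> show ?thesis by simp
  qed
  have "(a x0, s x0) = (a x, s x)" if "x \<in> U" for x
  proof (rule connected_local_const[OF U(1) x0 that, where f = "\<lambda>x. (a x, s x)"], intro ballI)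
    fix x assume x: "x \<in> U"
    have "\<forall>\<^sub>F y in nhds x. \<forall>\<^sub>F z in nhds y. \<phi> z = a x + of_int (s x) * z"
      using as[OF x] by (simp add: eventually_eventually)
    moreover have "\<forall>\<^sub>F y in nhds x. y \<in> U" using U(2) x by (rule eventually_nhds_in_open)
    ultimately have "\<forall>\<^sub>F y in nhds x. (a x, s x) = (a y, s y)"
      by eventually_elim (use uniq in auto)
    then show "\<forall>\<^sub>F y in at x within U. (a x, s x) = (a y, s y)"
      by (simp add: eventually_at_filter eventually_mono)
  qed
  moreover have "\<phi> x = a x + of_int (s x) * x" if "x \<in> U" for x
    using as[OF that] by (rule eventually_nhds_x_imp_x)
  ultimately show ?thesis by (intro exI[of _ "a x0"] exI[of _ "s x0"]) auto
qed

text \<open>After subtracting \<open>kink\<close> the two one-sided slopes agree at every interior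
  point, since the jump of the slopes of \<open>f\<close> is the weight there. Together with
  continuity this makes the difference locally affine, hence affine on the connected open
  edge.\<close>

lemma rational_function_form:
  assumes \<Gamma>: "tropical_curve \<Gamma>" and f: "rational_function \<Gamma> f" and v: "valid_chips \<Gamma> ds"
    and eq: "div_of \<Gamma> f = chip_div \<Gamma> ds" and e: "e \<in> edges \<Gamma>"
  shows "\<exists>(s::int) (a::real). \<forall>y. 0 \<le> y \<and> ereal y < len \<Gamma> e \<longrightarrow>
    f (chart \<Gamma> e (ereal y)) = ereal (a + of_int s * y + kink ds e y)"
proof -
  have fin: "fin_digraph (graph \<Gamma>)" and pos: "0 < len \<Gamma> e"
    using \<Gamma> e by (auto simp: tropical_curve_def)
  note nonneg = valid_chips_nonneg[OF v]
  define g where "g y = f (chart \<Gamma> e y)" for y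
  have cont: "continuous_on {0..len \<Gamma> e} g" and pl: "piecewise_linear (len \<Gamma> e) g"
    using f e by (auto simp: rational_function_def g_def[abs_def])
  have finite: "\<bar>g (ereal y)\<bar> \<noteq> \<infinity>" if y: "0 < y" "ereal y < len \<Gamma> e" for y
  proof -
    have "chart \<Gamma> e (ereal y) = Interior e y" using y by (auto simp: chart_def zero_ereal_def)
    moreover have "chart \<Gamma> e (ereal y) \<in> points \<Gamma>"
      unfolding points_def using y by (intro UnI2 UN_I[OF e] imageI) auto
    moreover have "Interior e y \<notin> unbounded_ends \<Gamma>" by (auto simp: unbounded_ends_def chart_def)
    ultimately show ?thesis using f unfolding rational_function_def g_def by metis
  qed
  define \<phi> where "\<phi> y = real_of_ereal (g (ereal y)) - kink ds e y" for y
  define U where "U = {y::real. 0 < y \<and> ereal y < len \<Gamma> e}"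
  have U: "U = {0<..} \<inter> ereal -` {..<len \<Gamma> e}" by (auto simp: U_def)
  have "open U" unfolding U by (intro open_Int open_greaterThan open_vimage open_lessThan continuous_on_ereal continuous_on_id)
  have "is_interval U"
    unfolding is_interval_1 U_def by (auto intro: order.strict_trans1 order.strict_trans2 simp flip: ereal_less_eq(3))
  then have "Topological_Spaces.connected U" by (simp add: is_interval_connected_1)
  obtain x0 where x0: "x0 \<in> U"
    using ereal_dense2[OF pos] by (auto simp: U_def zero_ereal_def)
  have g_nhds: "\<forall>\<^sub>F y in nhds x. g (ereal y) = ereal (\<phi> y + kink ds e y)" if "x \<in> U" for x
    using eventually_nhds_in_open[OF \<open>open U\<close> that]
    by eventually_elim (use finite in \<open>auto simp: \<phi>_def U_def ereal_real\<close>)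
  have "\<exists>a (s::int). \<forall>\<^sub>F y in nhds x. \<phi> y = a + of_int s * y" if x: "x \<in> U" for x
  proof -
    have x': "0 < x" "ereal x < len \<Gamma> e" using x by (auto simp: U_def)
    obtain s1 a1 where 1: "\<forall>\<^sub>F z in at_right (ereal x). g z = ereal (a1 + of_int s1 * real_of_ereal z)"
      using piecewise_linear_right[OF pl, of "ereal x"] x' by auto
    obtain s2 a2 where 2: "\<forall>\<^sub>F z in at_left (ereal x). g z = ereal (a2 + of_int s2 * real_of_ereal z)"
      using piecewise_linear_left[OF pl, of "ereal x"] x' less_imp_le[OF x'(2)] by auto
    let ?c1 = "chip_sum ds (\<lambda>p. \<exists>z\<le>ereal x. p = On e z)" and ?c2 = "chip_sum ds (\<lambda>p. \<exists>z<ereal x. p = On e z)"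
    obtain b1 where 3: "\<forall>\<^sub>F z in at_right (ereal x). ereal (kink ds e (real_of_ereal z)) = ereal (b1 + of_int ?c1 * real_of_ereal z)"
      using kink_right[OF _ x'(2) nonneg] x' by auto
    obtain b2 where 4: "\<forall>\<^sub>F z in at_left (ereal x). ereal (kink ds e (real_of_ereal z)) = ereal (b2 + of_int ?c2 * real_of_ereal z)"
      using kink_left[OF _ nonneg, of "ereal x"] x' by auto
    have "slope g (at_right (ereal x)) = s1" "slope g (at_left (ereal x)) = s2"
      using slope_right[OF x'(2) 1] slope_left[OF _ 2, of 0] x' by auto
    then have "s1 - s2 = ord \<Gamma> f (Interior e x)"
      using ord_Interior[OF e x', of f] by (simp add: g_def[abs_def])
    also have "\<dots> = chip_sum ds (\<lambda>p. p = On e (ereal x))"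
      using eq lookup_div_of[OF fin f] lookup_chip_div[of \<Gamma> ds "Interior e x"] chip_sum_Interior[OF v x'] by simp
    finally have s12: "s1 - s2 = chip_sum ds (\<lambda>p. p = On e (ereal x))" .
    have "?c1 = chip_sum ds (\<lambda>p. (\<exists>z<ereal x. p = On e z) \<or> p = On e (ereal x))"
      by (rule chip_sum_cong) (auto simp: le_less)
    also have "\<dots> = ?c2 + chip_sum ds (\<lambda>p. p = On e (ereal x))"
      by (rule chip_sum_disj) auto
    finally have c: "s1 - ?c1 = s2 - ?c2" using s12 by simp
    \<comment> \<open>The common slope of \<open>\<phi>\<close> on both sides of
      \<open>x\<close>.\<close>
    define s where "s = s1 - ?c1"
    have s: "real_of_int s = of_int s1 - of_int ?c1" "real_of_int s = of_int s2 - of_int ?c2"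
      using c by (simp_all add: s_def flip: of_int_diff)
    have g': "\<forall>\<^sub>F y in at x. g (ereal y) = ereal (\<phi> y + kink ds e y)"
      using g_nhds[OF x] by (simp add: eventually_at_filter eventually_mono)
    have r: "\<forall>\<^sub>F y in at_right x. \<phi> y = (a1 - b1) + of_int s * y"
      using 1[unfolded at_right_ereal eventually_filtermap] 3[unfolded at_right_ereal eventually_filtermap]
        filter_leD[OF at_le[of "{x<..}" UNIV x] g', simplified]
      by eventually_elim (simp add: s(1) algebra_simps)
    have l: "\<forall>\<^sub>F y in at_left x. \<phi> y = (a2 - b2) + of_int s * y"
      using 2[unfolded at_left_ereal eventually_filtermap] 4[unfolded at_left_ereal eventually_filtermap]
        filter_leD[OF at_le[of "{..<x}" UNIV x] g', simplified]
      by eventually_elim (simp add: s(2) algebra_simps)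
    \<comment> \<open>Continuity at \<open>x\<close> is what equates the constants
      \<open>a1 - b1\<close> and \<open>a2 - b2\<close> of the two sides.\<close>
    have "continuous_on (ereal ` U) g"
      by (rule continuous_on_subset[OF cont]) (auto simp: U_def)
    then have "continuous_on U (g \<circ> ereal)"
      by (intro continuous_on_compose continuous_on_ereal continuous_on_id)
    then have "continuous_on U (real_of_ereal \<circ> (g \<circ> ereal))"
      by (subst (asm) continuous_on_iff_real) (use finite in \<open>auto simp: U_def\<close>)
    then have "continuous_on U \<phi>"
      unfolding \<phi>_def[abs_def] comp_def
      by (intro continuous_on_diff continuous_on_subset[OF continuous_kink]) auto
    then have lim: "(\<phi> \<longlongrightarrow> \<phi> x) (at x)"
      using \<open>open U\<close> x by (auto simp: continuous_on_eq_continuous_at isCont_def)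
    have "((\<lambda>y. (a1 - b1) + of_int s * y) \<longlongrightarrow> \<phi> x) (at_right x)"
      by (rule Lim_transform_eventually[OF _ r]) (use lim in \<open>simp add: filterlim_at_split\<close>)
    then have 5: "\<phi> x = (a1 - b1) + of_int s * x"
      by (rule tendsto_unique[rotated]) (auto intro!: tendsto_intros)
    have "((\<lambda>y. (a2 - b2) + of_int s * y) \<longlongrightarrow> \<phi> x) (at_left x)"
      by (rule Lim_transform_eventually[OF _ l]) (use lim in \<open>simp add: filterlim_at_split\<close>)
    then have 6: "\<phi> x = (a2 - b2) + of_int s * x"
      by (rule tendsto_unique[rotated]) (auto intro!: tendsto_intros)
    have "a2 - b2 = a1 - b1" using 5 6 by simp
    then have "\<forall>\<^sub>F y in at x. \<phi> y = (a1 - b1) + of_int s * y"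
      using l r by (simp add: eventually_at_split)
    then have "\<forall>\<^sub>F y in nhds x. \<phi> y = (a1 - b1) + of_int s * y"
      using 5 by (auto simp: eventually_at_filter elim: eventually_mono)
    then show ?thesis by blast
  qed
  from locally_affine_imp_affine[OF \<open>Topological_Spaces.connected U\<close> \<open>open U\<close> x0 this]
  obtain a and s :: int where as: "\<And>y. y \<in> U \<Longrightarrow> \<phi> y = a + of_int s * y" by blast
  have gU: "g (ereal y) = ereal (a + of_int s * y + kink ds e y)" if "y \<in> U" for y
    using as[OF that] finite[of y] that by (auto simp: \<phi>_def U_def ereal_real algebra_simps)
  \<comment> \<open>The formula extends to position \<open>0\<close> by continuity. The far end is
    treated separately because it may be infinite.\<close>
  have "(g \<longlongrightarrow> g 0) (at_right (ereal 0))"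
    using continuous_on_Icc_at_rightD[OF cont pos] by (simp add: zero_ereal_def)
  then have "((\<lambda>y. g (ereal y)) \<longlongrightarrow> g 0) (at_right 0)"
    by (simp add: at_right_ereal filterlim_filtermap)
  moreover have "\<forall>\<^sub>F y in at_right 0. g (ereal y) = ereal (a + of_int s * y + kink ds e y)"
  proof -
    have "y \<in> U" if "0 < y" "y < x0" for y
      using that x0 less_trans[of "ereal y" "ereal x0" "len \<Gamma> e"] by (auto simp: U_def)
    then have "\<forall>\<^sub>F y in at_right (0::real). y \<in> U"
      using x0 by (subst eventually_at_right[of 0 x0]) (auto simp: U_def)
    then show ?thesis by eventually_elim (rule gU)
  qed
  ultimately have "((\<lambda>y. ereal (a + of_int s * y + kink ds e y)) \<longlongrightarrow> g 0) (at_right 0)"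
    by (rule Lim_transform_eventually)
  moreover have "((\<lambda>y. ereal (a + of_int s * y + kink ds e y)) \<longlongrightarrow> ereal (a + of_int s * 0 + kink ds e 0)) (at_right 0)"
    using continuous_kink[of ds e]
    by (intro tendsto_intros) (auto simp: continuous_on_eq_continuous_at isCont_def filterlim_at_split)
  ultimately have g0: "g 0 = ereal (a + of_int s * 0 + kink ds e 0)"
    by (rule tendsto_unique[rotated]) simp
  have "f (chart \<Gamma> e (ereal y)) = ereal (a + of_int s * y + kink ds e y)" if "0 \<le> y" "ereal y < len \<Gamma> e" for y
  proof (cases "y = 0")
    case True
    then show ?thesis using g0 by (simp add: g_def zero_ereal_def)
  next
    case False
    then show ?thesis using gU[of y] that by (simp add: g_def U_def)
  qed
  then show ?thesis by blast
qed

section \<open>Gluing a rational function from slopes and vertex values\<close>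

lemma affine_kink_tendsto:
  "((\<lambda>y. ereal (a + of_int s * y + kink ds e y)) \<longlongrightarrow> ereal (a + of_int s * x + kink ds e x)) (at x within S)"
proof -
  have "(kink ds e \<longlongrightarrow> kink ds e x) (at x)"
    using continuous_kink[of ds e] by (simp add: continuous_on_eq_continuous_at isCont_def)
  then have "(kink ds e \<longlongrightarrow> kink ds e x) (at x within S)" by (rule tendsto_within_subset) simp
  then show ?thesis by (intro tendsto_intros)
qed

lemma form_at_end:
  fixes g :: "ereal \<Rightarrow> ereal"
  assumes cont: "continuous_on {0..ereal L} g" and L: "0 < L"
    and form: "\<And>y. 0 \<le> y \<Longrightarrow> y < L \<Longrightarrow> g (ereal y) = ereal (a + of_int s * y + kink ds e y)"
  shows "g (ereal L) = ereal (a + of_int s * L + kink ds e L)"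
proof -
  have "(g \<longlongrightarrow> g (ereal L)) (at_left (ereal L))"
    using continuous_on_Icc_at_leftD[OF cont] L by simp
  then have "((\<lambda>y. g (ereal y)) \<longlongrightarrow> g (ereal L)) (at_left L)"
    by (simp add: at_left_ereal filterlim_filtermap)
  moreover have "\<forall>\<^sub>F y in at_left L. g (ereal y) = ereal (a + of_int s * y + kink ds e y)"
    by (subst eventually_at_left[OF L]) (use L form in auto)
  ultimately have "((\<lambda>y. ereal (a + of_int s * y + kink ds e y)) \<longlongrightarrow> g (ereal L)) (at_left L)"
    by (rule Lim_transform_eventually)
  then show ?thesis
    by (rule tendsto_unique[rotated, OF _ affine_kink_tendsto]) simp
qed

text \<open>A vertex at infinity is a leaf, so no other edge constrains the value of a function
  there.\<close>

lemma infinite_edge_head: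
  assumes \<Gamma>: "tropical_curve \<Gamma>" and e: "e \<in> edges \<Gamma>" "len \<Gamma> e = \<infinity>"
  shows "e' \<in> edges \<Gamma> \<Longrightarrow> head (graph \<Gamma>) e' = head (graph \<Gamma>) e \<Longrightarrow> e' = e"
    and "e' \<in> edges \<Gamma> \<Longrightarrow> tail (graph \<Gamma>) e' \<noteq> head (graph \<Gamma>) e"
proof -
  interpret fin_digraph "graph \<Gamma>" using \<Gamma> by (simp add: tropical_curve_def)
  let ?v = "head (graph \<Gamma>) e"
  have deg: "card (in_arcs (graph \<Gamma>) ?v) + card (out_arcs (graph \<Gamma>) ?v) = 1"
    using \<Gamma> e by (simp add: tropical_curve_def vertex_degree_def in_degree_def out_degree_def)
  have "e \<in> in_arcs (graph \<Gamma>) ?v" using e by simp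
  then have "card (in_arcs (graph \<Gamma>) ?v) \<noteq> 0" using finite_in_arcs by auto
  with deg have in1: "card (in_arcs (graph \<Gamma>) ?v) = 1" and out0: "card (out_arcs (graph \<Gamma>) ?v) = 0" by auto
  from in1 obtain d where "in_arcs (graph \<Gamma>) ?v = {d}" by (auto simp: card_1_singleton_iff)
  then show "e' \<in> edges \<Gamma> \<Longrightarrow> head (graph \<Gamma>) e' = ?v \<Longrightarrow> e' = e"
    using e by (metis in_in_arcs_conv singletonD)
  have "out_arcs (graph \<Gamma>) ?v = {}" using out0 finite_out_arcs by auto
  then show "e' \<in> edges \<Gamma> \<Longrightarrow> tail (graph \<Gamma>) e' \<noteq> ?v" by (metis in_out_arcs_conv empty_iff)
qed

text \<open>The limit is \<open>a\<close>, \<open>\<infinity>\<close> or \<open>-\<infinity>\<close>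
  according to the sign of the slope. It supplies the value at an unbounded end, where infinite
  values are permitted.\<close>

lemma ex_limit_at_infinity:
  assumes "\<forall>\<^sub>F z in at_left (\<infinity>::ereal). g z = ereal (a + of_int (c::int) * real_of_ereal z)"
  shows "\<exists>L. (g \<longlongrightarrow> L) (at_left \<infinity>)"
proof -
  let ?P = "\<lambda>y::real. a + of_int c * y"
  have "\<exists>L. ((ereal \<circ> ?P) \<longlongrightarrow> L) at_top"
  proof -
    consider "c = 0" | "0 < c" | "c < 0" by linarith
    then show ?thesis
    proof cases
      case 1
      then show ?thesis by (intro exI[of _ "ereal a"]) (simp add: comp_def)
    next
      case 2
      have "LIM y at_top. ?P y :> at_top"
        using 2 by (intro filterlim_tendsto_add_at_top[OF tendsto_const]
            filterlim_tendsto_pos_mult_at_top[OF tendsto_const _ filterlim_ident]) simp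
      then show ?thesis using ereal_tendsto_simps2(2) by blast
    next
      case 3
      have "LIM y at_top. - ?P y :> at_top"
      proof -
        have "LIM y at_top. (- a) + of_int (- c) * y :> at_top"
          using 3 by (intro filterlim_tendsto_add_at_top[OF tendsto_const]
            filterlim_tendsto_pos_mult_at_top[OF tendsto_const _ filterlim_ident]) simp
        then show ?thesis by (simp add: algebra_simps)
      qed
      then have "LIM y at_top. ?P y :> at_bot"
        by (simp only: filterlim_uminus_at_bot)
      then show ?thesis using ereal_tendsto_simps2(3) by blast
    qed
  qed
  then obtain L where "((ereal \<circ> ?P) \<longlongrightarrow> L) at_top" by blast
  then have "((\<lambda>z. ereal (a + of_int c * real_of_ereal z)) \<longlongrightarrow> L) (at_left \<infinity>)"
    by (simp add: at_left_PInf filterlim_filtermap comp_def)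
  moreover have "\<forall>\<^sub>F z in at_left \<infinity>. ereal (a + of_int c * real_of_ereal z) = g z"
    using assms by eventually_elim simp
  ultimately have "(g \<longlongrightarrow> L) (at_left \<infinity>)" by (rule Lim_transform_eventually)
  then show ?thesis by blast
qed

lemma piecewise_linear_form:
  assumes l: "0 < l" and form: "\<And>y. 0 \<le> y \<Longrightarrow> ereal y < l \<Longrightarrow> g (ereal y) = ereal (a + of_int s * y + kink ds e y)"
    and ds: "\<forall>z \<in> stops ds e. 0 \<le> z \<and> z \<le> l"
  shows "piecewise_linear l g"
proof -
  define A where "A = insert 0 (insert l (stops ds e))"
  define ts where "ts = sorted_list_of_set A"
  have A: "finite A" "\<And>z. z \<in> A \<Longrightarrow> 0 \<le> z" "\<And>z. z \<in> A \<Longrightarrow> z \<le> l" "0 \<in> A" "l \<in> A"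
    using ds l by (auto simp: A_def finite_stops)
  have set_ts: "set ts = A" and strict: "sorted_wrt (<) ts" and sorted: "sorted ts"
    using A(1) by (simp_all add: ts_def strict_sorted_list_of_set)
  then have ne: "ts \<noteq> []" using A(4) by auto
  have mono: "ts ! i \<le> ts ! j" if "i \<le> j" "j < length ts" for i j
    using sorted that by (simp add: sorted_nth_mono)
  have "hd ts = 0"
  proof -
    obtain i where i: "i < length ts" "ts ! i = 0" using A(4) set_ts by (metis in_set_conv_nth)
    have "hd ts \<le> 0" using mono[of 0 i] i ne by (simp add: hd_conv_nth)
    moreover have "0 \<le> hd ts" using A(2) set_ts ne hd_in_set by blast
    ultimately show ?thesis by simp
  qed
  moreover have "last ts = l"
  proof -
    obtain i where i: "i < length ts" "ts ! i = l" using A(5) set_ts by (metis in_set_conv_nth)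
    have "l \<le> last ts" using mono[of i "length ts - 1"] i ne by (simp add: last_conv_nth)
    moreover have "last ts \<le> l" using A(3) set_ts ne last_in_set by blast
    ultimately show ?thesis by simp
  qed
  moreover have "\<exists>(s::int) (a::real). \<forall>x::real. ts ! i < ereal x \<and> ereal x < ts ! Suc i \<longrightarrow> g (ereal x) = ereal (a + of_int s * x)"
    if i: "Suc i < length ts" for i
  proof -
    have gap: "z \<le> ts ! i \<or> ts ! Suc i \<le> z" if "z \<in> A" for z
    proof -
      obtain j where j: "j < length ts" "ts ! j = z" using \<open>z \<in> A\<close> set_ts by (metis in_set_conv_nth)
      show ?thesis using mono[of j i] mono[of "Suc i" j] i j by (cases "j \<le> i") auto
    qed
    have "\<forall>(k, p) \<in> set ds. \<forall>z. p = On e z \<longrightarrow> z \<noteq> -\<infinity> \<and> (z \<le> ts ! i \<or> ts ! Suc i \<le> z)"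
    proof (clarify, intro conjI)
      fix k z assume "(k, On e z) \<in> set ds"
      then have z: "z \<in> stops ds e" by (auto simp: stops_def)
      then show "z \<noteq> -\<infinity>" using ds by force
      show "z \<le> ts ! i \<or> ts ! Suc i \<le> z" using z by (intro gap) (simp add: A_def)
    qed
    moreover have "ts ! i < ts ! Suc i" using strict i by (simp add: sorted_wrt_nth_less)
    ultimately obtain b where
      b: "\<And>y. ts ! i < ereal y \<Longrightarrow> ereal y < ts ! Suc i \<Longrightarrow>
        kink ds e y = b + of_int (chip_sum ds (\<lambda>p. \<exists>z\<le>ts ! i. p = On e z)) * y"
      using kink_gap[of ds e "ts ! i" "ts ! Suc i"] by blast
    have bounds: "0 \<le> ts ! i" "ts ! Suc i \<le> l" using A set_ts i by auto
    have "g (ereal y) = ereal ((a + b) + of_int (s + chip_sum ds (\<lambda>p. \<exists>z\<le>ts ! i. p = On e z)) * y)"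
      if y: "ts ! i < ereal y" "ereal y < ts ! Suc i" for y
    proof -
      have "0 < ereal y" using bounds(1) y(1) by (rule order.strict_trans1)
      moreover have "ereal y < l" using y(2) bounds(2) by (rule order.strict_trans2)
      ultimately show ?thesis using form[of y] b[OF y] by (simp add: algebra_simps)
    qed
    then show ?thesis by blast
  qed
  ultimately show ?thesis unfolding piecewise_linear_def using ne strict by blast
qed

lemma continuous_form:
  assumes l: "0 < l" and form: "\<And>y. 0 \<le> y \<Longrightarrow> ereal y < l \<Longrightarrow> g (ereal y) = ereal (a + of_int s * y + kink ds e y)"
    and lim: "(g \<longlongrightarrow> g l) (at_left l)"
  shows "continuous_on {0..l} g"
proof (rule continuous_on_IccI[OF _ lim _ l])
  let ?P = "\<lambda>y. ereal (a + of_int s * y + kink ds e y)"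
  obtain u where u: "0 < ereal u" "ereal u < l" using ereal_dense2[OF l] by (auto simp: zero_ereal_def)
  have "\<forall>\<^sub>F y in at_right 0. ?P y = g (ereal y)"
  proof -
    have "ereal y < l" if "y < u" for y using that u(2) by (metis ereal_less_eq(3) less_imp_le order.strict_trans1)
    then show ?thesis using u form by (subst eventually_at_right[of 0 u]) auto
  qed
  with affine_kink_tendsto[of a s ds e 0 "{0<..}"] have "((\<lambda>y. g (ereal y)) \<longlongrightarrow> ?P 0) (at_right 0)"
    by (rule Lim_transform_eventually)
  moreover have "g 0 = ?P 0" using form[of 0] l by (simp add: zero_ereal_def)
  ultimately show "(g \<longlongrightarrow> g 0) (at_right 0)"
    by (simp add: zero_ereal_def at_right_ereal filterlim_filtermap)
next
  let ?P = "\<lambda>y. ereal (a + of_int s * y + kink ds e y)"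
  fix x assume x: "0 < x" "x < l"
  then obtain r where r: "x = ereal r" by (cases x) auto
  have "\<forall>\<^sub>F z in at x. z \<in> {0<..<l}" using x by (intro eventually_at_in_open') auto
  then have "\<forall>\<^sub>F y in at r. ?P y = g (ereal y)"
    unfolding r at_ereal eventually_filtermap by eventually_elim (use form in auto)
  with affine_kink_tendsto[of a s ds e r UNIV] have "((\<lambda>y. g (ereal y)) \<longlongrightarrow> ?P r) (at r)"
    by (rule Lim_transform_eventually)
  then show "g \<midarrow>x\<rightarrow> g x" using form[of r] x r by (simp add: at_ereal filterlim_filtermap)
qed

text \<open>A rational function with the given divisor amounts to slopes and vertex values: on each
  edge the normal form leaves one slope and one constant, and \<open>potential\<close> says that the
  pieces meet at the vertices.\<close>

theorem principal_iff:
  assumes \<Gamma>: "tropical_curve \<Gamma>" and v: "valid_chips \<Gamma> ds"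
  shows "(\<exists>f. rational_function \<Gamma> f \<and> div_of \<Gamma> f = chip_div \<Gamma> ds) \<longleftrightarrow>
    (\<exists>s h. balanced \<Gamma> ds s \<and> potential \<Gamma> ds s h)"
proof
  assume "\<exists>f. rational_function \<Gamma> f \<and> div_of \<Gamma> f = chip_div \<Gamma> ds"
  then obtain f where f: "rational_function \<Gamma> f" "div_of \<Gamma> f = chip_div \<Gamma> ds" by blast
  have "\<forall>e\<in>edges \<Gamma>. \<exists>(s::int) (a::real). \<forall>y. 0 \<le> y \<and> ereal y < len \<Gamma> e \<longrightarrow>
    f (chart \<Gamma> e (ereal y)) = ereal (a + of_int s * y + kink ds e y)"
    using rational_function_form[OF \<Gamma> f(1) v f(2)] by blast
  then obtain s a where form: "\<And>e y. e \<in> edges \<Gamma> \<Longrightarrow> 0 \<le> y \<Longrightarrow> ereal y < len \<Gamma> e \<Longrightarrow>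
      f (chart \<Gamma> e (ereal y)) = ereal (a e + of_int (s e) * y + kink ds e y)" by metis
  \<comment> \<open>At an unbounded end this may be the default \<open>0\<close> for an infinite
    value; \<open>potential\<close> imposes nothing on infinite edges.\<close>
  define h where "h u = real_of_ereal (f (Vertex u))" for u
  have "balanced \<Gamma> ds s" using div_of_eq_iff[OF \<Gamma> f(1) v form] f(2) by blast
  moreover have "potential \<Gamma> ds s h" unfolding potential_def
  proof (intro ballI impI)
    fix e assume e: "e \<in> edges \<Gamma>" "len \<Gamma> e \<noteq> \<infinity>"
    have pos: "0 < len \<Gamma> e" using \<Gamma> e by (simp add: tropical_curve_def)
    with e obtain L where L: "len \<Gamma> e = ereal L" "0 < L" by (cases "len \<Gamma> e") auto
    have "f (chart \<Gamma> e (ereal 0)) = ereal (a e)"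
      using form[OF e(1), of 0] pos kink_zero[OF valid_chips_nonneg[OF v]] by (simp add: zero_ereal_def)
    then have tail: "h (tail (graph \<Gamma>) e) = a e" by (simp add: h_def chart_def zero_ereal_def)
    have "f (chart \<Gamma> e (ereal L)) = ereal (a e + of_int (s e) * L + kink ds e L)"
      by (rule form_at_end[where g = "\<lambda>y. f (chart \<Gamma> e y)"]) (use f(1) e L form in \<open>auto simp: rational_function_def\<close>)
    then have "h (head (graph \<Gamma>) e) = a e + of_int (s e) * L + kink ds e L"
      using L by (simp add: h_def chart_def zero_ereal_def)
    with tail L show "h (head (graph \<Gamma>) e) - h (tail (graph \<Gamma>) e) =
       of_int (s e) * real_of_ereal (len \<Gamma> e) + kink ds e (real_of_ereal (len \<Gamma> e))" by simp
  qed
  ultimately show "\<exists>s h. balanced \<Gamma> ds s \<and> potential \<Gamma> ds s h" by blast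
next
  assume "\<exists>s h. balanced \<Gamma> ds s \<and> potential \<Gamma> ds s h"
  then obtain s h where bal: "balanced \<Gamma> ds s" and pot: "potential \<Gamma> ds s h" by blast
  have pos: "0 < len \<Gamma> e" if "e \<in> edges \<Gamma>" for e using \<Gamma> that by (simp add: tropical_curve_def)
  note nonneg = valid_chips_nonneg[OF v]
  define g where "g e y = ereal (h (tail (graph \<Gamma>) e) + of_int (s e) * real_of_ereal y + kink ds e (real_of_ereal y))" for e y
  have "\<exists>L. (g e \<longlongrightarrow> L) (at_left \<infinity>)" for e
  proof -
    let ?c = "chip_sum ds (\<lambda>p. \<exists>z<\<infinity>. p = On e z)"
    obtain b where "\<forall>\<^sub>F z in at_left \<infinity>. ereal (kink ds e (real_of_ereal z)) = ereal (b + of_int ?c * real_of_ereal z)"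
      using kink_left[OF _ nonneg, of \<infinity>] by auto
    then have "\<forall>\<^sub>F z in at_left \<infinity>. g e z = ereal ((h (tail (graph \<Gamma>) e) + b) + of_int (s e + ?c) * real_of_ereal z)"
      by eventually_elim (simp add: g_def algebra_simps)
    then show ?thesis by (rule ex_limit_at_infinity)
  qed
  then obtain M where M: "\<And>e. (g e \<longlongrightarrow> M e) (at_left \<infinity>)" by metis
  \<comment> \<open>At the head of an infinite edge the value \<open>h\<close> is replaced by the
    limit \<open>M\<close> along that edge, which makes the function continuous there.\<close>
  define far where "far u e \<longleftrightarrow> e \<in> edges \<Gamma> \<and> len \<Gamma> e = \<infinity> \<and> head (graph \<Gamma>) e = u" for u e
  define f where "f q = (case q of Vertex u \<Rightarrow> if \<exists>e. far u e then M (SOME e. far u e) else ereal (h u)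
      | Interior e r \<Rightarrow> g e (ereal r))" for q
  have far: "f (Vertex (head (graph \<Gamma>) e)) = M e" if "e \<in> edges \<Gamma>" "len \<Gamma> e = \<infinity>" for e
  proof -
    have "far (head (graph \<Gamma>) e) = (\<lambda>d. d = e)"
      using infinite_edge_head(1)[OF \<Gamma> that] that by (auto simp: far_def fun_eq_iff)
    then show ?thesis by (simp add: f_def)
  qed
  have tail: "f (Vertex (tail (graph \<Gamma>) e)) = ereal (h (tail (graph \<Gamma>) e))" if "e \<in> edges \<Gamma>" for e
  proof -
    have "\<not> far (tail (graph \<Gamma>) e) d" for d
      using infinite_edge_head(2)[OF \<Gamma>, of d e] that by (auto simp: far_def)
    then show ?thesis by (auto simp: f_def)
  qed
  have head: "f (Vertex (head (graph \<Gamma>) e)) = ereal (h (head (graph \<Gamma>) e))" if "e \<in> edges \<Gamma>" "len \<Gamma> e \<noteq> \<infinity>" for e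
    using infinite_edge_head(1)[OF \<Gamma> _ _ that(1)] that by (fastforce simp: f_def far_def)
  have form: "f (chart \<Gamma> e (ereal y)) = ereal (h (tail (graph \<Gamma>) e) + of_int (s e) * y + kink ds e y)"
    if "e \<in> edges \<Gamma>" "0 \<le> y" "ereal y < len \<Gamma> e" for e y
  proof (cases "y = 0")
    case True
    then show ?thesis using tail that kink_zero[OF nonneg] by (simp add: chart_def zero_ereal_def)
  next
    case False
    then have "chart \<Gamma> e (ereal y) = Interior e y" using that by (auto simp: chart_def zero_ereal_def)
    then show ?thesis by (simp add: f_def g_def)
  qed
  have "rational_function \<Gamma> f" unfolding rational_function_def
  proof (intro conjI ballI impI)
    fix e assume e: "e \<in> edges \<Gamma>"
    have "\<forall>z \<in> stops ds e. 0 \<le> z \<and> z \<le> len \<Gamma> e" using valid_chips_on[OF v] by (auto simp: stops_def)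
    then show "piecewise_linear (len \<Gamma> e) (\<lambda>x. f (chart \<Gamma> e x))"
      using pos[OF e] form[OF e] by (intro piecewise_linear_form[where e = e and ds = ds]) auto
    have "((\<lambda>x. f (chart \<Gamma> e x)) \<longlongrightarrow> f (chart \<Gamma> e (len \<Gamma> e))) (at_left (len \<Gamma> e))"
    proof (cases "len \<Gamma> e")
      case (real L)
      have L: "0 < L" using pos[OF e] real by simp
      have "f (chart \<Gamma> e (len \<Gamma> e)) = ereal (h (tail (graph \<Gamma>) e) + of_int (s e) * L + kink ds e L)"
        using pot e real L head[OF e] by (auto simp: potential_def chart_def zero_ereal_def algebra_simps)
      moreover have "\<forall>\<^sub>F y in at_left L. ereal (h (tail (graph \<Gamma>) e) + of_int (s e) * y + kink ds e y) = f (chart \<Gamma> e (ereal y))"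
        using L form[OF e] real by (subst eventually_at_left[OF L]) auto
      with affine_kink_tendsto have "((\<lambda>y. f (chart \<Gamma> e (ereal y))) \<longlongrightarrow>
          ereal (h (tail (graph \<Gamma>) e) + of_int (s e) * L + kink ds e L)) (at_left L)"
        by (rule Lim_transform_eventually)
      ultimately show ?thesis unfolding real by (simp add: at_left_ereal filterlim_filtermap)
    next
      case PInf
      have "\<forall>\<^sub>F z in at_left (\<infinity>::ereal). 0 < z \<and> z < \<infinity>"
        by (subst eventually_at_left[of 0]) (auto intro!: exI[of _ 0])
      then have "\<forall>\<^sub>F z in at_left \<infinity>. g e z = f (chart \<Gamma> e z)"
      proof eventually_elim
        case (elim z)
        then show ?case using form[OF e, of "real_of_ereal z"] PInf by (cases z) (auto simp: g_def)
      qed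
      with M have "((\<lambda>x. f (chart \<Gamma> e x)) \<longlongrightarrow> M e) (at_left \<infinity>)"
        by (rule Lim_transform_eventually)
      then show ?thesis using far[OF e PInf] PInf by (simp add: chart_def)
    qed (use pos[OF e] in simp)
    then show "continuous_on {0..len \<Gamma> e} (\<lambda>x. f (chart \<Gamma> e x))"
      using pos[OF e] form[OF e] by (intro continuous_form[where e = e and ds = ds]) auto
  next
    fix q assume q: "q \<in> points \<Gamma>" "\<bar>f q\<bar> = \<infinity>"
    then obtain u where u: "q = Vertex u" by (cases q) (auto simp: f_def g_def)
    with q obtain e where e: "far u e" by (auto simp: f_def split: if_splits)
    then have "chart \<Gamma> e \<infinity> = q" using u by (simp add: far_def chart_def)
    with e show "q \<in> unbounded_ends \<Gamma>" by (auto simp: unbounded_ends_def far_def)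
  qed
  moreover from this have "div_of \<Gamma> f = chip_div \<Gamma> ds"
    using div_of_eq_iff[OF \<Gamma> _ v form] bal by blast
  ultimately show "\<exists>f. rational_function \<Gamma> f \<and> div_of \<Gamma> f = chip_div \<Gamma> ds" by blast
qed

section \<open>Slope bound and degree\<close>

abbreviation total_weight :: "chips \<Rightarrow> int" where
  "total_weight ds \<equiv> chip_sum ds (\<lambda>p. True)"

definition abs_chips :: "chips \<Rightarrow> chips" where
  "abs_chips ds = map (\<lambda>(k, p). (\<bar>k\<bar>, p)) ds"

lemma abs_chips_simps [simp]:
  "abs_chips [] = []" "abs_chips ((k, p) # ds) = (\<bar>k\<bar>, p) # abs_chips ds"
  "abs_chips (ds @ ds') = abs_chips ds @ abs_chips ds'"
  by (simp_all add: abs_chips_def)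

lemma valid_abs_chips [simp]: "valid_chips \<Gamma> (abs_chips ds) = valid_chips \<Gamma> ds"
  by (induction ds) auto

lemma abs_chip_sum_le: "\<bar>chip_sum ds P\<bar> \<le> chip_sum (abs_chips ds) P"
proof (induction ds)
  case (Cons d ds)
  then show ?case by (cases d) auto
qed simp

lemma abs_chip_sum_nonneg: "0 \<le> chip_sum (abs_chips ds) P"
  using abs_chip_sum_le[of ds P] by linarith

lemma total_weight_eq:
  assumes "finite (edges \<Gamma>)" "finite (vertices \<Gamma>)" "valid_chips \<Gamma> ds"
  shows "total_weight ds = (\<Sum>e\<in>edges \<Gamma>. edge_weight ds e) + (\<Sum>v\<in>vertices \<Gamma>. vertex_weight ds v)"
  using assms(3)
proof (induction ds)
  case (Cons d ds)
  obtain k p where d: "d = (k, p)" by (cases d)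
  have "(\<Sum>e\<in>edges \<Gamma>. if \<exists>z. p = On e z then k else 0) + (\<Sum>v\<in>vertices \<Gamma>. if p = At v then k else 0) = k"
    using Cons.prems d assms(1,2) by (cases p) (simp_all add: sum.delta' eq_commute[of _ "_ :: nat"])
  with Cons d show ?case by (simp add: sum.distrib)
qed simp

lemma sum_over_arcs:
  fixes f :: "nat \<Rightarrow> 'a::comm_monoid_add"
  assumes "finite E" "finite U"
  shows "(\<Sum>u\<in>U. \<Sum>e | e \<in> E \<and> t e = u. f e) = (\<Sum>e\<in>E. if t e \<in> U then f e else 0)"
proof -
  have "(\<Sum>u\<in>U. \<Sum>e | e \<in> E \<and> t e = u. f e) = (\<Sum>u\<in>U. \<Sum>e\<in>E. if t e = u then f e else 0)"
    using assms by (simp add: sum.If_cases Int_def)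
  also have "\<dots> = (\<Sum>e\<in>E. \<Sum>u\<in>U. if t e = u then f e else 0)" by (rule sum.swap)
  also have "\<dots> = (\<Sum>e\<in>E. if t e \<in> U then f e else 0)"
    using assms by (simp add: sum.delta')
  finally show ?thesis .
qed

text \<open>A discrete divergence theorem: an edge inside \<open>U\<close> contributes only minus
  its weight, and slopes survive only on edges that cross the boundary of \<open>U\<close>.\<close>

lemma balanced_sum:
  assumes fin: "finite (edges \<Gamma>)" "finite U" and U: "U \<subseteq> vertices \<Gamma>" and bal: "balanced \<Gamma> ds s"
  shows "(\<Sum>e\<in>edges \<Gamma>. (if tail (graph \<Gamma>) e \<in> U then s e else 0) -
      (if head (graph \<Gamma>) e \<in> U then s e + edge_weight ds e else 0)) = (\<Sum>u\<in>U. vertex_weight ds u)"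
proof -
  have "(\<Sum>u\<in>U. vertex_weight ds u) = (\<Sum>u\<in>U. (\<Sum>e | e \<in> edges \<Gamma> \<and> tail (graph \<Gamma>) e = u. s e) -
     (\<Sum>e | e \<in> edges \<Gamma> \<and> head (graph \<Gamma>) e = u. s e + edge_weight ds e))"
    using bal U by (intro sum.cong) (auto simp: balanced_def)
  then show ?thesis by (simp add: sum_subtractf sum_over_arcs[OF fin])
qed

text \<open>For \<open>U\<close> the set of all vertices no edge crosses the boundary, so all slopes
  cancel.\<close>

lemma balanced_total_weight:
  assumes \<Gamma>: "tropical_curve \<Gamma>" and v: "valid_chips \<Gamma> ds" and bal: "balanced \<Gamma> ds s"
  shows "total_weight ds = 0"
proof -
  interpret fin_digraph "graph \<Gamma>" using \<Gamma> by (simp add: tropical_curve_def)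
  have "(\<Sum>e\<in>edges \<Gamma>. - edge_weight ds e) = (\<Sum>u\<in>vertices \<Gamma>. vertex_weight ds u)"
    using balanced_sum[OF finite_arcs finite_verts subset_refl bal] by simp
  then show ?thesis using total_weight_eq[OF finite_arcs finite_verts v] by (simp add: sum_negf)
qed

lemma abs_kink_le:
  assumes "valid_chips \<Gamma> ds" "0 \<le> L"
  shows "\<bar>kink ds e L\<bar> \<le> of_int (edge_weight (abs_chips ds) e) * L"
  using assms(1)
proof (induction ds)
  case (Cons d ds)
  obtain k p where d: "d = (k, p)" by (cases d)
  have "\<bar>of_int k * hinge e p L\<bar> \<le> of_int (if \<exists>z. p = On e z then \<bar>k\<bar> else 0) * L"
  proof (cases p)
    case (On e' z)
    with Cons.prems d have "0 \<le> z" by simp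
    then have "0 \<le> real_of_ereal z" by (simp add: real_of_ereal_pos)
    then have "\<bar>hinge e p L\<bar> \<le> L" using assms(2) On by auto
    moreover have "hinge e p L = 0" if "e' \<noteq> e" using that On by simp
    ultimately show ?thesis using On by (auto simp: abs_mult intro: mult_left_mono)
  qed simp
  with Cons d show ?case by (simp add: algebra_simps)
qed simp

text \<open>
  Summing the balancing conditions over the superlevel set of \<open>h\<close> above the lower end of an edge,
  every other edge contributes at most twice the weight on it.
\<close>

lemma slope_bound:
  assumes \<Gamma>: "tropical_curve \<Gamma>" and v: "valid_chips \<Gamma> ds"
    and bal: "balanced \<Gamma> ds s" and pot: "potential \<Gamma> ds s h" and e0: "e0 \<in> edges \<Gamma>"
  shows "\<bar>s e0\<bar> \<le> 3 * total_weight (abs_chips ds)"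
proof -
  interpret fin_digraph "graph \<Gamma>" using \<Gamma> by (simp add: tropical_curve_def)
  let ?t = "tail (graph \<Gamma>)" and ?h = "head (graph \<Gamma>)"
  let ?w = "edge_weight ds" and ?a = "edge_weight (abs_chips ds)"
  let ?C = "total_weight (abs_chips ds)"
  have wa: "\<bar>?w e\<bar> \<le> ?a e" for e by (rule abs_chip_sum_le)
  have a0: "0 \<le> ?a e" for e by (rule abs_chip_sum_nonneg)
  have C: "?C = (\<Sum>e\<in>edges \<Gamma>. ?a e) + (\<Sum>u\<in>vertices \<Gamma>. vertex_weight (abs_chips ds) u)"
    using v by (intro total_weight_eq) auto
  have atU: "\<bar>\<Sum>u\<in>U. vertex_weight ds u\<bar> \<le> ?C - (\<Sum>e\<in>edges \<Gamma>. ?a e)" if U: "U \<subseteq> vertices \<Gamma>" for U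
  proof -
    have "\<bar>\<Sum>u\<in>U. vertex_weight ds u\<bar> \<le> (\<Sum>u\<in>U. vertex_weight (abs_chips ds) u)"
      by (rule order_trans[OF sum_abs]) (intro sum_mono abs_chip_sum_le)
    also have "\<dots> \<le> (\<Sum>u\<in>vertices \<Gamma>. vertex_weight (abs_chips ds) u)"
      using U by (intro sum_mono2) (auto simp: abs_chip_sum_nonneg)
    finally show ?thesis using C by simp
  qed
  have ae: "?a e0 \<le> (\<Sum>e\<in>edges \<Gamma>. ?a e)"
    using e0 a0 by (intro member_le_sum) auto
  have sumC: "(\<Sum>e\<in>edges \<Gamma>. ?a e) \<le> ?C"
    unfolding C by (simp add: sum_nonneg abs_chip_sum_nonneg)
  show ?thesis
  proof (cases "len \<Gamma> e0 = \<infinity>")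
    case True
    \<comment> \<open>The head is a leaf, so its balancing condition alone determines
      \<open>s e0\<close>.\<close>
    have hd: "{e. e \<in> edges \<Gamma> \<and> ?h e = ?h e0} = {e0}"
      using infinite_edge_head(1)[OF \<Gamma> e0 True] e0 by auto
    have tl: "{e. e \<in> edges \<Gamma> \<and> ?t e = ?h e0} = {}"
      using infinite_edge_head(2)[OF \<Gamma> e0 True] by auto
    have "?h e0 \<in> vertices \<Gamma>" using e0 by simp
    with bal have "(\<Sum>e | e \<in> edges \<Gamma> \<and> ?t e = ?h e0. s e) -
        (\<Sum>e | e \<in> edges \<Gamma> \<and> ?h e = ?h e0. s e + ?w e) = vertex_weight ds (?h e0)"
      unfolding balanced_def by blast
    then have "- (s e0 + ?w e0) = vertex_weight ds (?h e0)" unfolding hd tl by simp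
    moreover have "\<bar>vertex_weight ds (?h e0)\<bar> \<le> ?C - (\<Sum>e\<in>edges \<Gamma>. ?a e)"
      using atU[of "{?h e0}"] \<open>?h e0 \<in> vertices \<Gamma>\<close> by simp
    ultimately show ?thesis using wa[of e0] ae sumC a0[of e0] by linarith
  next
    case False
    define far where "far u e \<longleftrightarrow> e \<in> edges \<Gamma> \<and> len \<Gamma> e = \<infinity> \<and> ?h e = u" for u e
    \<comment> \<open>At an unbounded end \<open>h\<close> is arbitrary. Giving it the value of the
      tail puts both ends of an infinite edge on the same side of every level.\<close>
    define h' where "h' u = (if \<exists>e. far u e then h (?t (SOME e. far u e)) else h u)" for u
    have h'_far: "h' (?h e) = h (?t e)" if "e \<in> edges \<Gamma>" "len \<Gamma> e = \<infinity>" for e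
    proof -
      have "far (?h e) = (\<lambda>d. d = e)"
        using infinite_edge_head(1)[OF \<Gamma> that] that by (auto simp: far_def fun_eq_iff)
      then show ?thesis by (simp add: h'_def)
    qed
    have h'_tail: "h' (?t e) = h (?t e)" if "e \<in> edges \<Gamma>" for e
    proof -
      have "\<not> far (?t e) d" for d
        using infinite_edge_head(2)[OF \<Gamma>, of d e] that by (auto simp: far_def)
      then show ?thesis by (auto simp: h'_def)
    qed
    have h'_head: "h' (?h e) = h (?h e)" if "e \<in> edges \<Gamma>" "len \<Gamma> e \<noteq> \<infinity>" for e
    proof -
      have "\<not> far (?h e) d" for d
        using infinite_edge_head(1)[OF \<Gamma>, of d e] that by (auto simp: far_def)
      then show ?thesis by (auto simp: h'_def)
    qed
    \<comment> \<open>The mean slope of the function on \<open>e\<close> differs from the initial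
      slope \<open>s e\<close> by at most the weight on \<open>e\<close>.\<close>
    have mean: "(h' (?h e) \<le> h' (?t e) \<longrightarrow> s e \<le> ?a e) \<and> (h' (?t e) \<le> h' (?h e) \<longrightarrow> - s e \<le> ?a e)"
      if e: "e \<in> edges \<Gamma>" "len \<Gamma> e \<noteq> \<infinity>" for e
    proof -
      have "0 < len \<Gamma> e" using \<Gamma> e by (simp add: tropical_curve_def)
      with e obtain L where L: "len \<Gamma> e = ereal L" "0 < L" by (cases "len \<Gamma> e") auto
      have eq: "h' (?h e) - h' (?t e) = of_int (s e) * L + kink ds e L"
        using pot e L by (simp add: potential_def h'_head h'_tail)
      have k: "\<bar>kink ds e L\<bar> \<le> of_int (?a e) * L" using abs_kink_le[OF v] L by simp
      show ?thesis
      proof (intro conjI impI)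
        assume "h' (?h e) \<le> h' (?t e)"
        with eq k have "of_int (s e) * L \<le> of_int (?a e) * L" by linarith
        with L(2) show "s e \<le> ?a e" by simp
      next
        assume "h' (?t e) \<le> h' (?h e)"
        moreover have "real_of_int (- s e) * L = - (of_int (s e) * L)" by simp
        ultimately have "real_of_int (- s e) * L \<le> of_int (?a e) * L" using eq k by linarith
        then show "- s e \<le> ?a e" by (simp only: mult_le_cancel_right_pos[OF L(2)] of_int_le_iff)
      qed
    qed
    \<comment> \<open>The chips at vertices account for the first term, the edges other than
      \<open>e0\<close> for the second. Final slopes add one more \<open>?a e0\<close>, and since no
      partial sum of weights exceeds \<open>?C\<close>, the total stays below
      \<open>3 * ?C\<close>.\<close>
    have level: "- (?C - (\<Sum>e\<in>edges \<Gamma>. ?a e)) - 2 * (\<Sum>e\<in>edges \<Gamma>. ?a e) \<le>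
        (if h' (?t e0) > c then s e0 else 0) - (if h' (?h e0) > c then s e0 + ?w e0 else 0)" for c
    proof -
      define U where "U = {u \<in> vertices \<Gamma>. h' u > c}"
      define T where "T e = (if ?t e \<in> U then s e else 0) - (if ?h e \<in> U then s e + ?w e else 0)" for e
      have U: "?t e \<in> U \<longleftrightarrow> h' (?t e) > c" "?h e \<in> U \<longleftrightarrow> h' (?h e) > c" if "e \<in> edges \<Gamma>" for e
        using that by (auto simp: U_def)
      have T: "T e \<le> 2 * ?a e" if e: "e \<in> edges \<Gamma>" for e
      proof (cases "len \<Gamma> e = \<infinity>")
        case True
        have "?t e \<in> U \<longleftrightarrow> ?h e \<in> U" using h'_far[OF e True] h'_tail[OF e] U[OF e] by simp
        then have "T e = - ?w e \<or> T e = 0" unfolding T_def by (cases "?h e \<in> U") simp_all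
        then show ?thesis using wa[of e] a0[of e] by linarith
      next
        case False
        note m = mean[OF e False]
        consider "?t e \<in> U" "?h e \<in> U" | "?t e \<in> U" "?h e \<notin> U" | "?t e \<notin> U" "?h e \<in> U" | "?t e \<notin> U" "?h e \<notin> U"
          by blast
        then show ?thesis
        proof cases
          case 1
          then have "T e = - ?w e" by (simp add: T_def)
          then show ?thesis using wa[of e] by linarith
        next
          case 2
          then have "h' (?h e) \<le> h' (?t e)" using U[OF e] by linarith
          with m have "s e \<le> ?a e" by blast
          moreover have "T e = s e" using 2 by (simp add: T_def)
          ultimately show ?thesis using a0[of e] by linarith
        next
          case 3
          then have "h' (?t e) \<le> h' (?h e)" using U[OF e] by linarith
          with m have "- s e \<le> ?a e" by blast
          moreover have "T e = - (s e + ?w e)" using 3 by (simp add: T_def)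
          ultimately show ?thesis using wa[of e] by linarith
        next
          case 4
          then have "T e = 0" by (simp add: T_def)
          then show ?thesis using a0[of e] by linarith
        qed
      qed
      have "- (?C - (\<Sum>e\<in>edges \<Gamma>. ?a e)) \<le> (\<Sum>u\<in>U. vertex_weight ds u)"
        using atU[of U] by (auto simp: U_def abs_le_iff)
      also have "\<dots> = (\<Sum>e\<in>edges \<Gamma>. T e)"
        unfolding T_def by (rule balanced_sum[OF _ _ _ bal, symmetric]) (auto simp: U_def)
      also have "\<dots> = T e0 + (\<Sum>e\<in>edges \<Gamma> - {e0}. T e)" using e0 by (simp add: sum.remove)
      also have "(\<Sum>e\<in>edges \<Gamma> - {e0}. T e) \<le> (\<Sum>e\<in>edges \<Gamma> - {e0}. 2 * ?a e)" by (intro sum_mono T) auto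
      also have "\<dots> \<le> (\<Sum>e\<in>edges \<Gamma>. 2 * ?a e)" using a0 by (intro sum_mono2) auto
      finally show ?thesis using U[OF e0] by (simp add: T_def sum_distrib_left)
    qed
    consider "h' (?h e0) < h' (?t e0)" | "h' (?t e0) < h' (?h e0)" | "h' (?t e0) = h' (?h e0)" by linarith
    then show ?thesis
    proof cases
      case 1
      then have "s e0 \<le> ?a e0" using mean[OF e0 False] by simp
      moreover have "- (?C - (\<Sum>e\<in>edges \<Gamma>. ?a e)) - 2 * (\<Sum>e\<in>edges \<Gamma>. ?a e) \<le> s e0"
        using level[of "h' (?h e0)"] 1 by simp
      ultimately show ?thesis using ae sumC a0[of e0] by linarith
    next
      case 2
      then have "- s e0 \<le> ?a e0" using mean[OF e0 False] by simp
      moreover have "- (?C - (\<Sum>e\<in>edges \<Gamma>. ?a e)) - 2 * (\<Sum>e\<in>edges \<Gamma>. ?a e) \<le> - (s e0 + ?w e0)"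
        using level[of "h' (?t e0)"] 2 by simp
      ultimately show ?thesis using ae sumC a0[of e0] wa[of e0] by linarith
    next
      case 3
      then have "s e0 \<le> ?a e0" "- s e0 \<le> ?a e0" using mean[OF e0 False] by simp_all
      then show ?thesis using ae sumC a0[of e0] by linarith
    qed
  qed
qed

section \<open>The rank as a search problem\<close>

definition unit_chips :: "description list \<Rightarrow> chips" where
  "unit_chips qs = map (Pair 1) qs"

definition neg_chips :: "chips \<Rightarrow> chips" where
  "neg_chips ds = map (\<lambda>(k, p). (- k, p)) ds"

lemma unit_chips_simps [simp]:
  "unit_chips [] = []" "unit_chips (q # qs) = (1, q) # unit_chips qs"
  "unit_chips (qs @ rs) = unit_chips qs @ unit_chips rs"
  by (simp_all add: unit_chips_def)

lemma neg_chips_simps [simp]: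
  "neg_chips [] = []" "neg_chips ((k, p) # ds) = (- k, p) # neg_chips ds"
  by (simp_all add: neg_chips_def)

lemma chip_sum_neg: "chip_sum (neg_chips ds) P = - chip_sum ds P"
  by (induction ds) auto

lemma chip_div_neg: "chip_div \<Gamma> (neg_chips ds) = - chip_div \<Gamma> ds"
  by (induction ds) (auto simp flip: minus_frag_cmul)

lemma valid_neg_chips [simp]: "valid_chips \<Gamma> (neg_chips ds) = valid_chips \<Gamma> ds"
  by (induction ds) auto

lemma valid_unit_chips [simp]: "valid_chips \<Gamma> (unit_chips qs) \<longleftrightarrow> (\<forall>q \<in> set qs. valid_description \<Gamma> q)"
  by (induction qs) auto

lemma total_weight_unit: "total_weight (unit_chips qs) = int (length qs)"
  by (induction qs) auto

lemma deg_superset: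
  assumes "finite S" "Poly_Mapping.keys D \<subseteq> S"
  shows "deg D = (\<Sum>v\<in>S. Poly_Mapping.lookup D v)"
  unfolding deg_def using assms by (intro sum.mono_neutral_left) (auto simp: in_keys_iff)

lemma deg_add: "deg (D + E) = deg D + deg E"
proof -
  let ?S = "Poly_Mapping.keys D \<union> Poly_Mapping.keys E"
  have "deg (D + E) = (\<Sum>v\<in>?S. Poly_Mapping.lookup (D + E) v)"
    using Poly_Mapping.keys_add[of D E] by (intro deg_superset) auto
  also have "\<dots> = (\<Sum>v\<in>?S. Poly_Mapping.lookup D v) + (\<Sum>v\<in>?S. Poly_Mapping.lookup E v)"
    by (simp add: lookup_add sum.distrib)
  also have "(\<Sum>v\<in>?S. Poly_Mapping.lookup D v) = deg D" by (rule deg_superset[symmetric]) auto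
  also have "(\<Sum>v\<in>?S. Poly_Mapping.lookup E v) = deg E" by (rule deg_superset[symmetric]) auto
  finally show ?thesis .
qed

lemma deg_zero [simp]: "deg 0 = 0"
  by (simp add: deg_def)

lemma deg_chip: "deg (frag_cmul k (frag_of q)) = k"
  by (subst deg_superset[of "{q}"]) (auto simp: lookup_single split: if_splits)

lemma deg_chip_div: "deg (chip_div \<Gamma> ds) = total_weight ds"
proof (induction ds)
  case (Cons d ds)
  then show ?case by (cases d) (simp add: deg_add deg_chip)
qed simp

lemma chip_div_in_Div:
  assumes "valid_chips \<Gamma> ds"
  shows "chip_div \<Gamma> ds \<in> Div \<Gamma>"
proof -
  have "q \<in> points \<Gamma>" if "q \<in> Poly_Mapping.keys (chip_div \<Gamma> ds)" for q
    using that lookup_chip_div_no_point[OF assms, of q] by (auto simp: in_keys_iff lookup_chip_div)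
  then show ?thesis by (auto simp: Div_def)
qed

lemma effective_unit: "effective (chip_div \<Gamma> (unit_chips qs))"
  unfolding effective_def by (induction qs) (auto simp: lookup_add lookup_single when_def)

lemma ex_description:
  assumes "q \<in> points \<Gamma>"
  shows "\<exists>p. valid_description \<Gamma> p \<and> described_point \<Gamma> p = q"
proof -
  consider u where "u \<in> vertices \<Gamma>" "q = Vertex u"
    | e x where "e \<in> edges \<Gamma>" "0 \<le> x" "x \<le> len \<Gamma> e" "q = chart \<Gamma> e x"
    using assms by (auto simp: points_def)
  then show ?thesis
  proof cases
    case (1 u)
    then show ?thesis by (intro exI[of _ "At u"]) simp
  next
    case (2 e x)
    then show ?thesis by (intro exI[of _ "On e x"]) simp
  qed
qed

lemma effective_eq_unit_chips:
  assumes "effective E" "E \<in> Div \<Gamma>" "deg E = int n"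
  shows "\<exists>qs. length qs = n \<and> (\<forall>q \<in> set qs. valid_description \<Gamma> q) \<and> E = chip_div \<Gamma> (unit_chips qs)"
  using assms
proof (induction n arbitrary: E)
  case 0
  have "\<forall>v \<in> Poly_Mapping.keys E. Poly_Mapping.lookup E v = 0"
    using 0 by (subst sum_nonneg_eq_0_iff[symmetric]) (auto simp: deg_def effective_def)
  then have "E = 0" by (simp add: in_keys_iff flip: keys_eq_empty) (use in_keys_iff in blast)
  then show ?case by (intro exI[of _ "[]"]) simp
next
  case (Suc n)
  have "E \<noteq> 0" using Suc.prems(3) by auto
  then obtain v where v: "v \<in> Poly_Mapping.keys E" by (metis keys_eq_empty ex_in_conv)
  then have pos: "1 \<le> Poly_Mapping.lookup E v"
    using Suc.prems(1) by (metis effective_def in_keys_iff int_one_le_iff_zero_less order_le_less)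
  obtain p where p: "valid_description \<Gamma> p" "described_point \<Gamma> p = v"
    using ex_description v Suc.prems(2) unfolding Div_def by blast
  let ?E = "E - frag_of v"
  have E: "E = frag_of v + ?E" by simp
  have "effective ?E"
    using Suc.prems(1) pos by (auto simp: effective_def lookup_minus lookup_single when_def)
  moreover have "?E \<in> Div \<Gamma>"
    using Suc.prems(2) v keys_diff[of E "frag_of v"] by (auto simp: Div_def)
  moreover have "deg ?E = int n"
    using Suc.prems(3) E deg_add[of "frag_of v" ?E] deg_chip[of 1 v] by simp
  ultimately obtain qs where "length qs = n" "\<forall>q \<in> set qs. valid_description \<Gamma> q" "?E = chip_div \<Gamma> (unit_chips qs)"
    using Suc.IH by blast
  then show ?case using p E by (intro exI[of _ "p # qs"]) (simp add: algebra_simps)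
qed

definition solvable :: "(nat, nat) metric_graph \<Rightarrow> chips \<Rightarrow> bool" where
  "solvable \<Gamma> ds \<longleftrightarrow> (\<exists>s h. balanced \<Gamma> ds s \<and> potential \<Gamma> ds s h)"

text \<open>
  Principal divisors have degree \<open>0\<close>, so only completions of \<open>qs\<close> by exactly \<open>deg D - d\<close> further
  points can be equivalent to \<open>D\<close>.
\<close>

definition obstructed :: "(nat, nat) metric_graph \<Rightarrow> chips \<Rightarrow> nat \<Rightarrow> bool" where
  "obstructed \<Gamma> ds d \<longleftrightarrow> total_weight ds < int d \<or>
    (\<exists>qs. length qs = d \<and> (\<forall>q \<in> set qs. valid_description \<Gamma> q) \<and>
       (\<forall>rs. length rs = nat (total_weight ds) - d \<longrightarrow> (\<forall>q \<in> set rs. valid_description \<Gamma> q) \<longrightarrow>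
          \<not> solvable \<Gamma> (neg_chips ds @ unit_chips (qs @ rs))))"

text \<open>If \<open>F = D - E + div f\<close> then \<open>div f = E + F - D\<close>, which is the
  chip list passed to \<open>solvable\<close>. The first alternative covers the case in which the
  truncated subtraction would not be the degree of \<open>F\<close>.\<close>

lemma linear_system_empty_iff:
  assumes \<Gamma>: "tropical_curve \<Gamma>" and v: "valid_chips \<Gamma> ds"
    and q: "\<forall>q \<in> set qs. valid_description \<Gamma> q"
  shows "linear_system \<Gamma> (chip_div \<Gamma> ds - chip_div \<Gamma> (unit_chips qs)) = {} \<longleftrightarrow>
    total_weight ds < int (length qs) \<or>
    (\<forall>rs. length rs = nat (total_weight ds) - length qs \<longrightarrow> (\<forall>q \<in> set rs. valid_description \<Gamma> q) \<longrightarrow>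
          \<not> solvable \<Gamma> (neg_chips ds @ unit_chips (qs @ rs)))"
proof -
  let ?L = "\<lambda>rs. neg_chips ds @ unit_chips (qs @ rs)"
  let ?D = "chip_div \<Gamma> ds - chip_div \<Gamma> (unit_chips qs)"
  have mem: "chip_div \<Gamma> (unit_chips rs) \<in> linear_system \<Gamma> ?D \<longleftrightarrow> solvable \<Gamma> (?L rs)"
    if rs: "\<forall>q \<in> set rs. valid_description \<Gamma> q" for rs
  proof -
    have val: "valid_chips \<Gamma> (?L rs)" using v q rs by simp
    have "chip_div \<Gamma> (unit_chips rs) = ?D + X \<longleftrightarrow> X = chip_div \<Gamma> (?L rs)" for X
      by (auto simp: chip_div_neg algebra_simps)
    then show ?thesis
      unfolding solvable_def principal_iff[OF \<Gamma> val, symmetric] linear_system_def equivalent_def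
      using rs chip_div_in_Div effective_unit by fastforce
  qed
  have len: "int (length rs) = total_weight ds - int (length qs)"
    if rs: "\<forall>q \<in> set rs. valid_description \<Gamma> q" and s: "solvable \<Gamma> (?L rs)" for rs
  proof -
    have val: "valid_chips \<Gamma> (?L rs)" using v q rs by simp
    from s obtain s where "balanced \<Gamma> (?L rs) s" by (auto simp: solvable_def)
    from balanced_total_weight[OF \<Gamma> val this] show ?thesis
      by (simp add: chip_sum_neg total_weight_unit)
  qed
  show ?thesis
  proof
    assume empty: "linear_system \<Gamma> ?D = {}"
    then show "total_weight ds < int (length qs) \<or>
    (\<forall>rs. length rs = nat (total_weight ds) - length qs \<longrightarrow> (\<forall>q \<in> set rs. valid_description \<Gamma> q) \<longrightarrow>
          \<not> solvable \<Gamma> (?L rs))" using mem by blast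
  next
    assume r: "total_weight ds < int (length qs) \<or>
    (\<forall>rs. length rs = nat (total_weight ds) - length qs \<longrightarrow> (\<forall>q \<in> set rs. valid_description \<Gamma> q) \<longrightarrow>
          \<not> solvable \<Gamma> (?L rs))"
    show "linear_system \<Gamma> ?D = {}"
    proof (rule ccontr)
      assume "linear_system \<Gamma> ?D \<noteq> {}"
      then obtain F where F: "F \<in> linear_system \<Gamma> ?D" by blast
      then have F': "effective F" "F \<in> Div \<Gamma>" by (auto simp: linear_system_def)
      have "0 \<le> deg F" using F'(1) by (auto simp: deg_def effective_def intro: sum_nonneg)
      then have "deg F = int (nat (deg F))" by simp
      from effective_eq_unit_chips[OF F' this] obtain rs where
        rs: "\<forall>q \<in> set rs. valid_description \<Gamma> q" "F = chip_div \<Gamma> (unit_chips rs)" by blast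
      then have s: "solvable \<Gamma> (?L rs)" using mem F by blast
      from len[OF rs(1) s] have l: "int (length rs) = total_weight ds - int (length qs)" .
      then have "length rs = nat (total_weight ds) - length qs" "int (length qs) \<le> total_weight ds" by linarith+
      with r rs s show False by auto
    qed
  qed
qed

theorem divisor_rank_eq:
  assumes \<Gamma>: "tropical_curve \<Gamma>" and ds: "describes \<Gamma> ds D"
  shows "divisor_rank \<Gamma> D = int (LEAST d. obstructed \<Gamma> ds d) - 1" and "\<exists>d. obstructed \<Gamma> ds d"
proof -
  have v: "valid_chips \<Gamma> ds" and D: "D = chip_div \<Gamma> ds"
    using ds by (auto simp: describes_def valid_chips_def chip_div_def)
  interpret fin_digraph "graph \<Gamma>" using \<Gamma> by (simp add: tropical_curve_def)
  \<comment> \<open>A divisor of degree greater than \<open>deg D\<close> always obstructs; this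
    guarantees that the search ends.\<close>
  show ex: "\<exists>d. obstructed \<Gamma> ds d"
    by (rule exI[of _ "nat (total_weight ds + 1)"]) (auto simp: obstructed_def)
  have "Digraph_Component.connected (graph \<Gamma>)" using \<Gamma> by (simp add: tropical_curve_def)
  then have "vertices \<Gamma> \<noteq> {}"
    by (auto simp: Digraph_Component.connected_def strongly_connected_def)
  then obtain u where u: "u \<in> vertices \<Gamma>" by blast
  let ?P = "\<lambda>d. \<exists>E \<in> Div \<Gamma>. effective E \<and> linear_system \<Gamma> (D - E) = {} \<and> deg E = d"
  \<comment> \<open>The rank is a \<open>LEAST\<close> over integers. Effective divisors have
    nonnegative degree, so it becomes a \<open>LEAST\<close> over natural numbers.\<close>
  have iff: "?P d \<longleftrightarrow> 0 \<le> d \<and> obstructed \<Gamma> ds (nat d)" for d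
  proof
    assume "?P d"
    then obtain E where E: "E \<in> Div \<Gamma>" "effective E" "linear_system \<Gamma> (D - E) = {}" "deg E = d" by blast
    have "0 \<le> deg E" using E(2) by (auto simp: deg_def effective_def intro: sum_nonneg)
    with E have d: "0 \<le> d" "deg E = int (nat d)" by auto
    from effective_eq_unit_chips[OF E(2,1) d(2)] obtain qs where
      qs: "length qs = nat d" "\<forall>q \<in> set qs. valid_description \<Gamma> q" "E = chip_div \<Gamma> (unit_chips qs)" by blast
    have "obstructed \<Gamma> ds (nat d)"
      using E(3) qs linear_system_empty_iff[OF \<Gamma> v qs(2)] unfolding obstructed_def D by metis
    with d show "0 \<le> d \<and> obstructed \<Gamma> ds (nat d)" by simp
  next
    assume d: "0 \<le> d \<and> obstructed \<Gamma> ds (nat d)"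
    have "\<exists>qs. length qs = nat d \<and> (\<forall>q \<in> set qs. valid_description \<Gamma> q) \<and>
        linear_system \<Gamma> (chip_div \<Gamma> ds - chip_div \<Gamma> (unit_chips qs)) = {}"
    proof (cases "total_weight ds < int (nat d)")
      case True
      \<comment> \<open>The degree alone obstructs, so any \<open>d\<close> points serve;
        connectedness supplies a vertex to repeat.\<close>
      have val: "\<forall>q \<in> set (replicate (nat d) (At u)). valid_description \<Gamma> q" using u by simp
      show ?thesis using linear_system_empty_iff[OF \<Gamma> v val] True val
        by (intro exI[of _ "replicate (nat d) (At u)"]) simp
    next
      case False
      with d obtain qs where qs: "length qs = nat d" "\<forall>q \<in> set qs. valid_description \<Gamma> q"
        "\<forall>rs. length rs = nat (total_weight ds) - nat d \<longrightarrow> (\<forall>q \<in> set rs. valid_description \<Gamma> q) \<longrightarrow>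
          \<not> solvable \<Gamma> (neg_chips ds @ unit_chips (qs @ rs))"
        unfolding obstructed_def by blast
      then show ?thesis using linear_system_empty_iff[OF \<Gamma> v qs(2)] by (intro exI[of _ qs]) simp
    qed
    then obtain qs where qs: "length qs = nat d" "\<forall>q \<in> set qs. valid_description \<Gamma> q"
        "linear_system \<Gamma> (chip_div \<Gamma> ds - chip_div \<Gamma> (unit_chips qs)) = {}" by blast
    moreover have "deg (chip_div \<Gamma> (unit_chips qs)) = d"
      using d qs(1) by (simp add: deg_chip_div total_weight_unit)
    ultimately show "?P d" using effective_unit chip_div_in_Div
      by (intro bexI[of _ "chip_div \<Gamma> (unit_chips qs)"]) (auto simp: D)
  qed
  have "(LEAST d. 0 \<le> d \<and> obstructed \<Gamma> ds (nat d)) = int (LEAST d. obstructed \<Gamma> ds d)"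
  proof (rule Least_equality)
    show "0 \<le> int (LEAST d. obstructed \<Gamma> ds d) \<and> obstructed \<Gamma> ds (nat (int (LEAST d. obstructed \<Gamma> ds d)))"
      using LeastI_ex[OF ex] by simp
    show "int (LEAST d. obstructed \<Gamma> ds d) \<le> y" if "0 \<le> y \<and> obstructed \<Gamma> ds (nat y)" for y
      using Least_le[of "obstructed \<Gamma> ds" "nat y"] that by linarith
  qed
  then show "divisor_rank \<Gamma> D = int (LEAST d. obstructed \<Gamma> ds d) - 1"
    unfolding divisor_rank_def iff by simp
qed

section \<open>The program\<close>

lemma icomp_nat_diff:
  assumes "ncomp R F" "ncomp R G"
  shows "ncomp R (\<lambda>a. F a - G a)"
  using icomp_nat[OF icomp_diff[OF assms]] by (simp add: nat_minus_as_int)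

lemma icomp_nat_if:
  assumes "bcomp R Q" "ncomp R F" "ncomp R G"
  shows "ncomp R (\<lambda>a. if Q a then F a else G a)"
  using icomp_if[OF assms] by (simp add: if_distrib[of int])

section \<open>Decoding the input and the search condition\<close>

definition nV :: "input \<Rightarrow> nat" where "nV x = nat (geti x 0)"
definition nE :: "input \<Rightarrow> nat" where "nE x = nat (geti x 1)"
definition nD :: "input \<Rightarrow> nat" where "nD x = nat (geti x 2)"

definition tl_of :: "input \<Rightarrow> nat \<Rightarrow> nat" where "tl_of x e = nat (geti x (3 + 3 * e))"
definition hd_of :: "input \<Rightarrow> nat \<Rightarrow> nat" where "hd_of x e = nat (geti x (4 + 3 * e))"
definition inf_of :: "input \<Rightarrow> nat \<Rightarrow> int" where "inf_of x e = geti x (5 + 3 * e)"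

definition coef_of :: "input \<Rightarrow> nat \<Rightarrow> int" where "coef_of x j = geti x (3 + 3 * nE x + 4 * j)"
definition kind_of :: "input \<Rightarrow> nat \<Rightarrow> int" where "kind_of x j = geti x (4 + 3 * nE x + 4 * j)"
definition index_of :: "input \<Rightarrow> nat \<Rightarrow> nat" where "index_of x j = nat (geti x (5 + 3 * nE x + 4 * j))"

definition degree_of :: "input \<Rightarrow> int" where "degree_of x = (\<Sum>j<nD x. coef_of x j)"
text \<open>The number of unknown points: those of \<open>E\<close> and \<open>F\<close> together,
  where \<open>E + F\<close> has the degree of \<open>D\<close>.\<close>

definition nP :: "input \<Rightarrow> nat" where "nP x = nat (degree_of x)"
text \<open>The bound \<open>3 * total_weight\<close> of \<open>slope_bound\<close> for the absolute
  chips of \<open>E + F - D\<close>.\<close>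

definition slope_max :: "input \<Rightarrow> nat" where "slope_max x = 3 * (nat (\<Sum>j<nD x. \<bar>coef_of x j\<bar>) + nP x)"

text \<open>
  The real vectors that the algorithm speaks about consist of \<open>1\<close>, the edge lengths, the
  positions of the given chips, the positions of \<open>nP x\<close> unknown points, and the values of the
  function at the vertices.  The unknown point \<open>i\<close> is the vertex \<open>\<tau> i\<close> if \<open>\<tau> i < nV x\<close>, and lies
  on the edge \<open>\<tau> i - nV x\<close> otherwise.
\<close>

definition params :: "input \<Rightarrow> nat \<Rightarrow> real" where
  "params x l = (if l = 0 then 1 else getr x (l - 1))"

definition nK :: "input \<Rightarrow> nat" where "nK x = 1 + nE x + nD x"
definition nU :: "input \<Rightarrow> nat" where "nU x = nK x + nP x + nV x"

definition placed :: "input \<Rightarrow> (nat \<Rightarrow> nat) \<Rightarrow> (nat \<Rightarrow> real) \<Rightarrow> nat \<Rightarrow> bool" where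
  "placed x \<tau> u i \<longleftrightarrow> \<tau> i < nV x + nE x \<and>
     (nV x \<le> \<tau> i \<longrightarrow> 0 \<le> u (nK x + i) \<and>
        (inf_of x (\<tau> i - nV x) = 0 \<longrightarrow> u (nK x + i) \<le> u (1 + (\<tau> i - nV x))))"

definition edge_load :: "input \<Rightarrow> (nat \<Rightarrow> nat) \<Rightarrow> nat \<Rightarrow> int" where
  "edge_load x \<tau> e = (\<Sum>i<nP x. if \<tau> i = nV x + e then 1 else 0) -
     (\<Sum>j<nD x. if kind_of x j = 1 \<and> index_of x j = e then coef_of x j else 0)"

definition vertex_load :: "input \<Rightarrow> (nat \<Rightarrow> nat) \<Rightarrow> nat \<Rightarrow> int" where
  "vertex_load x \<tau> v = (\<Sum>i<nP x. if \<tau> i = v then 1 else 0) -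
     (\<Sum>j<nD x. if kind_of x j = 0 \<and> index_of x j = v then coef_of x j else 0)"

definition balance_eqs :: "input \<Rightarrow> (nat \<Rightarrow> nat) \<Rightarrow> (nat \<Rightarrow> int) \<Rightarrow> bool" where
  "balance_eqs x \<tau> s \<longleftrightarrow> (\<forall>v<nV x.
     (\<Sum>e<nE x. if tl_of x e = v then s e else 0) -
     (\<Sum>e<nE x. if hd_of x e = v then s e + edge_load x \<tau> e else 0) = vertex_load x \<tau> v)"

text \<open>The equation in \<open>potential\<close> with every hinge written as a difference. It is
  linear, and correct once all chips are known to lie on the edge.\<close>

definition edge_eq :: "input \<Rightarrow> (nat \<Rightarrow> nat) \<Rightarrow> (nat \<Rightarrow> int) \<Rightarrow> (nat \<Rightarrow> real) \<Rightarrow> nat \<Rightarrow> bool" where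
  "edge_eq x \<tau> s u e \<longleftrightarrow>
     u (nK x + nP x + hd_of x e) - u (nK x + nP x + tl_of x e) = of_int (s e) * u (1 + e) +
       (\<Sum>i<nP x. if \<tau> i = nV x + e then u (1 + e) - u (nK x + i) else 0) -
       (\<Sum>j<nD x. if kind_of x j = 1 \<and> index_of x j = e then of_int (coef_of x j) * (u (1 + e) - u (1 + nE x + j)) else 0)"

definition principal_eqs :: "input \<Rightarrow> (nat \<Rightarrow> nat) \<Rightarrow> (nat \<Rightarrow> int) \<Rightarrow> (nat \<Rightarrow> real) \<Rightarrow> bool" where
  "principal_eqs x \<tau> s u \<longleftrightarrow> balance_eqs x \<tau> s \<and> (\<forall>e<nE x. inf_of x e = 0 \<longrightarrow> edge_eq x \<tau> s u e)"

text \<open>The sum of the coefficients of \<open>edge_eq\<close>: the slope, two for each unit of a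
  given coefficient, two for each unknown point, and two for the vertex values. The last summand
  also covers the comparisons in \<open>placed\<close>.\<close>

definition coef_max :: "input \<Rightarrow> nat" where
  "coef_max x = slope_max x + 2 * nat (\<Sum>j<nD x. \<bar>coef_of x j\<bar>) + 2 * nP x + 2"

text \<open>The number of eliminated variables is \<open>nP x + nV x\<close> however the points are
  divided between \<open>E\<close> and \<open>F\<close>, so the radius does not depend on
  \<open>d\<close>.\<close>

definition radius1 :: "input \<Rightarrow> nat" where
  "radius1 x = code_bound (coef_max x) (nK x) (nP x + nV x)"

definition radius2 :: "input \<Rightarrow> nat" where
  "radius2 x = (2 * radius1 x + 1) * radius1 x"

text \<open>The first \<open>d\<close> types belong to \<open>E\<close> and are read from
  \<open>tE\<close>, the others belong to \<open>F\<close> and are read from \<open>tF\<close>.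
  Points keep their index in both codes, so the ranges of the codes do not depend on
  \<open>d\<close>.\<close>

definition type_of :: "input \<Rightarrow> nat \<Rightarrow> nat \<Rightarrow> nat \<Rightarrow> nat \<Rightarrow> nat" where
  "type_of x d tE tF i = (if i < d then dig (nV x + nE x) tE i else dig (nV x + nE x) tF i)"

definition slope_of :: "input \<Rightarrow> nat \<Rightarrow> nat \<Rightarrow> int" where
  "slope_of x c e = int (dig (2 * slope_max x + 1) c e) - int (slope_max x)"

definition vector_of :: "input \<Rightarrow> nat \<Rightarrow> nat \<Rightarrow> nat \<Rightarrow> nat \<Rightarrow> real" where
  "vector_of x d cE cF i =
     (if i < nK x then params x i
      else if i < nK x + d then comb (radius1 x) (nK x) (params x) (nU x) cE i
      else comb (radius2 x) (nK x) (params x) (nU x) cF i)"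

text \<open>\<open>tE\<close> and \<open>cE\<close> code the types and positions of
  \<open>E\<close>; \<open>cF\<close> codes the positions of \<open>F\<close> and the vertex values,
  \<open>tF\<close> and \<open>c\<close> the types of \<open>F\<close> and the slopes. The last two
  are quantified innermost so that what follows the real codes is a single sign-invariant
  predicate.\<close>

definition search_cond :: "input \<Rightarrow> nat \<Rightarrow> bool" where
  "search_cond x d \<longleftrightarrow> degree_of x < int d \<or>
     (\<exists>tE < (nV x + nE x) ^ nP x. \<exists>cE < (2 * radius1 x + 1) ^ (nU x * nK x + 1).
      \<forall>cF < (2 * radius2 x + 1) ^ (nU x * nK x + 1).
        (\<forall>i<d. placed x (type_of x d tE 0) (vector_of x d cE cF) i) \<and>
        (\<forall>tF < (nV x + nE x) ^ nP x. \<forall>c < (2 * slope_max x + 1) ^ nE x.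
           (\<forall>i<nP x. d \<le> i \<longrightarrow> placed x (type_of x d tE tF) (vector_of x d cE cF) i) \<longrightarrow>
           \<not> principal_eqs x (type_of x d tE tF) (slope_of x c) (vector_of x d cE cF)))"

section \<open>Computability of the search condition\<close>

lemmas nat_intros = icomp_nat_const icomp_nat_add icomp_nat_mult icomp_nat_diff icomp_nat_div icomp_nat_mod
  icomp_power icomp_nat icomp_nat_if

lemmas comp_intros = nat_intros icomp_const icomp_add icomp_diff icomp_mult icomp_if icomp_abs
  rcomp_add rcomp_diff rcomp_mult rcomp_divide rcomp_if rcomp_zero rcomp_one rcomp_of_int rcomp_of_nat
  bcomp_not bcomp_conj bcomp_disj bcomp_imp bcomp_less_nat bcomp_le_nat bcomp_eq_nat
  bcomp_less_int bcomp_eq_int bcomp_le_real bcomp_eq_real icomp_geti rcomp_getr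

text \<open>The variables by de Bruijn index, \<open>var0\<close> being the innermost.\<close>

lemmas var0 = icomp_head[where e = int]
lemmas var1 = icomp_weaken[OF var0]
lemmas var2 = icomp_weaken[OF var1]
lemmas var3 = icomp_weaken[OF var2]
lemmas var4 = icomp_weaken[OF var3]
lemmas var5 = icomp_weaken[OF var4]
lemmas var6 = icomp_weaken[OF var5]
lemmas var7 = icomp_weaken[OF var6]
lemmas vars = var0 var1 var2 var3 var4 var5 var6 var7

lemma comp_nV: "reads R I \<Longrightarrow> ncomp R (\<lambda>a. nV (I a))"
  unfolding nV_def by (intro icomp_nat icomp_geti icomp_nat_const)

lemma comp_nE: "reads R I \<Longrightarrow> ncomp R (\<lambda>a. nE (I a))"
  unfolding nE_def by (intro icomp_nat icomp_geti icomp_nat_const)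

lemma comp_nD: "reads R I \<Longrightarrow> ncomp R (\<lambda>a. nD (I a))"
  unfolding nD_def by (intro icomp_nat icomp_geti icomp_nat_const)

lemma comp_nK: "reads R I \<Longrightarrow> ncomp R (\<lambda>a. nK (I a))"
  unfolding nK_def by (intro comp_intros comp_nE comp_nD)

lemma comp_tl_of: "reads R I \<Longrightarrow> ncomp R F \<Longrightarrow> ncomp R (\<lambda>a. tl_of (I a) (F a))"
  unfolding tl_of_def by (intro comp_intros comp_nE)

lemma comp_hd_of: "reads R I \<Longrightarrow> ncomp R F \<Longrightarrow> ncomp R (\<lambda>a. hd_of (I a) (F a))"
  unfolding hd_of_def by (intro comp_intros comp_nE)

lemma comp_inf_of: "reads R I \<Longrightarrow> ncomp R F \<Longrightarrow> icomp R (\<lambda>a. inf_of (I a) (F a))"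
  unfolding inf_of_def by (intro comp_intros comp_nE)

lemma comp_coef_of: "reads R I \<Longrightarrow> ncomp R F \<Longrightarrow> icomp R (\<lambda>a. coef_of (I a) (F a))"
  unfolding coef_of_def by (intro comp_intros comp_nE)

lemma comp_kind_of: "reads R I \<Longrightarrow> ncomp R F \<Longrightarrow> icomp R (\<lambda>a. kind_of (I a) (F a))"
  unfolding kind_of_def by (intro comp_intros comp_nE)

lemma comp_index_of: "reads R I \<Longrightarrow> ncomp R F \<Longrightarrow> ncomp R (\<lambda>a. index_of (I a) (F a))"
  unfolding index_of_def by (intro comp_intros comp_nE)

lemma comp_params: "reads R I \<Longrightarrow> ncomp R F \<Longrightarrow> rcomp R (\<lambda>a. params (I a) (F a))"
  unfolding params_def by (intro comp_intros)

lemma comp_degree_of: "reads R I \<Longrightarrow> icomp R (\<lambda>a. degree_of (I a))"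
  unfolding degree_of_def by (intro icomp_sum comp_coef_of comp_nD reads_ext vars)

lemma comp_nP: "reads R I \<Longrightarrow> ncomp R (\<lambda>a. nP (I a))"
  unfolding nP_def by (intro comp_intros comp_degree_of)

lemma comp_nU: "reads R I \<Longrightarrow> ncomp R (\<lambda>a. nU (I a))"
  unfolding nU_def by (intro comp_intros comp_nP comp_nK comp_nV)

lemma comp_coef_sum: "reads R I \<Longrightarrow> icomp R (\<lambda>a. \<Sum>j<nD (I a). \<bar>coef_of (I a) j\<bar>)"
  by (intro icomp_sum icomp_abs comp_coef_of comp_nD reads_ext vars)

lemma comp_slope_max: "reads R I \<Longrightarrow> ncomp R (\<lambda>a. slope_max (I a))"
  unfolding slope_max_def by (intro comp_intros comp_coef_sum comp_nP)

lemma comp_coef_max: "reads R I \<Longrightarrow> ncomp R (\<lambda>a. coef_max (I a))"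
  unfolding coef_max_def by (intro comp_intros comp_coef_sum comp_nP comp_slope_max)

lemma comp_elim_bound:
  assumes "ncomp R F" "ncomp R G"
  shows "ncomp R (\<lambda>a. elim_bound (F a) (G a))"
  unfolding elim_bound_def
  by (rule icomp_nat_iter[where b = "\<lambda>_ _ b. 2 * b\<^sup>2"]) (intro assms comp_intros vars)+

lemma comp_radius1: "reads R I \<Longrightarrow> ncomp R (\<lambda>a. radius1 (I a))"
  unfolding radius1_def code_bound_def
  by (intro comp_intros comp_elim_bound comp_coef_max comp_nK comp_nP comp_nV)

lemma comp_radius2: "reads R I \<Longrightarrow> ncomp R (\<lambda>a. radius2 (I a))"
  unfolding radius2_def by (intro comp_intros comp_radius1)

lemma comp_dig: "ncomp R F \<Longrightarrow> ncomp R G \<Longrightarrow> ncomp R H \<Longrightarrow> ncomp R (\<lambda>a. dig (F a) (G a) (H a))"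
  unfolding dig_def by (intro comp_intros)

lemma comp_type_of:
  "reads R I \<Longrightarrow> ncomp R F \<Longrightarrow> ncomp R G \<Longrightarrow> ncomp R H \<Longrightarrow> ncomp R J \<Longrightarrow>
   ncomp R (\<lambda>a. type_of (I a) (F a) (G a) (H a) (J a))"
  unfolding type_of_def by (intro comp_intros comp_dig comp_nV comp_nE)

lemma comp_slope_of:
  "reads R I \<Longrightarrow> ncomp R F \<Longrightarrow> ncomp R G \<Longrightarrow> icomp R (\<lambda>a. slope_of (I a) (F a) (G a))"
  unfolding slope_of_def by (intro comp_intros comp_dig comp_slope_max)

lemma comp_comb:
  assumes "reads R I" "ncomp R A" "ncomp R k" "ncomp R K" "ncomp R c" "ncomp R i"
  shows "rcomp R (\<lambda>a. comb (A a) (k a) (params (I a)) (K a) (c a) (i a))"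
  unfolding comb_def
  by (intro comp_intros rcomp_sum comp_dig comp_params reads_ext vars assms assms(2-)[THEN icomp_weaken])

lemma comp_vector_of:
  "reads R I \<Longrightarrow> ncomp R F \<Longrightarrow> ncomp R G \<Longrightarrow> ncomp R H \<Longrightarrow> ncomp R J \<Longrightarrow>
   rcomp R (\<lambda>a. vector_of (I a) (F a) (G a) (H a) (J a))"
  unfolding vector_of_def
  by (intro rcomp_if bcomp_less_nat icomp_nat_add comp_comb comp_params comp_nK comp_nU comp_radius1 comp_radius2)

lemmas const_intros = comp_nP comp_nU comp_nV comp_nE comp_nD comp_nK comp_tl_of comp_hd_of comp_inf_of
  comp_coef_of comp_kind_of comp_index_of

text \<open>Functions are not values of the program. Predicates on types, slopes and vectors are
  therefore shown computable only for arguments decoded from integers.\<close>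

lemma comp_placed:
  assumes "reads R I" "ncomp R D" "ncomp R T" "ncomp R T'" "ncomp R C" "ncomp R C'" "ncomp R J"
  shows "bcomp R (\<lambda>a. placed (I a) (type_of (I a) (D a) (T a) (T' a)) (vector_of (I a) (D a) (C a) (C' a)) (J a))"
  unfolding placed_def
  by (intro bcomp_conj bcomp_imp bcomp_less_nat bcomp_le_nat bcomp_le_real bcomp_eq_int rcomp_zero icomp_const
      icomp_nat_add icomp_nat_diff icomp_nat_const comp_type_of comp_vector_of comp_inf_of comp_nV comp_nE comp_nK assms)

lemma comp_edge_load:
  assumes "reads R I" "ncomp R D" "ncomp R T" "ncomp R T'" "ncomp R J"
  shows "icomp R (\<lambda>a. edge_load (I a) (type_of (I a) (D a) (T a) (T' a)) (J a))"
  unfolding edge_load_def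
  by (intro icomp_diff icomp_sum icomp_if bcomp_conj bcomp_eq_nat bcomp_eq_int icomp_const icomp_nat_add
      comp_type_of const_intros reads_ext vars assms assms(2-)[THEN icomp_weaken])

lemma comp_vertex_load:
  assumes "reads R I" "ncomp R D" "ncomp R T" "ncomp R T'" "ncomp R J"
  shows "icomp R (\<lambda>a. vertex_load (I a) (type_of (I a) (D a) (T a) (T' a)) (J a))"
  unfolding vertex_load_def
  by (intro icomp_diff icomp_sum icomp_if bcomp_conj bcomp_eq_nat bcomp_eq_int icomp_const icomp_nat_add
      comp_type_of const_intros reads_ext vars assms assms(2-)[THEN icomp_weaken])

lemma comp_balance_eqs:
  assumes "reads R I" "ncomp R D" "ncomp R T" "ncomp R T'" "ncomp R C"
  shows "bcomp R (\<lambda>a. balance_eqs (I a) (type_of (I a) (D a) (T a) (T' a)) (slope_of (I a) (C a)))"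
  unfolding balance_eqs_def
  by (intro bcomp_ball bcomp_eq_int icomp_diff icomp_sum icomp_if bcomp_eq_nat icomp_const icomp_add
      comp_edge_load comp_vertex_load comp_slope_of const_intros reads_ext vars assms assms(2-)[THEN icomp_weaken]
      assms(2-)[THEN icomp_weaken, THEN icomp_weaken])

lemma comp_edge_eq:
  assumes "reads R I" "ncomp R D" "ncomp R T" "ncomp R T'" "ncomp R S" "ncomp R C" "ncomp R C'" "ncomp R J"
  shows "bcomp R (\<lambda>a. edge_eq (I a) (type_of (I a) (D a) (T a) (T' a)) (slope_of (I a) (S a))
    (vector_of (I a) (D a) (C a) (C' a)) (J a))"
  unfolding edge_eq_def
  by (intro bcomp_eq_real rcomp_add rcomp_diff rcomp_mult rcomp_sum rcomp_of_int rcomp_if rcomp_zero bcomp_conj bcomp_eq_nat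
      bcomp_eq_int icomp_const icomp_nat_const icomp_nat_add comp_type_of comp_slope_of comp_vector_of const_intros
      reads_ext vars assms assms(2-)[THEN icomp_weaken])

lemma comp_principal_eqs:
  assumes "reads R I" "ncomp R D" "ncomp R T" "ncomp R T'" "ncomp R S" "ncomp R C" "ncomp R C'"
  shows "bcomp R (\<lambda>a. principal_eqs (I a) (type_of (I a) (D a) (T a) (T' a)) (slope_of (I a) (S a))
    (vector_of (I a) (D a) (C a) (C' a)))"
  unfolding principal_eqs_def
  by (intro bcomp_conj bcomp_ball bcomp_imp bcomp_eq_int icomp_const comp_balance_eqs comp_edge_eq comp_inf_of comp_nE
      reads_ext vars assms assms(2-)[THEN icomp_weaken])

lemma comp_search_cond:
  assumes "reads R I" "ncomp R D"
  shows "bcomp R (\<lambda>a. search_cond (I a) (D a))"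
proof -
  \<comment> \<open>Weakening is not directed by syntax, so the facts about the input and
    \<open>D\<close> are supplied for the nesting depths at which they occur.\<close>
  note r = assms(1)[THEN reads_ext] assms(1)[THEN reads_ext, THEN reads_ext]
    assms(1)[THEN reads_ext, THEN reads_ext, THEN reads_ext]
    assms(1)[THEN reads_ext, THEN reads_ext, THEN reads_ext, THEN reads_ext]
    assms(1)[THEN reads_ext, THEN reads_ext, THEN reads_ext, THEN reads_ext, THEN reads_ext]
    assms(1)[THEN reads_ext, THEN reads_ext, THEN reads_ext, THEN reads_ext, THEN reads_ext, THEN reads_ext]
  note D = assms(2) assms(2)[THEN icomp_weaken, THEN icomp_weaken, THEN icomp_weaken]
    assms(2)[THEN icomp_weaken, THEN icomp_weaken, THEN icomp_weaken, THEN icomp_weaken]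
    assms(2)[THEN icomp_weaken, THEN icomp_weaken, THEN icomp_weaken, THEN icomp_weaken, THEN icomp_weaken]
    assms(2)[THEN icomp_weaken, THEN icomp_weaken, THEN icomp_weaken, THEN icomp_weaken, THEN icomp_weaken, THEN icomp_weaken]
  show ?thesis
    unfolding search_cond_def
    by (intro bcomp_disj bcomp_less_int bcomp_ball bcomp_bex bcomp_conj bcomp_imp bcomp_not bcomp_le_nat
        comp_placed comp_principal_eqs comp_degree_of comp_radius1 comp_radius2 comp_slope_max
        icomp_power icomp_nat_add icomp_nat_mult icomp_nat_const comp_nV comp_nE comp_nP comp_nU comp_nK
        assms(1) r D vars)
qed

theorem computes_Least_search_cond:
  "\<exists>P. \<forall>x d. wf_input x \<longrightarrow> search_cond x d \<longrightarrow> computes P x (int (LEAST d. search_cond x d) - 1)"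
  by (rule computes_search[OF comp_search_cond[OF reads_ext[OF reads_base] var0]])

section \<open>Correctness of the program\<close>

lemma nth_concat_blocks:
  assumes "\<And>y. y \<in> set ys \<Longrightarrow> length (f y) = m" "i < length ys" "r < m"
  shows "concat (map f ys) ! (m * i + r) = f (ys ! i) ! r"
  using assms
proof (induction ys arbitrary: i)
  case (Cons y ys)
  show ?case
  proof (cases i)
    case 0
    then show ?thesis using Cons.prems by (simp add: nth_append)
  next
    case (Suc i')
    then show ?thesis using Cons.prems Cons.IH[of i'] by (simp add: nth_append)
  qed
qed simp

lemma length_concat_blocks:
  "(\<And>y. y \<in> set ys \<Longrightarrow> length (f y) = m) \<Longrightarrow> length (concat (map f ys)) = m * length ys"
  by (induction ys) auto

lemma length_description_ints [simp]: "length (description_ints p) = 3"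
  by (cases p) auto

definition desc_kind :: "description \<Rightarrow> int" where
  "desc_kind p = (case p of At v \<Rightarrow> 0 | On e z \<Rightarrow> 1)"

definition desc_index :: "description \<Rightarrow> nat" where
  "desc_index p = (case p of At v \<Rightarrow> v | On e z \<Rightarrow> e)"

lemma encode_ints:
  fixes \<Gamma> ds
  defines "x \<equiv> encode \<Gamma> ds"
  defines "m \<equiv> card (edges \<Gamma>)"
  shows "length (fst x) = 3 + 3 * m + 4 * length ds"
    and "geti x 0 = int (card (vertices \<Gamma>))" "geti x 1 = int m" "geti x 2 = int (length ds)"
    and "e < m \<Longrightarrow> r < 3 \<Longrightarrow> geti x (3 + (3 * e + r)) =
      [int (tail (graph \<Gamma>) e), int (head (graph \<Gamma>) e), inf_flag (len \<Gamma> e)] ! r"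
    and "j < length ds \<Longrightarrow> r < 4 \<Longrightarrow> geti x (3 + 3 * m + (4 * j + r)) =
      (fst (ds ! j) # description_ints (snd (ds ! j))) ! r"
proof -
  let ?A = "[int (card (vertices \<Gamma>)), int m, int (length ds)]"
  let ?f = "\<lambda>e. [int (tail (graph \<Gamma>) e), int (head (graph \<Gamma>) e), inf_flag (len \<Gamma> e)]"
  let ?g = "\<lambda>(k, p). k # description_ints p"
  have x: "fst x = ?A @ concat (map ?f [0..<m]) @ concat (map ?g ds)"
    by (simp add: x_def m_def encode_def)
  have lf: "length (concat (map ?f [0..<m])) = 3 * m"
    by (subst length_concat_blocks[of _ _ 3]) auto
  have lg: "length (concat (map ?g ds)) = 4 * length ds"
    by (subst length_concat_blocks[of _ _ 4]) auto
  show len: "length (fst x) = 3 + 3 * m + 4 * length ds" unfolding x using lf lg by simp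
  have nth: "geti x i = (?A @ concat (map ?f [0..<m]) @ concat (map ?g ds)) ! i" if "i < 3 + 3 * m + 4 * length ds" for i
  proof -
    have "geti x i = fst x ! i" using that len by (simp add: geti_def)
    then show ?thesis unfolding x .
  qed
  show "geti x 0 = int (card (vertices \<Gamma>))" "geti x 1 = int m" "geti x 2 = int (length ds)"
    by (simp_all add: nth)
  show "geti x (3 + (3 * e + r)) = ?f e ! r" if "e < m" "r < 3"
  proof -
    have lt: "3 * e + r < 3 * m" using that by linarith
    have "geti x (3 + (3 * e + r)) = (?A @ concat (map ?f [0..<m]) @ concat (map ?g ds)) ! (length ?A + (3 * e + r))"
      using lt nth[of "3 + (3 * e + r)"] by simp
    also have "\<dots> = (concat (map ?f [0..<m]) @ concat (map ?g ds)) ! (3 * e + r)"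
      by (rule nth_append_length_plus)
    also have "\<dots> = concat (map ?f [0..<m]) ! (3 * e + r)"
      using lt lf by (simp only: nth_append if_True)
    also have "\<dots> = ?f ([0..<m] ! e) ! r"
      by (rule nth_concat_blocks[where f = ?f and ys = "[0..<m]" and m = 3]) (use that in auto)
    finally show ?thesis using that by simp
  qed
  show "geti x (3 + 3 * m + (4 * j + r)) = (fst (ds ! j) # description_ints (snd (ds ! j))) ! r"
    if "j < length ds" "r < 4"
  proof -
    have lt: "4 * j + r < 4 * length ds" using that by linarith
    let ?B = "?A @ concat (map ?f [0..<m])"
    have B: "length ?B = 3 + 3 * m" using lf by simp
    have "geti x (3 + 3 * m + (4 * j + r)) = (?B @ concat (map ?g ds)) ! (length ?B + (4 * j + r))"
      unfolding B using lt nth[of "3 + 3 * m + (4 * j + r)"] by (simp only: append_assoc)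
    also have "\<dots> = concat (map ?g ds) ! (4 * j + r)"
      by (rule nth_append_length_plus)
    also have "\<dots> = ?g (ds ! j) ! r"
      by (rule nth_concat_blocks[where f = ?g and m = 4]) (use that in auto)
    finally show ?thesis by (simp only: case_prod_beta)
  qed
qed

lemma encode_reals:
  fixes \<Gamma> ds
  defines "x \<equiv> encode \<Gamma> ds"
  defines "m \<equiv> card (edges \<Gamma>)"
  shows "length (snd x) = m + length ds"
    and "e < m \<Longrightarrow> getr x e = real_of_ereal (len \<Gamma> e)"
    and "j < length ds \<Longrightarrow> getr x (m + j) = description_real (snd (ds ! j))"
  by (simp_all add: x_def m_def encode_def getr_def nth_append case_prod_beta)

locale encoded =
  fixes \<Gamma> :: "(nat, nat) metric_graph" and ds :: chips and x :: input
  assumes tropical: "tropical_curve \<Gamma>" and num: "numbered \<Gamma>" and valid: "valid_chips \<Gamma> ds"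
    and x: "x = encode \<Gamma> ds"
begin

sublocale fin_digraph "graph \<Gamma>"
  using tropical by (simp add: tropical_curve_def)

lemma sizes: "nV x = card (vertices \<Gamma>)" "nE x = card (edges \<Gamma>)" "nD x = length ds"
  using encode_ints(2-4)[of \<Gamma> ds] by (simp_all add: x nV_def nE_def nD_def)

lemma sets: "vertices \<Gamma> = {..<nV x}" "edges \<Gamma> = {..<nE x}"
  using num by (simp_all add: numbered_def sizes)

lemma wf: "wf_input x"
  using encode_ints(1-4)[of \<Gamma> ds] encode_reals(1)[of \<Gamma> ds] by (simp add: wf_input_def x)

lemma arc:
  assumes "e < nE x"
  shows "tl_of x e = tail (graph \<Gamma>) e" "hd_of x e = head (graph \<Gamma>) e" "inf_of x e = 0 \<longleftrightarrow> len \<Gamma> e \<noteq> \<infinity>"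
    "params x (1 + e) = real_of_ereal (len \<Gamma> e)"
  using assms encode_ints(5)[of e \<Gamma> 0 ds] encode_ints(5)[of e \<Gamma> 1 ds] encode_ints(5)[of e \<Gamma> 2 ds] encode_reals(2)[of e \<Gamma> ds]
  by (simp_all add: x[symmetric] sizes tl_of_def hd_of_def inf_of_def params_def inf_flag_def algebra_simps)

lemma chip:
  assumes "j < nD x"
  shows "coef_of x j = fst (ds ! j)" "kind_of x j = desc_kind (snd (ds ! j))" "index_of x j = desc_index (snd (ds ! j))"
    "params x (1 + nE x + j) = description_real (snd (ds ! j))"
proof -
  note e = encode_ints(6)[of j ds _ \<Gamma>, folded x, folded sizes(2)]
  have 1: "3 + 3 * nE x + (4 * j + 1) = 4 + 3 * nE x + 4 * j" "3 + 3 * nE x + (4 * j + 2) = 5 + 3 * nE x + 4 * j" by simp_all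
  show "coef_of x j = fst (ds ! j)"
    using e[of 0] assms by (simp add: coef_of_def sizes(3))
  show "kind_of x j = desc_kind (snd (ds ! j))"
    using e[of 1] assms unfolding 1 by (cases "snd (ds ! j)") (simp_all add: kind_of_def sizes(3) desc_kind_def)
  show "index_of x j = desc_index (snd (ds ! j))"
    using e[of 2] assms unfolding 1 by (cases "snd (ds ! j)") (simp_all add: index_of_def sizes(3) desc_index_def)
  show "params x (1 + nE x + j) = description_real (snd (ds ! j))"
    using encode_reals(3)[of j ds \<Gamma>, folded x, folded sizes(2)] assms by (simp add: params_def sizes(3))
qed

lemma sum_chips: "(\<Sum>j<nD x. F (ds ! j)) = (\<Sum>d\<leftarrow>ds. F d)"
  by (simp add: sizes(3) sum_list_sum_nth atLeast0LessThan)

lemma degree: "degree_of x = total_weight ds"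
proof -
  have "degree_of x = (\<Sum>j<nD x. fst (ds ! j))" by (simp add: degree_of_def chip)
  also have "\<dots> = (\<Sum>d\<leftarrow>ds. fst d)" by (rule sum_chips)
  also have "\<dots> = total_weight ds" by (induction ds) auto
  finally show ?thesis .
qed

lemma coef_sum: "(\<Sum>j<nD x. \<bar>coef_of x j\<bar>) = total_weight (abs_chips ds)"
proof -
  have "(\<Sum>j<nD x. \<bar>coef_of x j\<bar>) = (\<Sum>j<nD x. \<bar>fst (ds ! j)\<bar>)" by (simp add: chip)
  also have "\<dots> = (\<Sum>d\<leftarrow>ds. \<bar>fst d\<bar>)" by (rule sum_chips)
  also have "\<dots> = total_weight (abs_chips ds)" by (induction ds) auto
  finally show ?thesis .
qed

section \<open>Unknown points as pairs of a type and a real position\<close>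

definition place :: "nat \<Rightarrow> real \<Rightarrow> description" where
  "place t y = (if t < nV x then At t else On (t - nV x) (ereal y))"

definition places :: "(nat \<Rightarrow> nat) \<Rightarrow> (nat \<Rightarrow> real) \<Rightarrow> description list" where
  "places \<tau> u = map (\<lambda>i. place (\<tau> i) (u (nK x + i))) [0..<nP x]"

definition instance_chips :: "(nat \<Rightarrow> nat) \<Rightarrow> (nat \<Rightarrow> real) \<Rightarrow> chips" where
  "instance_chips \<tau> u = neg_chips ds @ unit_chips (places \<tau> u)"

definition good :: "(nat \<Rightarrow> real) \<Rightarrow> bool" where
  "good u \<longleftrightarrow> (\<forall>i<nK x. u i = params x i)"

lemma good:
  assumes "good u"
  shows "e < nE x \<Longrightarrow> u (1 + e) = real_of_ereal (len \<Gamma> e)"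
    and "j < nD x \<Longrightarrow> u (1 + nE x + j) = description_real (snd (ds ! j))"
  using assms by (simp_all add: good_def nK_def arc(4)[simplified] chip(4)[simplified])

lemma placed_iff:
  assumes "good u"
  shows "placed x \<tau> u i \<longleftrightarrow> \<tau> i < nV x + nE x \<and> valid_description \<Gamma> (place (\<tau> i) (u (nK x + i)))"
proof (cases "nV x \<le> \<tau> i \<and> \<tau> i < nV x + nE x")
  case True
  define e where "e = \<tau> i - nV x"
  have e: "e < nE x" using True by (auto simp: e_def)
  have "0 < len \<Gamma> e" using tropical e by (simp add: tropical_curve_def sets)
  then have "ereal y \<le> len \<Gamma> e \<longleftrightarrow> len \<Gamma> e = \<infinity> \<or> y \<le> real_of_ereal (len \<Gamma> e)" for y
    by (cases "len \<Gamma> e") auto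
  then show ?thesis
    using True e good(1)[OF assms e] arc(3)[OF e]
    by (auto simp: placed_def place_def sets simp flip: e_def)
qed (auto simp: placed_def place_def sets)

text \<open>Positions are real numbers, so an unbounded end is represented by its vertex instead of
  an infinite position.\<close>

lemma ex_place:
  assumes "valid_description \<Gamma> q"
  shows "\<exists>t y. t < nV x + nE x \<and> valid_description \<Gamma> (place t y) \<and>
    described_point \<Gamma> (place t y) = described_point \<Gamma> q"
proof (cases q)
  case (At v)
  then show ?thesis using assms by (intro exI[of _ v]) (auto simp: place_def sets)
next
  case (On e z)
  then have e: "e \<in> edges \<Gamma>" "0 \<le> z" "z \<le> len \<Gamma> e" using assms by auto
  show ?thesis
  proof (cases z)
    case (real y)
    then show ?thesis using On e by (intro exI[of _ "nV x + e"] exI[of _ y]) (auto simp: place_def sets)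
  next
    case PInf
    then have "len \<Gamma> e = \<infinity>" using e by simp
    moreover have "head (graph \<Gamma>) e \<in> vertices \<Gamma>" using e by simp
    ultimately show ?thesis using On PInf
      by (intro exI[of _ "head (graph \<Gamma>) e"]) (auto simp: place_def sets chart_def)
  qed (use e in simp)
qed

lemma edge_weight_unit: "edge_weight (unit_chips (map (\<lambda>i. place (\<tau> i) (y i)) [0..<n])) e =
    (\<Sum>i<n. if \<tau> i = nV x + e then 1 else 0)"
  by (induction n) (auto simp: place_def)

lemma vertex_weight_unit: "v < nV x \<Longrightarrow> vertex_weight (unit_chips (map (\<lambda>i. place (\<tau> i) (y i)) [0..<n])) v =
    (\<Sum>i<n. if \<tau> i = v then 1 else 0)"
  by (induction n) (auto simp: place_def)

text \<open>Weights depend on the types alone, not on the positions; so balancing is a purely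
  integral condition.\<close>

lemma edge_load: "edge_load x \<tau> e = edge_weight (instance_chips \<tau> u) e"
proof -
  have "(\<Sum>j<nD x. if kind_of x j = 1 \<and> index_of x j = e then coef_of x j else 0) =
      (\<Sum>j<nD x. (\<lambda>d. if desc_kind (snd d) = 1 \<and> desc_index (snd d) = e then fst d else 0) (ds ! j))"
    by (intro sum.cong) (auto simp: chip)
  also have "\<dots> = (\<Sum>d\<leftarrow>ds. if desc_kind (snd d) = 1 \<and> desc_index (snd d) = e then fst d else 0)"
    by (rule sum_chips)
  also have "\<dots> = edge_weight ds e"
    unfolding chip_sum_def
    by (intro arg_cong[where f = sum_list] map_cong)
       (auto simp: desc_kind_def desc_index_def split: description.splits)
  finally show ?thesis
    by (simp add: edge_load_def instance_chips_def chip_sum_neg places_def edge_weight_unit)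
qed

lemma vertex_load: "v < nV x \<Longrightarrow> vertex_load x \<tau> v = vertex_weight (instance_chips \<tau> u) v"
proof -
  have "(\<Sum>j<nD x. if kind_of x j = 0 \<and> index_of x j = v then coef_of x j else 0) =
      (\<Sum>j<nD x. (\<lambda>d. if desc_kind (snd d) = 0 \<and> desc_index (snd d) = v then fst d else 0) (ds ! j))"
    by (intro sum.cong) (auto simp: chip)
  also have "\<dots> = (\<Sum>d\<leftarrow>ds. if desc_kind (snd d) = 0 \<and> desc_index (snd d) = v then fst d else 0)"
    by (rule sum_chips)
  also have "\<dots> = vertex_weight ds v"
    unfolding chip_sum_def
    by (intro arg_cong[where f = sum_list] map_cong)
       (auto simp: desc_kind_def desc_index_def split: description.splits)
  finally show "v < nV x \<Longrightarrow> ?thesis"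
    by (simp add: vertex_load_def instance_chips_def chip_sum_neg places_def vertex_weight_unit)
qed

lemma balance_eqs_iff: "balance_eqs x \<tau> s \<longleftrightarrow> balanced \<Gamma> (instance_chips \<tau> u) s"
proof -
  have "(\<Sum>e<nE x. if tl_of x e = v then s e else 0) = (\<Sum>e | e \<in> edges \<Gamma> \<and> tail (graph \<Gamma>) e = v. s e)" for v
    by (simp add: sets arc sum.If_cases Int_def conj_commute cong: sum.cong if_cong) (rule sum.mono_neutral_cong, auto simp: arc)
  moreover have "(\<Sum>e<nE x. if hd_of x e = v then s e + edge_load x \<tau> e else 0) =
      (\<Sum>e | e \<in> edges \<Gamma> \<and> head (graph \<Gamma>) e = v. s e + edge_weight (instance_chips \<tau> u) e)" for v
    unfolding edge_load[of \<tau> _ u]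
    by (simp add: sets arc sum.If_cases Int_def conj_commute cong: sum.cong if_cong) (rule sum.mono_neutral_cong, auto simp: arc)
  ultimately show ?thesis
    by (simp add: balance_eqs_def balanced_def sets vertex_load[of _ \<tau> u] Ball_def)
qed

lemma kink_neg: "kink (neg_chips ds') e y = - kink ds' e y"
proof (induction ds')
  case (Cons d ds')
  then show ?case by (cases d) simp
qed simp

lemma kink_unit: "(\<And>i. i < n \<Longrightarrow> \<tau> i = nV x + e \<Longrightarrow> y i \<le> L) \<Longrightarrow>
    kink (unit_chips (map (\<lambda>i. place (\<tau> i) (y i)) [0..<n])) e L = (\<Sum>i<n. if \<tau> i = nV x + e then L - y i else 0)"
  by (induction n) (auto simp: place_def)

lemma edge_eq_iff:
  assumes g: "good u" and pl: "\<And>i. i < nP x \<Longrightarrow> placed x \<tau> u i" and e: "e < nE x" "len \<Gamma> e \<noteq> \<infinity>"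
  defines "h \<equiv> \<lambda>v. u (nK x + nP x + v)" and "L \<equiv> real_of_ereal (len \<Gamma> e)"
  shows "edge_eq x \<tau> s u e \<longleftrightarrow> h (head (graph \<Gamma>) e) - h (tail (graph \<Gamma>) e) =
       of_int (s e) * L + kink (instance_chips \<tau> u) e L"
proof -
  have L: "u (1 + e) = L" using good(1)[OF g e(1)] by (simp add: L_def)
  have "0 < len \<Gamma> e" using tropical e by (simp add: tropical_curve_def sets)
  then have lenL: "len \<Gamma> e = ereal L" using e(2) by (cases "len \<Gamma> e") (auto simp: L_def)
  have le: "u (nK x + i) \<le> L" if "i < nP x" "\<tau> i = nV x + e" for i
    using pl[OF that(1)] that(2) L arc(3)[OF e(1)] e(2) by (simp add: placed_def)
  have "(\<Sum>j<nD x. if kind_of x j = 1 \<and> index_of x j = e then of_int (coef_of x j) * (u (1 + e) - u (1 + nE x + j)) else 0) =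
      (\<Sum>j<nD x. (\<lambda>d. if desc_kind (snd d) = 1 \<and> desc_index (snd d) = e then of_int (fst d) * (L - description_real (snd d)) else 0) (ds ! j))"
    by (rule sum.cong, simp, simp add: chip(1-3) good(2)[OF g, simplified] L[simplified])
  also have "\<dots> = (\<Sum>d\<leftarrow>ds. if desc_kind (snd d) = 1 \<and> desc_index (snd d) = e then of_int (fst d) * (L - description_real (snd d)) else 0)"
    by (rule sum_chips)
  also have "\<dots> = kink ds e L"
  proof (unfold kink_def, intro arg_cong[where f = sum_list] map_cong refl)
    fix d assume "d \<in> set ds"
    obtain k p where d: "d = (k, p)" by (cases d)
    show "(if desc_kind (snd d) = 1 \<and> desc_index (snd d) = e then of_int (fst d) * (L - description_real (snd d)) else 0) =
        (case d of (k, p) \<Rightarrow> of_int k * hinge e p L)"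
    proof (cases p)
      case (On e' z)
      have "0 \<le> z" "z \<le> len \<Gamma> e'" using valid_chips_on[OF valid] \<open>d \<in> set ds\<close> d On by blast+
      with lenL have "e' = e \<Longrightarrow> z \<noteq> \<infinity> \<and> real_of_ereal z \<le> L" by (cases z) auto
      with d On show ?thesis by (auto simp: desc_kind_def desc_index_def)
    qed (simp add: d desc_kind_def)
  qed
  finally have "kink (instance_chips \<tau> u) e L = (\<Sum>i<nP x. if \<tau> i = nV x + e then L - u (nK x + i) else 0) -
     (\<Sum>j<nD x. if kind_of x j = 1 \<and> index_of x j = e then of_int (coef_of x j) * (u (1 + e) - u (1 + nE x + j)) else 0)"
    using le by (simp add: instance_chips_def places_def kink_neg kink_unit)
  then show ?thesis
    unfolding edge_eq_def arc(1,2)[OF e(1)] L h_def by (simp only: add_diff_eq)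
qed

lemma principal_eqs_iff:
  assumes "good u" "\<And>i. i < nP x \<Longrightarrow> placed x \<tau> u i"
  shows "principal_eqs x \<tau> s u \<longleftrightarrow> balanced \<Gamma> (instance_chips \<tau> u) s \<and>
    potential \<Gamma> (instance_chips \<tau> u) s (\<lambda>v. u (nK x + nP x + v))"
  using edge_eq_iff[OF assms] arc(3) balance_eqs_iff[of \<tau> s u]
  by (auto simp: principal_eqs_def potential_def sets)

end

section \<open>Coefficient bounds and invariance under sign equivalence\<close>

text \<open>Bounds on coefficients are carried along the syntax of a form: they add under sums and
  differences and multiply under scaling.\<close>

definition lform :: "nat \<Rightarrow> nat \<Rightarrow> ((nat \<Rightarrow> real) \<Rightarrow> real) \<Rightarrow> bool" where
  "lform b K \<phi> \<longleftrightarrow> (\<exists>c. (\<forall>i<K. \<bar>c i\<bar> \<le> int b) \<and> (\<forall>u. \<phi> u = lin K c u))"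

lemma lformI: "(\<And>i. i < K \<Longrightarrow> \<bar>c i\<bar> \<le> int b) \<Longrightarrow> (\<And>u. \<phi> u = lin K c u) \<Longrightarrow> lform b K \<phi>"
  by (auto simp: lform_def)

lemma lformE:
  assumes "lform b K \<phi>"
  obtains c where "\<And>i. i < K \<Longrightarrow> \<bar>c i\<bar> \<le> int b" "\<And>u. \<phi> u = lin K c u"
  using assms by (auto simp: lform_def)

lemma lform_var: "i < K \<Longrightarrow> lform 1 K (\<lambda>u. u i)"
  by (rule lformI[where c = "\<lambda>j. if j = i then 1 else 0"]) (simp_all add: lin_unit)

lemma lform_zero: "lform 0 K (\<lambda>u. 0)"
  by (rule lformI[where c = "\<lambda>j. 0"]) (simp_all add: lin_def)

lemma lform_scale:
  assumes "lform b K \<phi>"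
  shows "lform (nat \<bar>m\<bar> * b) K (\<lambda>u. of_int m * \<phi> u)"
  using assms
proof (rule lformE)
  fix c assume c: "\<And>i. i < K \<Longrightarrow> \<bar>c i\<bar> \<le> int b" "\<And>u. \<phi> u = lin K c u"
  show ?thesis
    by (rule lformI[where c = "\<lambda>i. m * c i"]) (simp_all add: c lin_scale abs_mult mult_left_mono)
qed

lemma lform_add:
  assumes "lform b K \<phi>" "lform b' K \<psi>"
  shows "lform (b + b') K (\<lambda>u. \<phi> u + \<psi> u)"
  using assms(1)
proof (rule lformE)
  fix c assume c: "\<And>i. i < K \<Longrightarrow> \<bar>c i\<bar> \<le> int b" "\<And>u. \<phi> u = lin K c u"
  show ?thesis using assms(2)
  proof (rule lformE)
    fix c' assume c': "\<And>i. i < K \<Longrightarrow> \<bar>c' i\<bar> \<le> int b'" "\<And>u. \<psi> u = lin K c' u"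
    show ?thesis
    proof (rule lformI[where c = "\<lambda>i. c i + c' i"])
      show "\<bar>c i + c' i\<bar> \<le> int (b + b')" if "i < K" for i using c(1)[OF that] c'(1)[OF that] by simp
    qed (simp add: c c' lin_add)
  qed
qed

lemma lform_diff:
  assumes "lform b K \<phi>" "lform b' K \<psi>"
  shows "lform (b + b') K (\<lambda>u. \<phi> u - \<psi> u)"
  using lform_add[OF assms(1) lform_scale[OF assms(2), of "-1"]] by simp

lemma lform_if: "lform b K \<phi> \<Longrightarrow> lform b K (\<lambda>u. if Q then \<phi> u else 0)"
  by (cases Q) (auto simp: lform_def lin_def intro: exI[of _ "\<lambda>j. 0"])

lemma lform_sum:
  fixes n :: nat
  assumes "\<And>i. i < n \<Longrightarrow> lform (b i) K (\<phi> i)"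
  shows "lform (\<Sum>i<n. b i) K (\<lambda>u. \<Sum>i<n. \<phi> i u)"
  using assms
proof (induction n)
  case 0
  then show ?case using lform_zero by simp
next
  case (Suc n)
  then show ?case using lform_add[of "\<Sum>i<n. b i" K "\<lambda>u. \<Sum>i<n. \<phi> i u" "b n" "\<phi> n"] by simp
qed

lemma lform_sgn:
  assumes "lform b K \<phi>" "b \<le> B" "sign_eq B K u v"
  shows "sgn (\<phi> u) = sgn (\<phi> v)"
  using assms(1)
proof (rule lformE)
  fix c assume c: "\<And>i. i < K \<Longrightarrow> \<bar>c i\<bar> \<le> int b" "\<And>u. \<phi> u = lin K c u"
  have "\<bar>c i\<bar> \<le> int B" if "i < K" for i using c(1)[OF that] assms(2) by linarith
  then show ?thesis using assms(3) c(2) by (simp add: sign_eq_def)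
qed

lemma placed_cong: "\<tau> i = \<tau>' i \<Longrightarrow> placed x \<tau> u i = placed x \<tau>' u i"
  by (simp add: placed_def)

text \<open>Codes determine types and slopes only on finite ranges of indices; the equations look no
  further.\<close>

lemma principal_eqs_cong:
  assumes \<tau>: "\<And>i. i < nP x \<Longrightarrow> \<tau> i = \<tau>' i" and s: "\<And>e. e < nE x \<Longrightarrow> s e = s' e"
  shows "principal_eqs x \<tau> s u = principal_eqs x \<tau>' s' u"
proof -
  have 1: "(\<Sum>i<nP x. F (\<tau> i) i) = (\<Sum>i<nP x. F (\<tau>' i) i)" for F :: "nat \<Rightarrow> nat \<Rightarrow> int"
    using \<tau> by (intro sum.cong) auto
  have 2: "(\<Sum>i<nP x. F (\<tau> i) i) = (\<Sum>i<nP x. F (\<tau>' i) i)" for F :: "nat \<Rightarrow> nat \<Rightarrow> real"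
    using \<tau> by (intro sum.cong) auto
  have load: "edge_load x \<tau> = edge_load x \<tau>'" "vertex_load x \<tau> = vertex_load x \<tau>'"
    using 1[of "\<lambda>t i. if t = nV x + _ then 1 else 0"] 1[of "\<lambda>t i. if t = _ then 1 else 0"]
    by (simp_all add: fun_eq_iff edge_load_def vertex_load_def)
  have "(\<Sum>e<nE x. F (s e) e) = (\<Sum>e<nE x. F (s' e) e)" for F :: "int \<Rightarrow> nat \<Rightarrow> int"
    using s by (intro sum.cong) auto
  from this[of "\<lambda>t e. if tl_of x e = _ then t else 0"] this[of "\<lambda>t e. if hd_of x e = _ then t + edge_load x \<tau>' e else 0"]
  have "balance_eqs x \<tau> s = balance_eqs x \<tau>' s'"
    unfolding balance_eqs_def load by simp
  moreover have "edge_eq x \<tau> s u e = edge_eq x \<tau>' s' u e" if "e < nE x" for e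
    using 2[of "\<lambda>t i. if t = nV x + e then u (1 + e) - u (nK x + i) else 0"] s[OF that]
    by (simp add: edge_eq_def)
  ultimately show ?thesis by (auto simp: principal_eqs_def)
qed

text \<open>Solvability is stated for chip lists, which may describe the same point differently. The
  detour through rational functions shows that only the divisor counts.\<close>

lemma solvable_cong:
  assumes "tropical_curve \<Gamma>" "valid_chips \<Gamma> L" "valid_chips \<Gamma> L'" "chip_div \<Gamma> L = chip_div \<Gamma> L'"
  shows "solvable \<Gamma> L = solvable \<Gamma> L'"
  unfolding solvable_def principal_iff[OF assms(1,2), symmetric] principal_iff[OF assms(1,3), symmetric] assms(4) ..

lemma chip_div_unit_cong:
  assumes "map (described_point \<Gamma>) qs = map (described_point \<Gamma>) rs"
  shows "chip_div \<Gamma> (unit_chips qs) = chip_div \<Gamma> (unit_chips rs)"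
proof -
  have eq: "chip_div \<Gamma> (unit_chips qs) = (\<Sum>p \<leftarrow> map (described_point \<Gamma>) qs. frag_of p)" for qs
    by (induction qs) auto
  show ?thesis by (simp only: eq assms)
qed

context encoded
begin

lemma index_less: "i < nP x \<Longrightarrow> nK x + i < nU x" "e < nE x \<Longrightarrow> 1 + e < nU x" "j < nD x \<Longrightarrow> 1 + nE x + j < nU x"
  "v < nV x \<Longrightarrow> nK x + nP x + v < nU x"
  by (simp_all add: nU_def nK_def)

lemma placed_sign:
  assumes se: "sign_eq B (nU x) u v" and B: "2 \<le> B" and i: "i < nP x"
  shows "placed x \<tau> u i = placed x \<tau> v i"
proof (cases "nV x \<le> \<tau> i \<and> \<tau> i < nV x + nE x")
  case True
  let ?e = "\<tau> i - nV x"
  have e: "?e < nE x" using True by linarith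
  have "sgn (u (nK x + i)) = sgn (v (nK x + i))"
    by (rule lform_sgn[OF lform_var _ se]) (use index_less(1)[OF i] B in auto)
  then have 1: "0 \<le> u (nK x + i) \<longleftrightarrow> 0 \<le> v (nK x + i)" by (metis zero_le_sgn_iff)
  have "sgn (u (1 + ?e) - u (nK x + i)) = sgn (v (1 + ?e) - v (nK x + i))"
    by (rule lform_sgn[OF lform_diff[OF lform_var lform_var] _ se]) (use index_less(1)[OF i] index_less(2)[OF e] B in auto)
  then have "0 \<le> u (1 + ?e) - u (nK x + i) \<longleftrightarrow> 0 \<le> v (1 + ?e) - v (nK x + i)" by (metis zero_le_sgn_iff)
  with 1 True show ?thesis by (simp add: placed_def)
qed (auto simp: placed_def)

text \<open>Here the slope is a coefficient of the linear form, so the slope bound is what keeps the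
  form within reach of \<open>sign_eq\<close>.\<close>

lemma edge_eq_sign:
  assumes se: "sign_eq (coef_max x) (nU x) u v" and e: "e < nE x" and s: "\<bar>s e\<bar> \<le> int (slope_max x)"
  shows "edge_eq x \<tau> s u e = edge_eq x \<tau> s v e"
proof -
  let ?\<psi> = "\<lambda>u. (u (nK x + nP x + hd_of x e) - u (nK x + nP x + tl_of x e)) - (of_int (s e) * u (1 + e) +
       (\<Sum>i<nP x. if \<tau> i = nV x + e then u (1 + e) - u (nK x + i) else 0) -
       (\<Sum>j<nD x. if kind_of x j = 1 \<and> index_of x j = e then of_int (coef_of x j) * (u (1 + e) - u (1 + nE x + j)) else 0))"
  let ?b = "(1 + 1) + ((nat \<bar>s e\<bar> * 1 + (\<Sum>i<nP x. 1 + 1)) + (\<Sum>j<nD x. nat \<bar>coef_of x j\<bar> * (1 + 1)))"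
  have ends: "hd_of x e < nV x" "tl_of x e < nV x"
    using arc(1,2)[OF e] head_in_verts[of e] tail_in_verts[of e] e by (simp_all add: sets)
  have H: "lform (1 + 1) (nU x) (\<lambda>u. u (nK x + nP x + hd_of x e) - u (nK x + nP x + tl_of x e))"
    by (rule lform_diff[OF lform_var lform_var]) (rule index_less(4), rule ends)+
  have A: "lform 1 (nU x) (\<lambda>u. u (1 + e))" by (rule lform_var) (rule index_less(2)[OF e])
  have I: "lform (1 + 1) (nU x) (\<lambda>u. if \<tau> i = nV x + e then u (1 + e) - u (nK x + i) else 0)" if "i < nP x" for i
    by (rule lform_if, rule lform_diff[OF A], rule lform_var, rule index_less(1)[OF that])
  have J: "lform (nat \<bar>coef_of x j\<bar> * (1 + 1)) (nU x)
      (\<lambda>u. if kind_of x j = 1 \<and> index_of x j = e then of_int (coef_of x j) * (u (1 + e) - u (1 + nE x + j)) else 0)"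
    if "j < nD x" for j
    by (rule lform_if, rule lform_scale, rule lform_diff[OF A], rule lform_var, rule index_less(3)[OF that])
  have lf: "lform ?b (nU x) ?\<psi>"
    by (rule lform_diff[OF H lform_diff[OF lform_add[OF lform_scale[OF A] lform_sum[OF I]] lform_sum[OF J]]])
  have le: "?b \<le> coef_max x"
  proof -
    have "int (\<Sum>j<nD x. nat \<bar>coef_of x j\<bar> * (1 + 1)) = (\<Sum>j<nD x. 2 * \<bar>coef_of x j\<bar>)" by simp
    also have "\<dots> = 2 * (\<Sum>j<nD x. \<bar>coef_of x j\<bar>)" by (rule sum_distrib_left[symmetric])
    finally have "(\<Sum>j<nD x. nat \<bar>coef_of x j\<bar> * (1 + 1)) = 2 * nat (\<Sum>j<nD x. \<bar>coef_of x j\<bar>)" by linarith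
    moreover have "nat \<bar>s e\<bar> \<le> slope_max x" using s by linarith
    moreover have "(\<Sum>i<nP x. 1 + 1) = 2 * nP x" by simp
    ultimately show ?thesis unfolding coef_max_def by linarith
  qed
  have "sgn (?\<psi> u) = sgn (?\<psi> v)" by (rule lform_sgn[OF lf le se])
  then have "?\<psi> u = 0 \<longleftrightarrow> ?\<psi> v = 0" 
    using sgn_eq_0_iff[of "?\<psi> u"] sgn_eq_0_iff[of "?\<psi> v"] by argo
  then show ?thesis unfolding edge_eq_def by (simp only: right_minus_eq)
qed

text \<open>The matrix after the real quantifiers: the chosen points lie on the curve, and no choice
  of types for the others and of bounded slopes solves the equations. The vector holds the
  parameters, all positions and the vertex values.\<close>

definition Phi :: "nat \<Rightarrow> (nat \<Rightarrow> nat) \<Rightarrow> (nat \<Rightarrow> real) \<Rightarrow> bool" where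
  "Phi d \<tau> v \<longleftrightarrow> (\<forall>i<d. placed x \<tau> v i) \<and>
     (\<forall>\<tau>' s. (\<forall>i<d. \<tau>' i = \<tau> i) \<longrightarrow> (\<forall>e<nE x. \<bar>s e\<bar> \<le> int (slope_max x)) \<longrightarrow>
        (\<forall>i<nP x. d \<le> i \<longrightarrow> placed x \<tau>' v i) \<longrightarrow> \<not> principal_eqs x \<tau>' s v)"

lemma Phi_sign:
  assumes d: "d \<le> nP x" and se: "sign_eq (coef_max x) (nU x) u v"
  shows "Phi d \<tau> u = Phi d \<tau> v"
proof -
  have pl: "placed x \<tau> u i = placed x \<tau> v i" if "i < nP x" for \<tau> i
    using placed_sign[OF se _ that] by (simp add: coef_max_def)
  have "principal_eqs x \<tau> s u = principal_eqs x \<tau> s v" if "\<forall>e<nE x. \<bar>s e\<bar> \<le> int (slope_max x)" for \<tau> s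
    using that edge_eq_sign[OF se] unfolding principal_eqs_def by blast
  moreover have "(\<forall>i<d. placed x \<tau> u i) = (\<forall>i<d. placed x \<tau> v i)" using pl d by auto
  moreover have "(\<forall>i<nP x. d \<le> i \<longrightarrow> placed x \<tau> u i) = (\<forall>i<nP x. d \<le> i \<longrightarrow> placed x \<tau> v i)" for \<tau> using pl by auto
  ultimately show ?thesis unfolding Phi_def by blast
qed

lemma total_abs_instance: "3 * total_weight (abs_chips (instance_chips \<tau> u)) = int (slope_max x)"
proof -
  have "total_weight (abs_chips (neg_chips ds')) = total_weight (abs_chips ds')" for ds' by (induction ds') auto
  moreover have "total_weight (abs_chips (unit_chips qs)) = int (length qs)" for qs by (induction qs) auto
  moreover have "0 \<le> total_weight (abs_chips ds)" by (rule abs_chip_sum_nonneg)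
  ultimately show ?thesis
    by (simp add: instance_chips_def places_def slope_max_def coef_sum)
qed

lemma valid_instance:
  assumes "good u" "\<And>i. i < nP x \<Longrightarrow> placed x \<tau> u i"
  shows "valid_chips \<Gamma> (instance_chips \<tau> u)"
  using assms(2) placed_iff[OF assms(1)] valid by (auto simp: instance_chips_def places_def)

text \<open>Points become types and reals, and vertex values become coordinates quantified together
  with the positions of \<open>F\<close>. Restricting to bounded slopes loses nothing by
  \<open>slope_bound\<close>.\<close>

lemma obstructed_iff:
  assumes d: "int d \<le> total_weight ds"
  shows "obstructed \<Gamma> ds d \<longleftrightarrow> (\<exists>\<tau> u. good u \<and> (\<forall>v. (\<forall>i<nK x + d. v i = u i) \<longrightarrow> Phi d \<tau> v))"
proof -
  have nP: "nP x = nat (total_weight ds)" by (simp add: nP_def degree)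
  then have dn: "d \<le> nP x" using d by linarith
  obtain t y where ty: "\<And>q. valid_description \<Gamma> q \<Longrightarrow> t q < nV x + nE x"
    "\<And>q. valid_description \<Gamma> q \<Longrightarrow> valid_description \<Gamma> (place (t q) (y q))"
    "\<And>q. valid_description \<Gamma> q \<Longrightarrow> described_point \<Gamma> (place (t q) (y q)) = described_point \<Gamma> q"
    using ex_place by metis
  \<comment> \<open>Replacing points by \<open>place\<close> may change their descriptions but not
    the points, hence not solvability.\<close>
  have transfer: "solvable \<Gamma> (instance_chips \<tau> v) = solvable \<Gamma> (neg_chips ds @ unit_chips (qs @ rs))"
    if g: "good v" and pl: "\<And>i. i < nP x \<Longrightarrow> placed x \<tau> v i"
      and qs: "length qs = d" "\<forall>q\<in>set qs. valid_description \<Gamma> q"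
      and rs: "length rs = nP x - d" "\<forall>q\<in>set rs. valid_description \<Gamma> q"
      and 1: "\<And>i. i < d \<Longrightarrow> described_point \<Gamma> (place (\<tau> i) (v (nK x + i))) = described_point \<Gamma> (qs ! i)"
      and 2: "\<And>i. i < nP x \<Longrightarrow> d \<le> i \<Longrightarrow> described_point \<Gamma> (place (\<tau> i) (v (nK x + i))) = described_point \<Gamma> (rs ! (i - d))"
    for \<tau> v qs rs
  proof (rule solvable_cong[OF tropical valid_instance[OF g pl]])
    show "valid_chips \<Gamma> (neg_chips ds @ unit_chips (qs @ rs))" using valid qs rs by simp
    have "map (described_point \<Gamma>) (places \<tau> v) = map (described_point \<Gamma>) (qs @ rs)"
      by (rule nth_equalityI) (use qs(1) rs(1) dn 1 2 in \<open>auto simp: places_def nth_append\<close>)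
    from chip_div_unit_cong[OF this]
    show "chip_div \<Gamma> (instance_chips \<tau> v) = chip_div \<Gamma> (neg_chips ds @ unit_chips (qs @ rs))"
      by (simp only: instance_chips_def chip_div_simps(3))
  qed
  show ?thesis
  proof
    assume "obstructed \<Gamma> ds d"
    then obtain qs where qs: "length qs = d" "\<forall>q\<in>set qs. valid_description \<Gamma> q"
      and no: "\<And>rs. length rs = nP x - d \<Longrightarrow> \<forall>q \<in> set rs. valid_description \<Gamma> q \<Longrightarrow>
          \<not> solvable \<Gamma> (neg_chips ds @ unit_chips (qs @ rs))"
      using d unfolding obstructed_def nP by fastforce
    have q: "valid_description \<Gamma> (qs ! i)" if "i < d" for i using that qs by simp
    define \<tau> where "\<tau> i = t (qs ! i)" for i
    define u where "u i = (if i < nK x then params x i else y (qs ! (i - nK x)))" for i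
    have "Phi d \<tau> v" if v: "\<And>i. i < nK x + d \<Longrightarrow> v i = u i" for v
    proof -
      have g: "good v" using v by (simp add: good_def u_def)
      have vi: "v (nK x + i) = y (qs ! i)" if "i < d" for i using v[of "nK x + i"] that by (simp add: u_def)
      have pl: "placed x \<tau> v i" if "i < d" for i
        using placed_iff[OF g, of \<tau> i] ty(1,2)[OF q[OF that]] by (simp add: vi[OF that] \<tau>_def)
      have "\<not> principal_eqs x \<tau>' s v" if \<tau>': "\<And>i. i < d \<Longrightarrow> \<tau>' i = \<tau> i"
        and pl': "\<And>i. i < nP x \<Longrightarrow> d \<le> i \<Longrightarrow> placed x \<tau>' v i" for \<tau>' s
      proof
        assume pr: "principal_eqs x \<tau>' s v"
        have pl'': "placed x \<tau>' v i" if "i < nP x" for i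
        proof (cases "i < d")
          case True
          then show ?thesis using pl[OF True] placed_cong[of \<tau>' i \<tau> x v] \<tau>' by simp
        qed (use pl' that in auto)
        let ?rs = "map (\<lambda>i. place (\<tau>' i) (v (nK x + i))) [d..<nP x]"
        have rs: "length ?rs = nP x - d" "\<forall>q \<in> set ?rs. valid_description \<Gamma> q"
          using pl' placed_iff[OF g] by auto
        have "solvable \<Gamma> (instance_chips \<tau>' v)"
          using pr principal_eqs_iff[OF g pl''] unfolding solvable_def by blast
        moreover have "solvable \<Gamma> (instance_chips \<tau>' v) = solvable \<Gamma> (neg_chips ds @ unit_chips (qs @ ?rs))"
        proof (rule transfer[OF g pl'' qs rs])
          show "described_point \<Gamma> (place (\<tau>' i) (v (nK x + i))) = described_point \<Gamma> (qs ! i)" if "i < d" for i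
            using ty(3)[OF q[OF that]] \<tau>'[OF that] vi[OF that] by (simp add: \<tau>_def)
        qed auto
        ultimately show False using no[OF rs] by blast
      qed
      with pl show ?thesis by (auto simp: Phi_def)
    qed
    moreover have "good u" by (simp add: good_def u_def)
    ultimately show "\<exists>\<tau> u. good u \<and> (\<forall>v. (\<forall>i<nK x + d. v i = u i) \<longrightarrow> Phi d \<tau> v)" by blast
  next
    assume "\<exists>\<tau> u. good u \<and> (\<forall>v. (\<forall>i<nK x + d. v i = u i) \<longrightarrow> Phi d \<tau> v)"
    then obtain \<tau> u where g: "good u" and Phi: "\<And>v. (\<And>i. i < nK x + d \<Longrightarrow> v i = u i) \<Longrightarrow> Phi d \<tau> v" by blast
    let ?qs = "map (\<lambda>i. place (\<tau> i) (u (nK x + i))) [0..<d]"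
    have pl: "placed x \<tau> u i" if "i < d" for i using Phi[of u] that by (simp add: Phi_def)
    then have qs: "length ?qs = d" "\<forall>q\<in>set ?qs. valid_description \<Gamma> q" using placed_iff[OF g] by auto
    have "\<not> solvable \<Gamma> (neg_chips ds @ unit_chips (?qs @ rs))"
      if rs: "length rs = nP x - d" "\<forall>q \<in> set rs. valid_description \<Gamma> q" for rs
    proof
      assume sol: "solvable \<Gamma> (neg_chips ds @ unit_chips (?qs @ rs))"
      have r: "valid_description \<Gamma> (rs ! (i - d))" if "d \<le> i" "i < nP x" for i
        using that rs by simp
      define \<tau>' where "\<tau>' i = (if i < d then \<tau> i else t (rs ! (i - d)))" for i
      \<comment> \<open>The vector of the parameters, \<open>E\<close>, the positions of
        \<open>F\<close> and then the values \<open>h\<close>, which are still to be found.\<close>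
      define w where "w h i = (if i < nK x + d then u i else if i < nK x + nP x then y (rs ! (i - nK x - d)) else h (i - nK x - nP x))"
        for h :: "nat \<Rightarrow> real" and i
      have gw: "good (w h)" for h using g by (simp add: good_def w_def)
      have w2: "w h (nK x + i) = y (rs ! (i - d))" if "d \<le> i" "i < nP x" for h i
        using that by (simp add: w_def)
      have plw: "placed x \<tau>' (w h) i" if "i < nP x" for h i
      proof (cases "i < d")
        case True
        then show ?thesis using pl[OF True] placed_iff[OF gw] placed_iff[OF g] by (simp add: \<tau>'_def w_def)
      next
        case False
        then show ?thesis using ty(1,2)[OF r[of i]] that w2[of i h] placed_iff[OF gw] by (simp add: \<tau>'_def)
      qed
      \<comment> \<open>The chips do not see the vertex values. So values obtained for the chips of
        \<open>w (\<lambda>_. 0)\<close> may afterwards be inserted into the vector itself.\<close>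
      have inst: "instance_chips \<tau>' (w h) = instance_chips \<tau>' (w h')" for h h'
      proof -
        have "places \<tau>' (w h) = places \<tau>' (w h')"
          unfolding places_def by (rule map_cong) (simp_all add: w_def)
        then show ?thesis by (simp add: instance_chips_def)
      qed
      have "solvable \<Gamma> (instance_chips \<tau>' (w (\<lambda>_. 0))) = solvable \<Gamma> (neg_chips ds @ unit_chips (?qs @ rs))"
      proof (rule transfer[OF gw plw qs rs])
        show "described_point \<Gamma> (place (\<tau>' i) (w (\<lambda>_. 0) (nK x + i))) = described_point \<Gamma> (?qs ! i)" if "i < d" for i
          using that by (simp add: \<tau>'_def w_def)
        show "described_point \<Gamma> (place (\<tau>' i) (w (\<lambda>_. 0) (nK x + i))) = described_point \<Gamma> (rs ! (i - d))"
          if "i < nP x" "d \<le> i" for i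
          using ty(3)[OF r[OF that(2,1)]] w2[OF that(2,1)] that by (simp add: \<tau>'_def)
      qed
      with sol obtain s h where sh: "balanced \<Gamma> (instance_chips \<tau>' (w (\<lambda>_. 0))) s"
        "potential \<Gamma> (instance_chips \<tau>' (w (\<lambda>_. 0))) s h" by (auto simp: solvable_def)
      then have sh': "balanced \<Gamma> (instance_chips \<tau>' (w h)) s" "potential \<Gamma> (instance_chips \<tau>' (w h)) s h"
        using inst[of h "\<lambda>_. 0"] by simp_all
      have "\<bar>s e\<bar> \<le> int (slope_max x)" if "e < nE x" for e
        using slope_bound[OF tropical valid_instance[OF gw plw] sh', of e] that total_abs_instance by (simp add: sets)
      moreover have "(\<lambda>v. w h (nK x + nP x + v)) = h" using dn by (auto simp: w_def fun_eq_iff)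
      then have "principal_eqs x \<tau>' s (w h)"
        using principal_eqs_iff[OF gw[of h] plw[of _ h], of s] sh' by simp
      moreover have "\<tau>' i = \<tau> i" if "i < d" for i using that by (simp add: \<tau>'_def)
      moreover have "Phi d \<tau> (w h)" by (rule Phi) (simp add: w_def)
      ultimately show False using plw unfolding Phi_def by blast
    qed
    then show "obstructed \<Gamma> ds d" using qs unfolding obstructed_def nP by blast
  qed
qed

lemma type_of_less: "i < d \<Longrightarrow> type_of x d tE tF i = dig (nV x + nE x) tE i"
  by (simp add: type_of_def)

text \<open>Functions and codes quantify over the same thing: bounded slopes are shifted digits, and
  the types are digits because points that are \<open>placed\<close> have a type below
  \<open>nV x + nE x\<close>.\<close>

lemma Phi_code:
  assumes d: "d \<le> nP x"
  shows "Phi d (type_of x d tE 0) v \<longleftrightarrow> (\<forall>i<d. placed x (type_of x d tE 0) v i) \<and>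
        (\<forall>tF < (nV x + nE x) ^ nP x. \<forall>c < (2 * slope_max x + 1) ^ nE x.
           (\<forall>i<nP x. d \<le> i \<longrightarrow> placed x (type_of x d tE tF) v i) \<longrightarrow>
           \<not> principal_eqs x (type_of x d tE tF) (slope_of x c) v)"
    (is "_ \<longleftrightarrow> ?A \<and> ?B")
proof
  assume P: "Phi d (type_of x d tE 0) v"
  have "\<bar>slope_of x c e\<bar> \<le> int (slope_max x)" for c e
    using dig_less[of "2 * slope_max x + 1" c e] by (auto simp: slope_of_def)
  with P show "?A \<and> ?B" unfolding Phi_def by (auto simp: type_of_less)
next
  assume AB: "?A \<and> ?B"
  have "\<not> principal_eqs x \<tau>' s v" if \<tau>': "\<And>i. i < d \<Longrightarrow> \<tau>' i = type_of x d tE 0 i"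
    and s: "\<And>e. e < nE x \<Longrightarrow> \<bar>s e\<bar> \<le> int (slope_max x)"
    and pl: "\<And>i. i < nP x \<Longrightarrow> d \<le> i \<Longrightarrow> placed x \<tau>' v i" for \<tau>' s
  proof -
    have "\<tau>' i < nV x + nE x" if "i < nP x" for i
    proof (cases "i < d")
      case True
      then show ?thesis using AB \<tau>'[OF True] by (auto simp: placed_def)
    qed (use pl[OF that] in \<open>auto simp: placed_def\<close>)
    then obtain tF where tF: "tF < (nV x + nE x) ^ nP x" "\<And>i. i < nP x \<Longrightarrow> dig (nV x + nE x) tF i = \<tau>' i"
      using ex_digits[of "nP x" \<tau>'] by blast
    have "nat (s e + int (slope_max x)) < 2 * slope_max x + 1" if "e < nE x" for e using s[OF that] by auto
    then obtain c where c: "c < (2 * slope_max x + 1) ^ nE x"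
      "\<And>e. e < nE x \<Longrightarrow> dig (2 * slope_max x + 1) c e = nat (s e + int (slope_max x))"
      using ex_digits[of "nE x" "\<lambda>e. nat (s e + int (slope_max x))"] by blast
    have t: "type_of x d tE tF i = \<tau>' i" if "i < nP x" for i
      using tF(2)[OF that] \<tau>' by (auto simp: type_of_def)
    have sc: "slope_of x c e = s e" if "e < nE x" for e
      using c(2)[OF that] s[OF that] by (auto simp: slope_of_def)
    have "placed x (type_of x d tE tF) v i" if "i < nP x" "d \<le> i" for i
      using pl[OF that] placed_cong[of "type_of x d tE tF" i \<tau>' x v] t[OF that(1)] by simp
    with AB tF(1) c(1) have "\<not> principal_eqs x (type_of x d tE tF) (slope_of x c) v" by blast
    then show ?thesis using principal_eqs_cong[OF t sc] by simp
  qed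
  with AB show "Phi d (type_of x d tE 0) v" unfolding Phi_def by blast
qed

lemma Phi_cong:
  assumes "\<And>i. i < d \<Longrightarrow> \<tau> i = \<tau>' i"
  shows "Phi d \<tau> v = Phi d \<tau>' v"
proof -
  have "(\<forall>i<d. placed x \<tau> v i) = (\<forall>i<d. placed x \<tau>' v i)" using assms placed_cong by metis
  then show ?thesis using assms unfolding Phi_def by simp
qed

lemma search_cond_iff: "search_cond x d \<longleftrightarrow> obstructed \<Gamma> ds d"
proof (cases "degree_of x < int d")
  case True
  then show ?thesis by (simp add: search_cond_def obstructed_def degree)
next
  case False
  then have d: "int d \<le> total_weight ds" by (simp add: degree)
  then have dn: "d \<le> nP x" by (simp add: nP_def degree)
  have B: "1 \<le> coef_max x" by (simp add: coef_max_def)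
  have nU: "nU x = nK x + d + (nP x - d + nV x)" using dn by (simp add: nU_def)
  have nK: "0 < nK x" "params x 0 = 1" by (simp_all add: nK_def params_def)
  have "vertices \<Gamma> \<noteq> {}"
    using tropical by (auto simp: tropical_curve_def Digraph_Component.connected_def strongly_connected_def)
  then have V: "0 < nV x + nE x" by (auto simp: sets)
  have "d + (nP x - d + nV x) = nP x + nV x" using dn by simp
  then have r1: "radius1 x = code_bound (coef_max x) (nK x) (d + (nP x - d + nV x))" by (simp add: radius1_def)
  \<comment> \<open>With the types of \<open>E\<close> fixed, the first block has \<open>d\<close>
    positions and the second the remaining \<open>nP x - d\<close> positions and the
    \<open>nV x\<close> vertex values.\<close>
  have bq: "(\<exists>u. good u \<and> (\<forall>v. (\<forall>i<nK x + d. v i = u i) \<longrightarrow> Phi d \<tau> v)) \<longleftrightarrow>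
    (\<exists>cE < (2 * radius1 x + 1) ^ (nU x * nK x + 1). \<forall>cF < (2 * radius2 x + 1) ^ (nU x * nK x + 1).
       Phi d \<tau> (vector_of x d cE cF))" for \<tau>
  proof -
    have det: "Phi d \<tau> u = Phi d \<tau> v"
      if "sign_eq (coef_max x) (nK x + d + (nP x - d + nV x)) u v" for u v
      using Phi_sign[OF dn, of u v] that by (simp only: nU)
    show ?thesis
      unfolding good_def vector_of_def[abs_def]
      by (rule bounded_quantifiers[where \<Phi> = "Phi d \<tau>" and p = "params x" and k = "nK x" and d = d and n = "nP x - d + nV x",
          OF nK(2,1) B det nU r1 radius2_def[of x]])
  qed
  have "search_cond x d \<longleftrightarrow> (\<exists>tE < (nV x + nE x) ^ nP x. \<exists>cE < (2 * radius1 x + 1) ^ (nU x * nK x + 1).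
      \<forall>cF < (2 * radius2 x + 1) ^ (nU x * nK x + 1). Phi d (type_of x d tE 0) (vector_of x d cE cF))"
    using False unfolding search_cond_def Phi_code[OF dn] by simp
  also have "\<dots> \<longleftrightarrow> (\<exists>tE < (nV x + nE x) ^ nP x. \<exists>u. good u \<and> (\<forall>v. (\<forall>i<nK x + d. v i = u i) \<longrightarrow> Phi d (type_of x d tE 0) v))"
    by (simp only: bq)
  also have "\<dots> \<longleftrightarrow> (\<exists>\<tau> u. good u \<and> (\<forall>v. (\<forall>i<nK x + d. v i = u i) \<longrightarrow> Phi d \<tau> v))"
  proof
    assume "\<exists>\<tau> u. good u \<and> (\<forall>v. (\<forall>i<nK x + d. v i = u i) \<longrightarrow> Phi d \<tau> v)"
    then obtain \<tau> u where \<tau>: "good u" "\<And>v. (\<And>i. i < nK x + d \<Longrightarrow> v i = u i) \<Longrightarrow> Phi d \<tau> v" by blast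
    have lt: "\<tau> i < nV x + nE x" if "i < d" for i
      using \<tau>(2)[of u] that by (simp add: Phi_def placed_def)
    \<comment> \<open>Types outside \<open>E\<close> are coded as \<open>0\<close>, a legal digit
      because the curve has a vertex.\<close>
    have "(if i < d then \<tau> i else 0) < nV x + nE x" for i using lt V by simp
    then obtain tE where tE: "tE < (nV x + nE x) ^ nP x"
      "\<And>i. i < nP x \<Longrightarrow> dig (nV x + nE x) tE i = (if i < d then \<tau> i else 0)"
      using ex_digits[of "nP x" "\<lambda>i. if i < d then \<tau> i else 0"] by blast
    have "type_of x d tE 0 i = \<tau> i" if "i < d" for i
      using tE(2)[of i] that dn by (simp add: type_of_less)
    then have "Phi d (type_of x d tE 0) v = Phi d \<tau> v" for v by (rule Phi_cong)
    with \<tau> tE(1) show "\<exists>tE < (nV x + nE x) ^ nP x. \<exists>u. good u \<and> (\<forall>v. (\<forall>i<nK x + d. v i = u i) \<longrightarrow> Phi d (type_of x d tE 0) v)"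
      by blast
  qed blast
  also have "\<dots> \<longleftrightarrow> obstructed \<Gamma> ds d" by (rule obstructed_iff[OF d, symmetric])
  finally show ?thesis .
qed

end

theorem corollary4p4:
  shows "\<exists>P :: com. \<forall>(\<Gamma> :: (nat, nat) metric_graph) (D :: (nat, nat) divisor) ds.
    tropical_curve \<Gamma> \<longrightarrow> D \<in> Div \<Gamma> \<longrightarrow> numbered \<Gamma> \<longrightarrow> describes \<Gamma> ds D \<longrightarrow>
      computes P (encode \<Gamma> ds) (divisor_rank \<Gamma> D)"
proof -
  obtain P where P: "\<And>x d. wf_input x \<Longrightarrow> search_cond x d \<Longrightarrow> computes P x (int (LEAST d. search_cond x d) - 1)"
    using computes_Least_search_cond by blast
  have "computes P (encode \<Gamma> ds) (divisor_rank \<Gamma> D)"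
    if \<Gamma>: "tropical_curve \<Gamma>" "numbered \<Gamma>" and ds: "describes \<Gamma> ds D"
    for \<Gamma> :: "(nat, nat) metric_graph" and D :: "(nat, nat) divisor" and ds
  proof -
    have "valid_chips \<Gamma> ds" using ds by (simp add: describes_def valid_chips_def)
    then interpret encoded \<Gamma> ds "encode \<Gamma> ds" using \<Gamma> by unfold_locales auto
    obtain d where "obstructed \<Gamma> ds d" using divisor_rank_eq(2)[OF \<Gamma>(1) ds] by blast
    then have "computes P (encode \<Gamma> ds) (int (LEAST d. search_cond (encode \<Gamma> ds) d) - 1)"
      by (intro P[OF wf, of d]) (simp add: search_cond_iff)
    then show ?thesis by (simp only: search_cond_iff divisor_rank_eq(1)[OF \<Gamma>(1) ds])
  qed
  then show ?thesis by blast
qed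

end
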